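(* Fix $\gamma\in\mathbb R$ and fixed $\alpha>1$. Suppose $(\log n)^2\ll k\ll\sqrt n$ and $m=\frac{k^2n}{4\log n}\big(1+\frac{\gamma}{\sqrt{\log n}}\big)$ (rounded to an integer). Let $A=\{\Lambda(G)\ge1\}$ and $B=\{\Delta(G)\ge t^*\}$. Then the symmetric difference $A\triangle B$ satisfies $\mathbb P_0(A\triangle B)=o(1)$ and $\mathbb P_1(A\triangle B)=o(1)$.
   Context: Let $n,m,k$ be positive integers and $N=\binom n2$; all asymptotics are as $n\to\infty$ with $k=k(n)$, $m=m(n)$, and $a\ll b$ means $a/b\to0$. The null distribution $\mathbb P_0$ is the Erdős–Rényi model $G(n,m)$: the uniform distribution over graphs on vertex set $[n]$ with exactly $m$ edges. The planted distribution $\mathbb P_1$ is the law of the random graph obtained as follows: choose a hub vertex $v_*\in[n]$ uniformly at random; choose a uniformly random set $S$ of $k$ of the $n-1$ possible edges incident to $v_*$; then choose a uniformly random set of $m-k$ edges among the $N-k$ possible edges not in $S$; the graph consists of these $m$ edges. $\Lambda(G)=\frac{d\mathbb P_1}{d\mathbb P_0}(G)$ is the likelihood ratio and $\Delta(G)$ the maximum degree of $G$. For a fixed $\alpha>0$, the threshold is $$t^*=\frac{2m}{n}+\sqrt{\frac{2m}{n}\Big(1-\frac mN\Big)}\sqrt{2\log n-\frac1\alpha\log\log n}.$$ *)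

theory Defs
  imports "HOL-Probability.Probability"
begin

text \<open>Simple graphs on the vertex set [n], represented as {0..<n}; an edge is a
2-element subset of the vertex set, a graph is a set of edges.\<close>

definition all_edges :: "nat \<Rightarrow> nat set set" where
  "all_edges n = {e. e \<subseteq> {..<n} \<and> card e = 2}"

definition N_pairs :: "nat \<Rightarrow> nat" where
  "N_pairs n = n choose 2"

definition P0 :: "nat \<Rightarrow> nat \<Rightarrow> nat set set pmf" where
  "P0 n m = pmf_of_set {G. G \<subseteq> all_edges n \<and> card G = m}"

definition incident_edges :: "nat \<Rightarrow> nat \<Rightarrow> nat set set" where
  "incident_edges n v = {e \<in> all_edges n. v \<in> e}"

definition P1 :: "nat \<Rightarrow> nat \<Rightarrow> nat \<Rightarrow> nat set set pmf" where
  "P1 n m k =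
     do { v \<leftarrow> pmf_of_set {..<n};
          S \<leftarrow> pmf_of_set {S. S \<subseteq> incident_edges n v \<and> card S = k};
          R \<leftarrow> pmf_of_set {R. R \<subseteq> all_edges n - S \<and> card R = m - k};
          return_pmf (S \<union> R) }"

definition LR :: "nat \<Rightarrow> nat \<Rightarrow> nat \<Rightarrow> nat set set \<Rightarrow> real" where
  "LR n m k G = pmf (P1 n m k) G / pmf (P0 n m) G"

definition degree :: "nat set set \<Rightarrow> nat \<Rightarrow> nat" where
  "degree G v = card {e \<in> G. v \<in> e}"

definition max_degree :: "nat \<Rightarrow> nat set set \<Rightarrow> nat" where
  "max_degree n G = Max (degree G ` {..<n})"

definition t_star :: "real \<Rightarrow> nat \<Rightarrow> nat \<Rightarrow> real" where
  "t_star \<alpha> n m =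
     2 * real m / real n
     + sqrt (2 * real m / real n * (1 - real m / real (N_pairs n)))
       * sqrt (2 * ln (real n) - (1 / \<alpha>) * ln (ln (real n)))"

end

theory Submission
  imports Defs "HOL-Real_Asymp.Real_Asymp"
begin

text \<open>
The likelihood ratio is a sum \<open>\<Lambda>(G) = \<Sum>v. w(deg v)\<close> with an increasing weight \<open>w\<close>, so planted
probabilities are \<open>P0\<close>-expectations weighted by \<open>\<Lambda>\<close>, and everything reduces to the hypergeometric
law of one degree and the joint law of two degrees under \<open>P0\<close>. With \<open>D = 2m/n\<close>, the weight \<open>w\<close> tends
to 0 below \<open>t* - \<epsilon> sqrt D\<close> and to infinity above \<open>t* + \<epsilon> sqrt D\<close>, while the planted hub falls into
the window between with probability \<open>O(\<epsilon>)\<close>. Since \<open>\<alpha> > 1\<close>, a union bound with the sharp Gaussian tail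
gives \<open>P0(B) \<rightarrow> 0\<close>. The part \<open>Y\<close> of \<open>\<Lambda>\<close> carried by degrees below the window has a mean bounded away
from 1, because the hub exceeds \<open>t*\<close> with probability bounded below, and its variance vanishes because
two degrees are almost independent; hence \<open>P0(A) \<rightarrow> 0\<close>. Finally, the planted probability of the
symmetric difference is at most the expectation of \<open>Y\<close> over it plus the planted mass of the window,
and the former is small since \<open>Y\<close> is bounded in \<open>L\<^sup>2\<close>.
\<close>


subsection \<open>Real inequalities and limits\<close>

lemma sum_lessThan_real: "(\<Sum>i<k. real i) = real k * (real k - 1) / 2"
  by (induction k) (auto simp: field_simps)

lemma exp_diff_sq_le_one_plus:
  fixes z :: real
  assumes "\<bar>z\<bar> \<le> 1 / 2"
  shows "exp (z - 2 * z\<^sup>2) \<le> 1 + z"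
proof -
  have "z - 2 * z\<^sup>2 \<le> ln (1 + z)"
    using abs_ln_one_plus_x_minus_x_bound[OF assms] by (simp add: abs_le_iff)
  then show ?thesis using assms by (subst (asm) ln_ge_iff) auto
qed

lemma ratio_chain_le:
  fixes f :: "nat \<Rightarrow> real"
  assumes step: "\<And>j. j < M \<Longrightarrow> f (Suc j) \<le> \<Theta> * f j" "\<And>j. j < M \<Longrightarrow> f j \<le> \<Theta> * f (Suc j)"
    and "1 \<le> \<Theta>" "\<And>j. 0 \<le> f j" and "i \<le> M" "j \<le> M" "i \<le> j + c" "j \<le> i + c"
  shows "f i \<le> \<Theta> ^ c * f j"
proof -
  have chain: "f (a + l) \<le> \<Theta> ^ l * f a \<and> f a \<le> \<Theta> ^ l * f (a + l)" if "a + l \<le> M" for a l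
    using that
  proof (induction l)
    case (Suc l)
    have "f (a + Suc l) \<le> \<Theta> * f (a + l)" "f (a + l) \<le> \<Theta> * f (a + Suc l)"
      using step[of "a + l"] Suc.prems by auto
    moreover have "\<Theta> * f (a + l) \<le> \<Theta> * (\<Theta> ^ l * f a)"
      using Suc assms(3) by (intro mult_left_mono) auto
    moreover have "\<Theta> ^ l * f (a + l) \<le> \<Theta> ^ l * (\<Theta> * f (a + Suc l))"
      using assms(3) calculation by (intro mult_left_mono) auto
    ultimately show ?case using Suc by (auto simp: mult_ac)
  qed simp
  have "f i \<le> \<Theta> ^ (if i \<le> j then j - i else i - j) * f j"
    using chain[of i "j - i"] chain[of j "i - j"] assms by auto
  also have "\<dots> \<le> \<Theta> ^ c * f j"
    using assms by (intro mult_right_mono power_increasing) auto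
  finally show ?thesis .
qed

lemma eventually_le_mult_of_ratio_tendsto_0:
  fixes f g :: "'a \<Rightarrow> real"
  assumes "((\<lambda>x. f x / g x) \<longlongrightarrow> 0) F" "eventually (\<lambda>x. 0 < g x) F" "0 < \<delta>"
  shows "eventually (\<lambda>x. f x \<le> \<delta> * g x) F"
  using order_tendstoD(2)[OF assms(1,3)] assms(2)
  by eventually_elim (simp add: divide_less_eq)

lemma tendsto_0_if_eventually_le_mult:
  fixes f :: "nat \<Rightarrow> real"
  assumes "\<And>n. 0 \<le> f n" "\<And>\<epsilon>. \<lbrakk>0 < \<epsilon>; \<epsilon> \<le> 1\<rbrakk> \<Longrightarrow> eventually (\<lambda>n. f n \<le> C * \<epsilon>) sequentially"
  shows "f \<longlonglongrightarrow> 0"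
proof (rule tendstoI)
  fix e :: real assume "0 < e"
  define \<epsilon> where "\<epsilon> = min 1 (e / (\<bar>C\<bar> + 1))"
  have \<epsilon>: "0 < \<epsilon>" "\<epsilon> \<le> 1" using \<open>0 < e\<close> by (auto simp: \<epsilon>_def)
  have "C * \<epsilon> < (\<bar>C\<bar> + 1) * \<epsilon>" using \<epsilon> by (intro mult_strict_right_mono) auto
  also have "\<dots> \<le> (\<bar>C\<bar> + 1) * (e / (\<bar>C\<bar> + 1))" by (intro mult_left_mono) (auto simp: \<epsilon>_def)
  finally have "C * \<epsilon> < e" by simp
  with assms(2)[OF \<epsilon>] show "eventually (\<lambda>n. dist (f n) 0 < e) sequentially"
    using assms(1) by (auto elim!: eventually_mono simp: dist_real_def)
qed

subsection \<open>Independence and second moments\<close>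

lemma expectation_eq_sum_on_rectangle:
  fixes h :: "'a \<Rightarrow> 'b \<Rightarrow> real"
  assumes "finite S" "finite T" "\<And>a b. a \<notin> S \<or> b \<notin> T \<Longrightarrow> h a b = 0"
  shows "measure_pmf.expectation p (\<lambda>(a, b). h a b) = (\<Sum>a\<in>S. \<Sum>b\<in>T. h a b * pmf p (a, b))"
proof -
  have "measure_pmf.expectation p (\<lambda>(a, b). h a b) = (\<Sum>x\<in>S \<times> T. (case x of (a, b) \<Rightarrow> h a b) * pmf p x)"
    using assms by (intro integral_measure_pmf_real) auto
  then show ?thesis by (simp add: sum.cartesian_product split_beta)
qed

text \<open>A bound on cross ratios turns into approximate independence by summation over \<open>a'\<close> and \<open>b'\<close>, so
that the joint law never has to be compared with the normalised marginals.\<close>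

lemma expectation_mult_le_of_cross_ratio:
  fixes p :: "('a \<times> 'b) pmf" and f :: "'a \<Rightarrow> real" and g :: "'b \<Rightarrow> real"
  assumes "finite (set_pmf p)" "finite S" "finite T" "0 \<le> \<Theta>"
    and cross: "\<And>a b a' b'. \<lbrakk>a \<in> S; b \<in> T; a' \<in> S; b' \<in> T\<rbrakk>
      \<Longrightarrow> pmf p (a, b) * pmf p (a', b') \<le> \<Theta> * (pmf p (a, b') * pmf p (a', b))"
    and f: "\<And>a. 0 \<le> f a" "\<And>a. a \<notin> S \<Longrightarrow> f a = 0"
    and g: "\<And>b. 0 \<le> g b" "\<And>b. b \<notin> T \<Longrightarrow> g b = 0"
  shows "measure_pmf.expectation p (\<lambda>(a, b). f a * g b) * measure_pmf.prob p (S \<times> T)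
       \<le> \<Theta> * (measure_pmf.expectation p (\<lambda>(a, b). f a) * measure_pmf.expectation p (\<lambda>(a, b). g b))"
proof -
  define J where "J a b = pmf p (a, b)" for a b
  note expectation_eq = expectation_eq_sum_on_rectangle[OF assms(2,3), of _ p, folded J_def]
  have integrable: "integrable (measure_pmf p) h" for h :: "'a \<times> 'b \<Rightarrow> real"
    using assms(1) by (rule integrable_measure_pmf_finite)
  have "measure_pmf.prob p (S \<times> T) = (\<Sum>b'\<in>T. \<Sum>a'\<in>S. J a' b')"
    using assms by (subst sum.swap) (simp add: measure_measure_pmf_finite sum.cartesian_product J_def split_beta)
  moreover have "measure_pmf.expectation p (\<lambda>(a, b). f a * g b) = (\<Sum>a\<in>S. \<Sum>b\<in>T. f a * g b * J a b)"
    using f g by (intro expectation_eq) auto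
  ultimately have "measure_pmf.expectation p (\<lambda>(a, b). f a * g b) * measure_pmf.prob p (S \<times> T)
      = (\<Sum>a\<in>S. \<Sum>b\<in>T. \<Sum>b'\<in>T. \<Sum>a'\<in>S. f a * g b * (J a b * J a' b'))"
    by (simp only: sum_distrib_right) (simp only: sum_distrib_left mult.assoc)
  also have "\<dots> \<le> (\<Sum>a\<in>S. \<Sum>b\<in>T. \<Sum>b'\<in>T. \<Sum>a'\<in>S. f a * g b * (\<Theta> * (J a b' * J a' b)))"
    unfolding J_def using f g cross by (intro sum_mono mult_left_mono) auto
  also have "\<dots> = \<Theta> * (\<Sum>a\<in>S. \<Sum>b\<in>T. \<Sum>b'\<in>T. \<Sum>a'\<in>S. (f a * J a b') * (g b * J a' b))"
    by (simp only: sum_distrib_left mult_ac)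
  also have "\<dots> = \<Theta> * ((\<Sum>a\<in>S. \<Sum>b'\<in>T. f a * J a b') * (\<Sum>b\<in>T. \<Sum>a'\<in>S. g b * J a' b))"
    by (simp only: sum_product)
  also have "\<dots> \<le> \<Theta> * (measure_pmf.expectation p (\<lambda>(a, b). f a)
        * measure_pmf.expectation p (\<lambda>(a, b). g b))"
  proof (intro mult_left_mono mult_mono)
    have "(\<Sum>a\<in>S. \<Sum>b'\<in>T. f a * J a b') = measure_pmf.expectation p (\<lambda>(a, b). f a * indicator T b)"
      using f by (subst expectation_eq) (auto simp: indicator_def)
    also have "\<dots> \<le> measure_pmf.expectation p (\<lambda>(a, b). f a)"
      using f by (intro integral_mono integrable) (auto simp: indicator_def)
    finally show "(\<Sum>a\<in>S. \<Sum>b'\<in>T. f a * J a b') \<le> measure_pmf.expectation p (\<lambda>(a, b). f a)" .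
    have "(\<Sum>b\<in>T. \<Sum>a'\<in>S. g b * J a' b) = measure_pmf.expectation p (\<lambda>(a, b). indicator S a * g b)"
      using g by (subst expectation_eq, force) (subst sum.swap, auto simp: indicator_def)
    also have "\<dots> \<le> measure_pmf.expectation p (\<lambda>(a, b). g b)"
      using g by (intro integral_mono integrable) (auto simp: indicator_def)
    finally show "(\<Sum>b\<in>T. \<Sum>a'\<in>S. g b * J a' b) \<le> measure_pmf.expectation p (\<lambda>(a, b). g b)" .
  qed (use assms(4) f g in \<open>auto simp: J_def intro!: sum_nonneg integral_nonneg_AE\<close>)
  finally show ?thesis .
qed

lemma (in prob_space) prob_sum_ge_one_le:
  fixes Y W :: "'a \<Rightarrow> real"
  assumes [measurable]: "random_variable borel Y" and square: "integrable M (\<lambda>x. (Y x)\<^sup>2)"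
    and W: "integrable M W" "\<And>x. 0 \<le> W x" and c: "0 < c" "expectation Y \<le> 1 - c"
  shows "prob {x \<in> space M. 1 \<le> Y x + W x} \<le> 4 / c\<^sup>2 * variance Y + 2 / c * expectation W"
proof -
  have [measurable]: "random_variable borel W" using W by simp
  have "prob {x \<in> space M. 1 \<le> Y x + W x}
      \<le> prob ({x \<in> space M. c / 2 \<le> \<bar>Y x - expectation Y\<bar>} \<union> {x \<in> space M. c / 2 \<le> W x})"
  proof (rule finite_measure_mono)
    show "{x \<in> space M. 1 \<le> Y x + W x}
        \<subseteq> {x \<in> space M. c / 2 \<le> \<bar>Y x - expectation Y\<bar>} \<union> {x \<in> space M. c / 2 \<le> W x}"
      using c by (auto simp: not_le abs_if)
  qed measurable
  also have "\<dots> \<le> prob {x \<in> space M. c / 2 \<le> \<bar>Y x - expectation Y\<bar>} + prob {x \<in> space M. c / 2 \<le> W x}"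
    by (rule measure_Un_le) measurable
  also have "\<dots> \<le> variance Y / (c / 2)\<^sup>2 + expectation W / (c / 2)"
    using c W square
    by (intro add_mono Chebyshev_inequality integral_Markov_inequality_measure[where A = "{}"]) auto
  also have "\<dots> = 4 / c\<^sup>2 * variance Y + 2 / c * expectation W"
    by (simp add: power_divide mult.commute)
  finally show ?thesis .
qed

lemma (in prob_space) expectation_mult_indicator_le:
  fixes Y :: "'a \<Rightarrow> real"
  assumes [measurable]: "A \<in> events" "random_variable borel Y"
    and square: "integrable M (\<lambda>x. (Y x)\<^sup>2)" and "\<And>x. 0 \<le> Y x" "0 < b"
  shows "expectation (\<lambda>x. Y x * indicator A x) \<le> b * prob A + expectation (\<lambda>x. (Y x)\<^sup>2) / b"
proof -
  have "integrable M Y" using assms(2) square by (rule square_integrable_imp_integrable)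
  have "expectation (\<lambda>x. Y x * indicator A x) \<le> expectation (\<lambda>x. b * indicator A x + (Y x)\<^sup>2 / b)"
  proof (rule integral_mono)
    fix x
    show "Y x * indicator A x \<le> b * indicator A x + (Y x)\<^sup>2 / b"
    proof (cases "Y x \<le> b")
      case True
      then have "Y x * indicator A x \<le> b * indicator A x" by (intro mult_right_mono) auto
      then show ?thesis using \<open>0 < b\<close> by (simp add: add_increasing2)
    next
      case False
      then have "b * Y x \<le> (Y x)\<^sup>2"
        using assms(4)[of x] unfolding power2_eq_square by (intro mult_right_mono) auto
      then have "Y x \<le> (Y x)\<^sup>2 / b" using \<open>0 < b\<close> by (simp add: field_simps)
      moreover have "Y x * indicator A x \<le> Y x" using assms(4)[of x] by (simp add: indicator_def)
      ultimately show ?thesis using \<open>0 < b\<close> by (simp add: add_increasing)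
    qed
  qed (use \<open>integrable M Y\<close> square in \<open>auto intro!: integrable_real_mult_indicator\<close>)
  also have "\<dots> = b * prob A + expectation (\<lambda>x. (Y x)\<^sup>2) / b"
    using square assms(1) sets.sets_into_space[OF assms(1)]
    by (subst Bochner_Integration.integral_add) (auto simp: Int_absorb2 less_top[symmetric])
  finally show ?thesis .
qed

subsection \<open>Geometric tails\<close>

lemma measure_pmf_atLeast_le_geometric:
  fixes p :: "nat pmf"
  assumes decay: "\<And>d. a \<le> d \<Longrightarrow> pmf p (Suc d) \<le> (1 - \<tau>) * pmf p d" and "\<tau> > 0"
  shows "measure_pmf.prob p {a..} \<le> pmf p a / \<tau>"
proof -
  have "bij_betw Suc {a..} {Suc a..}"
    by (rule bij_betw_byWitness[where f' = "\<lambda>d. d - 1"]) auto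
  note shift = abs_summable_on_reindex_bij_betw[OF this] infsetsum_reindex_bij_betw[OF this]
  have "measure_pmf.prob p {Suc a..} = infsetsum (\<lambda>d. pmf p (Suc d)) {a..}"
    by (simp add: measure_pmf_conv_infsetsum shift)
  also have "\<dots> \<le> infsetsum (\<lambda>d. (1 - \<tau>) * pmf p d) {a..}"
    using decay by (intro infsetsum_mono abs_summable_on_cmult_right) (auto simp: shift(1)[of "pmf p"])
  also have "\<dots> = (1 - \<tau>) * measure_pmf.prob p {a..}"
    by (simp add: measure_pmf_conv_infsetsum infsetsum_cmult_right pmf_abs_summable)
  finally have "measure_pmf.prob p {Suc a..} \<le> (1 - \<tau>) * measure_pmf.prob p {a..}" .
  moreover have "measure_pmf.prob p {a..} = pmf p a + measure_pmf.prob p {Suc a..}"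
  proof -
    have "{a..} = {a} \<union> {Suc a..}" by auto
    then show ?thesis
      using measure_pmf.finite_measure_Union[of "{a}" p "{Suc a..}"] by (simp add: measure_pmf_single)
  qed
  ultimately show ?thesis
    using \<open>\<tau> > 0\<close> by (simp add: field_simps)
qed

lemma measure_pmf_lessThan_le_geometric:
  fixes p :: "nat pmf"
  assumes growth: "\<And>d. d < a \<Longrightarrow> pmf p d \<le> (1 - \<tau>) * pmf p (Suc d)" and "0 < \<tau>" "\<tau> \<le> 1"
  shows "measure_pmf.prob p {..<a} \<le> pmf p a / \<tau>"
proof -
  have "(\<Sum>d<a. pmf p d) \<le> (1 - \<tau>) * (\<Sum>d<a. pmf p (Suc d))"
    unfolding sum_distrib_left using growth by (intro sum_mono) auto
  also have "\<dots> \<le> (1 - \<tau>) * ((\<Sum>d<a. pmf p d) + pmf p a)"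
  proof (intro mult_left_mono)
    have "(\<Sum>d<a. pmf p (Suc d)) + pmf p 0 = (\<Sum>d<a. pmf p d) + pmf p a"
      using sum.lessThan_Suc_shift[of "pmf p" a] by simp
    then show "(\<Sum>d<a. pmf p (Suc d)) \<le> (\<Sum>d<a. pmf p d) + pmf p a"
      using pmf_nonneg[of p 0] by linarith
  qed (use \<open>\<tau> \<le> 1\<close> in simp)
  finally have "\<tau> * (\<Sum>d<a. pmf p d) \<le> (1 - \<tau>) * pmf p a"
    by (simp add: algebra_simps)
  also have "\<dots> \<le> 1 * pmf p a"
    using \<open>0 < \<tau>\<close> by (intro mult_right_mono) auto
  finally show ?thesis
    using \<open>0 < \<tau>\<close> by (simp add: measure_measure_pmf_finite field_simps)
qed

subsection \<open>Distributions with Poisson-like ratios\<close>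

text \<open>Consecutive weights are compared with those of a Poisson law of mean \<open>D = r\<^sup>2\<close>. This alone
yields a Gaussian profile at scale \<open>r\<close> with matching upper and lower bounds, without Stirling's
formula.\<close>

locale poisson_like_pmf =
  fixes p :: "nat pmf" and D r A :: real
  assumes D_eq: "D = r * r" and r_ge: "r \<ge> 2" and A_ge: "A \<ge> 1"
    and above: "D \<le> real d \<Longrightarrow> (real d + 1) * pmf p (Suc d) \<le> D * pmf p d"
    and below: "real d + 1 \<le> D \<Longrightarrow> D * pmf p d \<le> (real d + 1) * pmf p (Suc d)"
    and near: "D - 1 \<le> real d \<Longrightarrow> real d \<le> D + A * r
                \<Longrightarrow> (1 - 1 / r) * D * pmf p d \<le> (real d + 1) * pmf p (Suc d)"
begin

definition mode :: nat where
  "mode = nat \<lceil>D\<rceil>"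

lemma D_ge: "D \<ge> 4"
  using mult_mono[OF r_ge r_ge] r_ge by (simp add: D_eq)

lemma mode_bounds: "D \<le> real mode" "real mode < D + 1" "4 \<le> mode"
  using D_ge unfolding mode_def by linarith+

lemma pmf_add_le_pmf:
  assumes "D \<le> real d"
  shows "pmf p (d + i) \<le> pmf p d"
proof (induction i)
  case (Suc i)
  have "(real (d + i) + 1) * pmf p (Suc (d + i)) \<le> D * pmf p (d + i)"
    using assms by (intro above) simp
  also have "\<dots> \<le> (real (d + i) + 1) * pmf p (d + i)"
    using assms by (intro mult_right_mono) auto
  finally have "pmf p (Suc (d + i)) \<le> pmf p (d + i)"
    by (subst (asm) mult_le_cancel_left_pos) auto
  with Suc show ?case by simp
qed simp

lemma pmf_diff_le_pmf:
  assumes "real d \<le> D"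
  shows "pmf p (d - i) \<le> pmf p d"
proof (induction i)
  case (Suc i)
  show ?case
  proof (cases "i < d")
    case True
    define e where "e = d - Suc i"
    have e: "Suc e = d - i" "real e + 1 \<le> D"
      using True assms by (auto simp: e_def of_nat_diff)
    have "D * pmf p e \<le> (real e + 1) * pmf p (Suc e)"
      using e by (intro below)
    also have "\<dots> \<le> D * pmf p (Suc e)"
      using e by (intro mult_right_mono) auto
    finally have "pmf p e \<le> pmf p (Suc e)"
      using D_ge by (subst (asm) mult_le_cancel_left_pos) auto
    with Suc e show ?thesis by (simp add: e_def)
  qed (use Suc in simp)
qed simp

lemma pmf_pred_mode_le: "pmf p (mode - 1) \<le> 4 * pmf p mode"
proof -
  have pred: "real (mode - 1) = real mode - 1" "Suc (mode - 1) = mode"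
    using mode_bounds by auto
  have "0 \<le> A * r" using A_ge r_ge by simp
  then have "(1 - 1 / r) * D * pmf p (mode - 1) \<le> (real (mode - 1) + 1) * pmf p (Suc (mode - 1))"
    using pred mode_bounds by (intro near; linarith)
  also have "\<dots> \<le> 2 * D * pmf p mode"
    unfolding pred using mode_bounds D_ge by (intro mult_right_mono) auto
  finally have "(1 - 1 / r) * D * pmf p (mode - 1) \<le> 2 * D * pmf p mode" .
  moreover have "1 / 2 * D * pmf p (mode - 1) \<le> (1 - 1 / r) * D * pmf p (mode - 1)"
    using D_ge r_ge by (intro mult_right_mono) (auto simp: field_simps)
  ultimately have "D * pmf p (mode - 1) \<le> D * (4 * pmf p mode)" by linarith
  then show ?thesis using D_ge by simp
qed

lemma pmf_le_mode: "pmf p d \<le> 4 * pmf p mode"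
proof (cases "mode \<le> d")
  case True
  then have "pmf p d \<le> pmf p mode"
    using pmf_add_le_pmf[of mode "d - mode"] mode_bounds by simp
  also have "\<dots> \<le> 4 * pmf p mode" by simp
  finally show ?thesis .
next
  case False
  then have "pmf p (mode - 1 - (mode - 1 - d)) \<le> pmf p (mode - 1)"
    using mode_bounds by (intro pmf_diff_le_pmf) (simp add: of_nat_diff)
  with False pmf_pred_mode_le show ?thesis by simp
qed

lemma exp_neg_le_one_minus_inverse: "exp (- (2 / r)) \<le> 1 - 1 / r"
proof -
  have "1 \<le> (1 - 1 / r) * (1 + 2 / r)"
    using r_ge by (simp add: field_simps)
  also have "\<dots> \<le> (1 - 1 / r) * exp (2 / r)"
    using r_ge exp_ge_add_one_self[of "2 / r"] by (intro mult_left_mono) auto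
  finally show ?thesis
    by (simp add: exp_minus field_simps)
qed

lemma exp_pmf_le_pmf_Suc:
  assumes d: "D - 1 \<le> real d" "real d + 1 \<le> D + A * r + 1"
  shows "exp (- ((A + 3) / r)) * pmf p d \<le> pmf p (Suc d)"
proof -
  have "real d + 1 \<le> D + A * r + r"
    using d r_ge by linarith
  also have "\<dots> = D * (1 + (A + 1) / r)"
    using r_ge by (simp add: D_eq field_simps)
  also have "\<dots> \<le> D * exp ((A + 1) / r)"
    using D_ge by (intro mult_left_mono exp_ge_add_one_self) auto
  finally have d_le: "real d + 1 \<le> D * exp ((A + 1) / r)" .
  have "- ((A + 3) / r) = - (2 / r) + - ((A + 1) / r)"
    by (simp add: add_divide_distrib)
  then have "(real d + 1) * (exp (- ((A + 3) / r)) * pmf p d)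
      = exp (- (2 / r)) * ((real d + 1) * exp (- ((A + 1) / r))) * pmf p d"
    by (simp only: exp_add mult_ac)
  also have "\<dots> \<le> (1 - 1 / r) * D * pmf p d"
  proof (intro mult_right_mono mult_mono exp_neg_le_one_minus_inverse)
    show "(real d + 1) * exp (- ((A + 1) / r)) \<le> D"
      using d_le by (simp add: exp_minus field_simps)
  qed (use r_ge in auto)
  also have "\<dots> \<le> (real d + 1) * pmf p (Suc d)"
    using d by (intro near) auto
  finally show ?thesis
    by (subst (asm) mult_le_cancel_left_pos) auto
qed

lemma exp_pmf_mode_le_pmf_add:
  assumes "real i \<le> A * r"
  shows "exp (- ((A + 3) * A)) * pmf p mode \<le> pmf p (mode + i)"
proof -
  have "exp (- ((A + 3) * (real i / r))) * pmf p mode \<le> pmf p (mode + i)"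
    using assms
  proof (induction i)
    case (Suc i)
    have "- ((A + 3) * (real (Suc i) / r)) = - ((A + 3) / r) + - ((A + 3) * (real i / r))"
      by (simp add: add_divide_distrib distrib_left)
    then have "exp (- ((A + 3) * (real (Suc i) / r))) * pmf p mode
        = exp (- ((A + 3) / r)) * (exp (- ((A + 3) * (real i / r))) * pmf p mode)"
      by (simp only: exp_add mult.assoc)
    also have "\<dots> \<le> exp (- ((A + 3) / r)) * pmf p (mode + i)"
      using Suc by (intro mult_left_mono) auto
    also have "\<dots> \<le> pmf p (Suc (mode + i))"
      using Suc mode_bounds by (intro exp_pmf_le_pmf_Suc) auto
    finally show ?case by simp
  qed simp
  moreover have "(A + 3) * (real i / r) \<le> (A + 3) * A"
    using assms A_ge r_ge by (intro mult_left_mono) (auto simp: field_simps)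
  then have "exp (- ((A + 3) * A)) * pmf p mode \<le> exp (- ((A + 3) * (real i / r))) * pmf p mode"
    by (intro mult_right_mono) auto
  ultimately show ?thesis by linarith
qed

lemma pmf_le_inverse_scale: "pmf p d \<le> 4 * exp ((A + 3) * A) / r"
proof -
  define E where "E = exp ((A + 3) * A)"
  have E: "E > 0" "exp (- ((A + 3) * A)) = 1 / E"
    by (simp_all add: E_def exp_minus divide_inverse)
  let ?I = "{mode..mode + nat \<lfloor>r\<rfloor>}"
  have "r * (1 / E * pmf p mode) \<le> real (card ?I) * (1 / E * pmf p mode)"
  proof (intro mult_right_mono)
    show "r \<le> real (card ?I)" using r_ge by simp linarith
  qed (use E in auto)
  also have "\<dots> \<le> sum (pmf p) ?I"
  proof (rule sum_bounded_below)
    fix d assume d: "d \<in> ?I"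
    then have "real (d - mode) \<le> r" using r_ge by (simp add: le_nat_floor) linarith
    also have "r \<le> A * r" using A_ge r_ge by simp
    finally show "1 / E * pmf p mode \<le> pmf p d"
      using exp_pmf_mode_le_pmf_add[of "d - mode"] d E by simp
  qed
  also have "\<dots> = measure_pmf.prob p ?I" by (simp add: measure_measure_pmf_finite)
  also have "\<dots> \<le> 1" by simp
  finally have "4 * pmf p mode \<le> 4 * E / r"
    using r_ge E by (simp add: field_simps)
  with pmf_le_mode[of d] show ?thesis by (simp add: E_def)
qed

lemma prob_below_mode_le: "measure_pmf.prob p {..<nat \<lfloor>D - r\<rfloor>} \<le> 4 * r * pmf p mode"
proof -
  define a where "a = nat \<lfloor>D - r\<rfloor>"
  have "r \<le> D" using r_ge by (simp add: D_eq)
  then have a: "real a \<le> D - r" unfolding a_def by linarith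
  have "measure_pmf.prob p {..<a} \<le> pmf p a / (1 / r)"
  proof (rule measure_pmf_lessThan_le_geometric)
    fix d assume "d < a"
    then have d: "real d + 1 \<le> D - r" using a by linarith
    then have "D * pmf p d \<le> (real d + 1) * pmf p (Suc d)" using r_ge by (intro below) linarith
    also have "\<dots> \<le> (D - r) * pmf p (Suc d)" using d by (intro mult_right_mono) auto
    also have "D - r = D * (1 - 1 / r)" using r_ge by (simp add: D_eq field_simps)
    finally show "pmf p d \<le> (1 - 1 / r) * pmf p (Suc d)"
      using D_ge by (simp only: mult.assoc mult_le_cancel_left_pos)
  qed (use r_ge in auto)
  also have "\<dots> \<le> 4 * r * pmf p mode"
    using mult_left_mono[OF pmf_le_mode, of r a] r_ge by (simp add: mult_ac)
  finally show ?thesis by (simp only: a_def)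
qed

lemma prob_atLeast_le:
  assumes "0 < Y" "Y \<le> D" and a: "D + Y \<le> real a"
  shows "measure_pmf.prob p {a..} \<le> 2 * D / Y * pmf p a"
proof -
  have "measure_pmf.prob p {a..} \<le> pmf p a / (Y / (2 * D))"
  proof (rule measure_pmf_atLeast_le_geometric)
    fix d assume "a \<le> d"
    then have d: "D + Y \<le> real d" using a by linarith
    have "(D + Y) * pmf p (Suc d) \<le> (real d + 1) * pmf p (Suc d)"
      using d by (intro mult_right_mono) auto
    also have "\<dots> \<le> D * pmf p d" using d assms by (intro above) linarith
    also have "\<dots> \<le> (D + Y) * (1 - Y / (2 * D)) * pmf p d"
    proof (intro mult_right_mono pmf_nonneg)
      have "Y * Y \<le> Y * D" using assms by (intro mult_left_mono) auto
      then show "D \<le> (D + Y) * (1 - Y / (2 * D))" using D_ge by (simp add: field_simps)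
    qed
    finally show "pmf p (Suc d) \<le> (1 - Y / (2 * D)) * pmf p d"
      using D_ge assms by (simp only: mult.assoc mult_le_cancel_left_pos)
  qed (use assms D_ge in simp)
  then show ?thesis by (simp add: mult_ac)
qed

lemma pmf_mode_ge: "1 \<le> 24 * r * pmf p mode"
proof -
  define a b where "a = nat \<lfloor>D - r\<rfloor>" and "b = nat \<lceil>D + r\<rceil>"
  have rD: "r \<le> D" using r_ge by (simp add: D_eq)
  have a: "real a \<le> D - r" "D - r < real a + 1" and b: "D + r \<le> real b" "real b < D + r + 1"
    unfolding a_def b_def using rD r_ge by linarith+
  then have ab: "a \<le> b" using r_ge by linarith
  have "1 = measure_pmf.prob p (({..<a} \<union> {a..<b}) \<union> {b..})"
  proof -
    have "({..<a} \<union> {a..<b}) \<union> {b..} = UNIV" using ab by auto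
    then show ?thesis by simp
  qed
  also have "\<dots> \<le> (measure_pmf.prob p {..<a} + measure_pmf.prob p {a..<b}) + measure_pmf.prob p {b..}"
    by (intro order_trans[OF measure_Un_le] add_right_mono measure_Un_le) auto
  also have "\<dots> \<le> 4 * r * pmf p mode + (2 * r + 2) * (4 * pmf p mode) + 8 * r * pmf p mode"
  proof (intro add_mono)
    show "measure_pmf.prob p {..<a} \<le> 4 * r * pmf p mode"
      unfolding a_def by (rule prob_below_mode_le)
    have "measure_pmf.prob p {a..<b} = sum (pmf p) {a..<b}"
      by (simp add: measure_measure_pmf_finite)
    also have "\<dots> \<le> real (card {a..<b}) * (4 * pmf p mode)"
      by (intro sum_bounded_above pmf_le_mode)
    also have "\<dots> \<le> (2 * r + 2) * (4 * pmf p mode)"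
      using a b ab by (intro mult_right_mono) (auto simp: of_nat_diff)
    finally show "measure_pmf.prob p {a..<b} \<le> (2 * r + 2) * (4 * pmf p mode)" .
    have "measure_pmf.prob p {b..} \<le> 2 * D / r * pmf p b"
      using b rD r_ge by (intro prob_atLeast_le) auto
    also have "\<dots> \<le> 2 * D / r * (4 * pmf p mode)"
      using r_ge D_ge by (intro mult_left_mono pmf_le_mode) auto
    finally show "measure_pmf.prob p {b..} \<le> 8 * r * pmf p mode"
      using r_ge by (simp add: D_eq)
  qed
  also have "\<dots> = (20 * r + 8) * pmf p mode" by (simp add: algebra_simps)
  also have "\<dots> \<le> 24 * r * pmf p mode" using r_ge by (intro mult_right_mono) auto
  finally show ?thesis .
qed

lemma prob_window_le:
  assumes "a \<le> b"
  shows "measure_pmf.prob p {d. a \<le> real d \<and> real d < b} \<le> (b - a + 1) * (4 * exp ((A + 3) * A) / r)"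
proof -
  let ?I = "{nat \<lceil>a\<rceil>..<nat \<lceil>b\<rceil>}"
  have "measure_pmf.prob p {d. a \<le> real d \<and> real d < b} \<le> measure_pmf.prob p ?I"
  proof (rule measure_pmf.finite_measure_mono)
    show "{d. a \<le> real d \<and> real d < b} \<subseteq> ?I"
      by auto linarith
  qed simp
  also have "\<dots> = sum (pmf p) ?I" by (simp add: measure_measure_pmf_finite)
  also have "\<dots> \<le> real (card ?I) * (4 * exp ((A + 3) * A) / r)"
    by (intro sum_bounded_above pmf_le_inverse_scale)
  also have "\<dots> \<le> (b - a + 1) * (4 * exp ((A + 3) * A) / r)"
  proof (intro mult_right_mono)
    show "real (card ?I) \<le> b - a + 1" using assms by simp linarith
  qed (use r_ge in simp)
  finally show ?thesis .
qed

lemma prob_above_mean_ge: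
  "exp (- ((A + 3) * A)) / 48 \<le> measure_pmf.prob p {d. D + (A - 1) * r \<le> real d}"
proof -
  define a b where "a = nat \<lceil>D + (A - 1) * r\<rceil>" and "b = nat \<lfloor>D + A * r\<rfloor>"
  let ?e = "exp (- ((A + 3) * A))"
  have nonneg: "0 \<le> (A - 1) * r" "A * r = (A - 1) * r + r" "r \<le> D"
    using A_ge r_ge by (auto simp: D_eq algebra_simps)
  then have a: "D + (A - 1) * r \<le> real a" "real a < D + (A - 1) * r + 1"
    and b: "real b \<le> D + A * r" "D + A * r < real b + 1"
    using r_ge unfolding a_def b_def by linarith+
  have "?e / 48 = r / 2 * (?e * (1 / (24 * r)))"
    using r_ge by simp
  also have "\<dots> \<le> real (card {a..b}) * (?e * pmf p mode)"
  proof (intro mult_mono mult_left_mono)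
    show "r / 2 \<le> real (card {a..b})" using a b nonneg r_ge by (simp add: of_nat_diff)
    show "1 / (24 * r) \<le> pmf p mode" using pmf_mode_ge r_ge by (simp add: field_simps)
  qed (use r_ge in auto)
  also have "\<dots> \<le> sum (pmf p) {a..b}"
  proof (rule sum_bounded_below)
    fix d assume "d \<in> {a..b}"
    then have d: "D \<le> real d" "real d \<le> D + A * r" using a b nonneg by auto
    then have "mode \<le> d" by (simp add: mode_def nat_le_iff ceiling_le_iff)
    then have "real (d - mode) \<le> A * r" using d mode_bounds by (simp add: of_nat_diff)
    with \<open>mode \<le> d\<close> show "?e * pmf p mode \<le> pmf p d"
      using exp_pmf_mode_le_pmf_add[of "d - mode"] by simp
  qed
  also have "\<dots> = measure_pmf.prob p {a..b}" by (simp add: measure_measure_pmf_finite)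
  also have "\<dots> \<le> measure_pmf.prob p {d. D + (A - 1) * r \<le> real d}"
    using a by (intro measure_pmf.finite_measure_mono) auto
  finally show ?thesis .
qed

lemma pmf_Suc_le_exp:
  assumes "D * z \<le> real d + 1 - D" "0 \<le> z" "z \<le> 1" "D \<le> real d"
  shows "pmf p (Suc d) \<le> exp (z\<^sup>2 - z) * pmf p d"
proof -
  have "D * (1 + z) * pmf p (Suc d) \<le> (real d + 1) * pmf p (Suc d)"
    using assms by (intro mult_right_mono) (auto simp: algebra_simps)
  also have "\<dots> \<le> D * pmf p d" using assms by (intro above) simp
  finally have ratio: "(1 + z) * pmf p (Suc d) \<le> pmf p d"
    using D_ge by (simp only: mult.assoc mult_le_cancel_left_pos)
  have "z - z\<^sup>2 \<le> ln (1 + z)"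
    using assms by (intro ln_one_plus_pos_lower_bound)
  then have "exp (z - z\<^sup>2) \<le> 1 + z"
    using assms by (subst (asm) ln_ge_iff) auto
  then have "exp (z - z\<^sup>2) * pmf p (Suc d) \<le> (1 + z) * pmf p (Suc d)"
    by (intro mult_right_mono) auto
  also note ratio
  finally have "exp (z\<^sup>2 - z) * (exp (z - z\<^sup>2) * pmf p (Suc d)) \<le> exp (z\<^sup>2 - z) * pmf p d"
    by (intro mult_left_mono) auto
  then show ?thesis by (simp add: mult.assoc[symmetric] mult_exp_exp)
qed

lemma pmf_mode_add_le:
  assumes "real j \<le> D"
  shows "pmf p (mode + j) \<le> pmf p mode * exp (real j ^ 3 / D\<^sup>2 - real j * (real j + 1) / (2 * D))"
  using assms
proof (induction j)
  case (Suc j)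
  let ?z = "(real j + 1) / D"
  let ?e = "\<lambda>x::real. x ^ 3 / D\<^sup>2 - x * (x + 1) / (2 * D)"
  have "pmf p (Suc (mode + j)) \<le> exp (?z\<^sup>2 - ?z) * pmf p (mode + j)"
    using Suc.prems D_ge mode_bounds by (intro pmf_Suc_le_exp) auto
  also have "\<dots> \<le> exp (?z\<^sup>2 - ?z) * (pmf p mode * exp (?e (real j)))"
    using Suc by (intro mult_left_mono) auto
  also have "\<dots> = pmf p mode * exp (?z\<^sup>2 - ?z + ?e (real j))"
    by (simp only: exp_add mult_ac)
  also have "\<dots> \<le> pmf p mode * exp (?e (real (Suc j)))"
  proof (intro mult_left_mono)
    have "real j ^ 3 + (real j + 1)\<^sup>2 \<le> (real j + 1) ^ 3"
      by (simp add: power2_eq_square power3_eq_cube algebra_simps)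
    then have "real j ^ 3 / D\<^sup>2 + ?z\<^sup>2 \<le> (real j + 1) ^ 3 / D\<^sup>2"
      unfolding power_divide add_divide_distrib[symmetric] by (intro divide_right_mono) auto
    moreover have "?z + real j * (real j + 1) / (2 * D) = (real j + 1) * (real j + 1 + 1) / (2 * D)"
      using D_ge by (simp add: field_simps)
    ultimately show "exp (?z\<^sup>2 - ?z + ?e (real j)) \<le> exp (?e (real (Suc j)))"
      unfolding exp_le_cancel_iff of_nat_Suc add.commute[of 1 "real j"] by linarith
  qed simp
  finally show ?case by simp
qed simp

lemma prob_upper_tail_le:
  assumes "1 \<le> Y" "Y + 1 \<le> D"
  shows "measure_pmf.prob p {d. D + Y \<le> real d}
       \<le> 8 * exp ((A + 3) * A + 1 / 2) * r / Y * exp ((Y + 1) ^ 3 / D\<^sup>2 - Y\<^sup>2 / (2 * D))"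
proof -
  define a where "a = nat \<lceil>D + Y\<rceil>"
  define j where "j = real (a - mode)"
  let ?E = "exp (1 / 2 + ((Y + 1) ^ 3 / D\<^sup>2 - Y\<^sup>2 / (2 * D)))"
  have a: "D + Y \<le> real a" "real a < D + Y + 1" unfolding a_def using assms D_ge by linarith+
  then have "mode \<le> a" using mode_bounds assms by linarith
  then have j: "a = mode + (a - mode)" "Y - 1 \<le> j" "j \<le> Y + 1"
    using a mode_bounds by (auto simp: j_def of_nat_diff)
  have "pmf p a \<le> pmf p mode * exp (j ^ 3 / D\<^sup>2 - j * (j + 1) / (2 * D))"
    using pmf_mode_add_le[of "a - mode"] j assms by (simp add: j_def)
  also have "\<dots> \<le> 4 * exp ((A + 3) * A) / r * ?E"
  proof (intro mult_mono pmf_le_inverse_scale)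
    have "(Y - 1) * Y \<le> j * (j + 1)" using j assms by (intro mult_mono) auto
    then have "(Y - 1) * Y / (2 * D) \<le> j * (j + 1) / (2 * D)"
      using D_ge by (intro divide_right_mono) auto
    moreover have "(Y - 1) * Y / (2 * D) = Y\<^sup>2 / (2 * D) - Y / (2 * D)"
      by (simp add: power2_eq_square left_diff_distrib diff_divide_distrib)
    moreover have "Y / (2 * D) \<le> 1 / 2" using assms D_ge by (simp add: field_simps)
    moreover have "j ^ 3 / D\<^sup>2 \<le> (Y + 1) ^ 3 / D\<^sup>2"
      using j by (intro divide_right_mono power_mono) (auto simp: j_def)
    ultimately show "exp (j ^ 3 / D\<^sup>2 - j * (j + 1) / (2 * D)) \<le> ?E"
      unfolding exp_le_cancel_iff by linarith
  qed (use r_ge in auto)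
  finally have pmf_a: "pmf p a \<le> 4 * exp ((A + 3) * A) / r * ?E" .
  have "measure_pmf.prob p {d. D + Y \<le> real d} = measure_pmf.prob p {a..}"
    using assms D_ge
    by (intro arg_cong[where f = "measure_pmf.prob p"]) (auto simp: a_def nat_le_iff ceiling_le_iff)
  also have "\<dots> \<le> 2 * D / Y * pmf p a" using a assms by (intro prob_atLeast_le) auto
  also have "\<dots> \<le> 2 * D / Y * (4 * exp ((A + 3) * A) / r * ?E)"
    using assms D_ge by (intro mult_left_mono pmf_a) auto
  also have "\<dots> = 8 * exp ((A + 3) * A + 1 / 2) * r / Y * exp ((Y + 1) ^ 3 / D\<^sup>2 - Y\<^sup>2 / (2 * D))"
    using r_ge by (simp only: exp_add) (simp add: D_eq)
  finally show ?thesis .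
qed

end

subsection \<open>Uniformly random subsets of fixed size\<close>

definition uniform_subset :: "'a set \<Rightarrow> nat \<Rightarrow> 'a set pmf" where
  "uniform_subset E m = pmf_of_set {G. G \<subseteq> E \<and> card G = m}"

lemma subsets_of_card_nonempty:
  assumes "finite E" "m \<le> card E"
  shows "{G. G \<subseteq> E \<and> card G = m} \<noteq> {}"
  using obtain_subset_with_card_n[OF assms(2)] by blast

lemma set_pmf_uniform_subset:
  assumes "finite E" "m \<le> card E"
  shows "set_pmf (uniform_subset E m) = {G. G \<subseteq> E \<and> card G = m}"
  unfolding uniform_subset_def using assms by (intro set_pmf_of_set subsets_of_card_nonempty) auto

lemma pmf_uniform_subset:
  assumes "finite E" "m \<le> card E"
  shows "pmf (uniform_subset E m) G = (if G \<subseteq> E \<and> card G = m then 1 / real (card E choose m) else 0)"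
  unfolding uniform_subset_def using assms
  by (subst pmf_of_set[OF subsets_of_card_nonempty]) (auto simp: n_subsets)

lemma prob_uniform_subset:
  assumes "finite E" "m \<le> card E"
  shows "measure_pmf.prob (uniform_subset E m) X
       = real (card {G. G \<subseteq> E \<and> card G = m \<and> G \<in> X}) / real (card E choose m)"
proof -
  have "{G. G \<subseteq> E \<and> card G = m \<and> G \<in> X} = {G. G \<subseteq> E \<and> card G = m} \<inter> X" by auto
  then show ?thesis
    unfolding uniform_subset_def using assms
    by (subst measure_pmf_of_set[OF subsets_of_card_nonempty]) (auto simp: n_subsets)
qed

lemma card_subsets_with_inter:
  assumes "finite E" "A \<subseteq> E" "a \<le> m"
  shows "card {G. G \<subseteq> E \<and> card G = m \<and> card (G \<inter> A) = a \<and> P (G - A)}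
       = (card A choose a) * card {R. R \<subseteq> E - A \<and> card R = m - a \<and> P R}"
    (is "card ?L = _ * card ?R")
proof -
  let ?T = "{T. T \<subseteq> A \<and> card T = a}"
  have finite_A: "finite A" using assms finite_subset by blast
  have "bij_betw (\<lambda>(T, R). T \<union> R) (?T \<times> ?R) ?L"
  proof (rule bij_betw_byWitness[where f' = "\<lambda>G. (G \<inter> A, G - A)"])
    show "\<forall>x\<in>?T \<times> ?R. (\<lambda>G. (G \<inter> A, G - A)) ((\<lambda>(T, R). T \<union> R) x) = x" by auto
    show "\<forall>G\<in>?L. (\<lambda>(T, R). T \<union> R) (G \<inter> A, G - A) = G" by auto
    show "(\<lambda>(T, R). T \<union> R) ` (?T \<times> ?R) \<subseteq> ?L"
    proof safe
      fix T R assume T: "T \<subseteq> A" "a = card T" and R: "R \<subseteq> E - A" "card R = m - card T" "P R"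
      have "finite T" "finite R" "T \<inter> R = {}"
        using T R assms finite_A by (auto intro: finite_subset)
      then show "card (T \<union> R) = m" using T R assms by (simp add: card_Un_disjoint)
      have "(T \<union> R) \<inter> A = T" "T \<union> R - A = R" using T R by auto
      then show "card ((T \<union> R) \<inter> A) = card T" "P (T \<union> R - A)" using R by auto
    qed (use assms in auto)
    show "(\<lambda>G. (G \<inter> A, G - A)) ` ?L \<subseteq> ?T \<times> ?R"
    proof safe
      fix G assume "G \<subseteq> E"
      then have "finite G" using assms finite_subset by blast
      then show "card (G - A) = card G - card (G \<inter> A)" by (simp add: card_Diff_subset_Int)
    qed auto
  qed
  then have "card ?L = card (?T \<times> ?R)" by (simp add: bij_betw_same_card)
  also have "\<dots> = (card A choose a) * card ?R"
    using n_subsets[OF finite_A, of a] by (simp add: card_cartesian_product)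
  finally show ?thesis .
qed

lemma card_subsets_with_inter_eq:
  assumes "finite E" "A \<subseteq> E" "a \<le> m"
  shows "card {G. G \<subseteq> E \<and> card G = m \<and> card (G \<inter> A) = a}
       = (card A choose a) * ((card E - card A) choose (m - a))"
proof -
  have "card (E - A) = card E - card A"
    using assms by (simp add: card_Diff_subset finite_subset)
  then show ?thesis
    using card_subsets_with_inter[of E A a m "\<lambda>_. True"] n_subsets[of "E - A" "m - a"] assms by simp
qed

lemma card_subsets_with_three_inters:
  assumes "finite E" "A \<subseteq> E" "B \<subseteq> E" "C \<subseteq> E" "A \<inter> B = {}" "A \<inter> C = {}" "B \<inter> C = {}"
    and "a + b + c \<le> m"
  shows "card {G. G \<subseteq> E \<and> card G = m \<and> card (G \<inter> C) = c \<and> card (G \<inter> A) = a \<and> card (G \<inter> B) = b}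
       = (card C choose c) * (card A choose a) * (card B choose b)
         * ((card E - card C - card A - card B) choose (m - c - a - b))"
proof -
  have inter_Diff: "(G - C) \<inter> A = G \<inter> A" "(G - C) \<inter> B = G \<inter> B" "(G - A) \<inter> B = G \<inter> B" for G
    using assms by auto
  have sub: "A \<subseteq> E - C" "B \<subseteq> E - C - A" using assms by auto
  have finite: "finite A" "finite B" "finite C" using assms by (auto intro: finite_subset)
  have card_rest: "card (E - C) = card E - card C" "card (E - C - A) = card E - card C - card A"
    using assms finite sub by (simp_all add: card_Diff_subset)
  have "card {G. G \<subseteq> E \<and> card G = m \<and> card (G \<inter> C) = c \<and> card (G \<inter> A) = a \<and> card (G \<inter> B) = b}
      = (card C choose c) * card {R. R \<subseteq> E - C \<and> card R = m - c \<and> card (R \<inter> A) = a \<and> card (R \<inter> B) = b}"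
    using card_subsets_with_inter[of E C c m "\<lambda>R. card (R \<inter> A) = a \<and> card (R \<inter> B) = b"] assms
    by (simp add: inter_Diff)
  also have "card {R. R \<subseteq> E - C \<and> card R = m - c \<and> card (R \<inter> A) = a \<and> card (R \<inter> B) = b}
      = (card A choose a) * card {R. R \<subseteq> E - C - A \<and> card R = m - c - a \<and> card (R \<inter> B) = b}"
    using card_subsets_with_inter[of "E - C" A a "m - c" "\<lambda>R. card (R \<inter> B) = b"] assms sub
    by (simp add: inter_Diff)
  also have "card {R. R \<subseteq> E - C - A \<and> card R = m - c - a \<and> card (R \<inter> B) = b}
      = (card B choose b) * ((card E - card C - card A - card B) choose (m - c - a - b))"
    using card_subsets_with_inter_eq[of "E - C - A" B b "m - c - a"] assms sub
    by (simp add: card_rest)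
  finally show ?thesis by (simp add: mult.assoc)
qed

subsection \<open>Hypergeometric distributions\<close>

definition hypergeometric_pmf :: "nat \<Rightarrow> nat \<Rightarrow> nat \<Rightarrow> nat pmf" where
  "hypergeometric_pmf N K m = map_pmf (\<lambda>G. card (G \<inter> {..<K})) (uniform_subset {..<N} m)"

lemma pmf_map_card_inter_uniform_subset:
  assumes "finite E" "A \<subseteq> E" "m \<le> card E"
  shows "pmf (map_pmf (\<lambda>G. card (G \<inter> A)) (uniform_subset E m)) d
       = (if d \<le> m then real (card A choose d) * real ((card E - card A) choose (m - d)) / real (card E choose m)
          else 0)"
proof -
  have "pmf (map_pmf (\<lambda>G. card (G \<inter> A)) (uniform_subset E m)) d
      = real (card {G. G \<subseteq> E \<and> card G = m \<and> card (G \<inter> A) = d}) / real (card E choose m)"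
    using assms by (simp add: pmf_map prob_uniform_subset vimage_def)
  moreover have "d \<le> m" if G: "G \<subseteq> E" "card G = m" "card (G \<inter> A) = d" for G
    using card_mono[of G "G \<inter> A"] G finite_subset[OF G(1)] assms by auto
  then have "{G. G \<subseteq> E \<and> card G = m \<and> card (G \<inter> A) = d} = {}" if "\<not> d \<le> m"
    using that by blast
  ultimately show ?thesis
    using assms card_subsets_with_inter_eq[of E A d m] by (cases "d \<le> m") auto
qed

lemma map_card_inter_uniform_subset:
  assumes "finite E" "A \<subseteq> E" "m \<le> card E"
  shows "map_pmf (\<lambda>G. card (G \<inter> A)) (uniform_subset E m) = hypergeometric_pmf (card E) (card A) m"
proof (rule pmf_eqI)
  fix d
  have "card A \<le> card E" using assms by (intro card_mono)
  then show "pmf (map_pmf (\<lambda>G. card (G \<inter> A)) (uniform_subset E m)) d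
      = pmf (hypergeometric_pmf (card E) (card A) m) d"
    unfolding hypergeometric_pmf_def using assms by (simp add: pmf_map_card_inter_uniform_subset)
qed

lemma pmf_hypergeometric:
  assumes "K \<le> m" "m \<le> N"
  shows "pmf (hypergeometric_pmf N K m) d
        = real (K choose d) * real ((N - K) choose (m - d)) / real (N choose m)"
  unfolding hypergeometric_pmf_def using assms by (subst pmf_map_card_inter_uniform_subset) auto

lemma pmf_hypergeometric_eq_0:
  assumes "K \<le> m" "m \<le> N" "K < d"
  shows "pmf (hypergeometric_pmf N K m) d = 0"
  using assms by (simp add: pmf_hypergeometric)

lemma set_pmf_hypergeometric_subset:
  assumes "K \<le> m" "m \<le> N"
  shows "set_pmf (hypergeometric_pmf N K m) \<subseteq> {..K}"
  using pmf_hypergeometric_eq_0[OF assms] by (auto simp: set_pmf_eq intro: leI)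

lemma real_Suc_times_binomial_Suc:
  assumes "d \<le> K"
  shows "(real d + 1) * real (K choose Suc d) = (real K - real d) * real (K choose d)"
proof -
  have "real (Suc d * (K choose Suc d)) = real ((K - d) * (K choose d))"
    by (simp only: binomial_absorption binomial_absorb_comp)
  then show ?thesis using assms by (simp add: of_nat_diff algebra_simps)
qed

lemma binomial_diff_Suc:
  assumes "j < m" "m \<le> X"
  shows "(real X - real m + real j + 1) * real (X choose (m - Suc j))
        = (real m - real j) * real (X choose (m - j))"
proof -
  have "Suc (m - Suc j) = m - j" "real (m - Suc j) = real m - real j - 1"
    using assms by (auto simp: of_nat_diff)
  moreover have "m - Suc j \<le> X" using assms by simp
  ultimately show ?thesis
    using real_Suc_times_binomial_Suc[of "m - Suc j" X] by (simp add: algebra_simps)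
qed

lemma pmf_hypergeometric_Suc:
  assumes "K \<le> m" "K + m \<le> N" "d \<le> K"
  shows "(real d + 1) * (real N - real K - real m + real d + 1) * pmf (hypergeometric_pmf N K m) (Suc d)
       = (real K - real d) * (real m - real d) * pmf (hypergeometric_pmf N K m) d"
proof (cases "d = K")
  case True
  then show ?thesis using assms by (simp add: pmf_hypergeometric)
next
  case False
  let ?u = "real d + 1" and ?v = "real N - real K - real m + real d + 1"
  have "?v * real ((N - K) choose (m - Suc d)) = (real m - real d) * real ((N - K) choose (m - d))"
    using binomial_diff_Suc[of d m "N - K"] assms False by (simp add: of_nat_diff)
  moreover have "?u * real (K choose Suc d) = (real K - real d) * real (K choose d)"
    using assms by (intro real_Suc_times_binomial_Suc)
  ultimately have "(?u * real (K choose Suc d)) * (?v * real ((N - K) choose (m - Suc d)))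
      = ((real K - real d) * real (K choose d)) * ((real m - real d) * real ((N - K) choose (m - d)))"
    by simp
  then show ?thesis
    using assms by (simp add: pmf_hypergeometric mult_ac)
qed

lemma pmf_hypergeometric_Suc_le:
  assumes "K \<le> m" "K + m \<le> N" "d \<le> K"
    and "(real K - real d) * (real m - real d) \<le> x * (real N - real K - real m + real d + 1)"
  shows "(real d + 1) * pmf (hypergeometric_pmf N K m) (Suc d) \<le> x * pmf (hypergeometric_pmf N K m) d"
proof -
  let ?h = "pmf (hypergeometric_pmf N K m)" and ?v = "real N - real K - real m + real d + 1"
  have "?v * ((real d + 1) * ?h (Suc d)) = (real K - real d) * (real m - real d) * ?h d"
    using pmf_hypergeometric_Suc[OF assms(1-3)] by (simp only: mult_ac)
  also have "\<dots> \<le> ?v * (x * ?h d)"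
    using mult_right_mono[OF assms(4), of "?h d"] by (simp add: mult_ac)
  finally show ?thesis using assms by (subst (asm) mult_le_cancel_left_pos) auto
qed

lemma pmf_hypergeometric_Suc_ge:
  assumes "K \<le> m" "K + m \<le> N" "d \<le> K"
    and "x * (real N - real K - real m + real d + 1) \<le> (real K - real d) * (real m - real d)"
  shows "x * pmf (hypergeometric_pmf N K m) d \<le> (real d + 1) * pmf (hypergeometric_pmf N K m) (Suc d)"
proof -
  let ?h = "pmf (hypergeometric_pmf N K m)" and ?v = "real N - real K - real m + real d + 1"
  have "?v * (x * ?h d) \<le> (real K - real d) * (real m - real d) * ?h d"
    using mult_right_mono[OF assms(4), of "?h d"] by (simp add: mult_ac)
  also have "\<dots> = ?v * ((real d + 1) * ?h (Suc d))"
    using pmf_hypergeometric_Suc[OF assms(1-3)] by (simp only: mult_ac)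
  finally show ?thesis using assms by (subst (asm) mult_le_cancel_left_pos) auto
qed

lemma shifted_product_le:
  fixes P R S D r y :: real
  assumes PR: "P * R = D * S" and pos: "0 < P" "0 < R" "0 < S" "0 < D" "1 \<le> r" "0 \<le> y"
    and small: "3 * r * y \<le> P" "3 * r * y \<le> R" "3 * r * (y + 1) \<le> S"
  shows "(1 - 1 / r) * D * (S + y + 1) \<le> (P - y) * (R - y)"
proof -
  have y: "y \<le> P / (3 * r)" "y \<le> R / (3 * r)" "y + 1 \<le> S / (3 * r)"
    using small pos by (simp_all only: pos_le_divide_eq mult.commute[of _ "3 * r"])
  have "(1 - 1 / r) * D * (S + y + 1) \<le> (1 - 1 / r) * D * (S + S / (3 * r))"
    using y pos by (intro mult_left_mono) auto
  also have "\<dots> = D * S * ((1 - 1 / r) * (1 + 1 / (3 * r)))"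
    by (simp add: algebra_simps)
  also have "\<dots> \<le> D * S * (1 - 2 / (3 * r))"
  proof (intro mult_left_mono)
    have "(1 - 1 / r) * (1 + 1 / (3 * r)) = 1 - 2 / (3 * r) - 1 / (3 * r * r)"
      using pos by (simp add: field_simps)
    then show "(1 - 1 / r) * (1 + 1 / (3 * r)) \<le> 1 - 2 / (3 * r)" using pos by simp
  qed (use pos in auto)
  also have "\<dots> = P * R - (P / (3 * r)) * R - P * (R / (3 * r))"
    unfolding PR[symmetric] by (simp add: algebra_simps)
  also have "\<dots> \<le> P * R - y * R - P * y"
    using y pos by (intro diff_mono mult_right_mono mult_left_mono) auto
  also have "\<dots> \<le> (P - y) * (R - y)" using pos by (simp add: algebra_simps)
  finally show ?thesis .
qed

locale hypergeometric_central =
  fixes N K m :: nat and D r A :: real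
  assumes K_le: "K \<le> m" and Km_le: "K + m \<le> N" and mean: "real K * real m = D * real N"
    and D_eq: "D = r * r" and r_ge: "r \<ge> 2" and A_ge: "A \<ge> 1"
    and K_ge: "(3 * A + 4) * D \<le> real K" and rest_ge: "(3 * A + 4) * D \<le> real N - real K - real m"
begin

lemma D_ge: "D \<ge> 4" and r_le_D: "r \<le> D"
  using mult_mono[OF r_ge r_ge] r_ge by (simp_all add: D_eq)

lemma D_le_K: "D \<le> real K"
  using mult_right_mono[of 1 "3 * A + 4" D] A_ge D_ge K_ge by linarith

lemma mean_shifted: "(real K - D) * (real m - D) = D * (real N - real K - real m + D)"
  using mean by (simp add: algebra_simps)

lemma near_product_le:
  assumes "D - 1 \<le> real d" "real d \<le> D + A * r"
  shows "(1 - 1 / r) * D * (real N - real K - real m + real d + 1)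
        \<le> (real K - real d) * (real m - real d)"
proof -
  define y where "y = max 0 (real d - D)"
  have "0 \<le> A * r" using A_ge r_ge by simp
  then have y: "0 \<le> y" "y \<le> A * r" "real d \<le> D + y" using assms by (auto simp: y_def)
  have "3 * r * y \<le> 3 * r * (A * r)" using y r_ge by (intro mult_left_mono) auto
  then have ry: "3 * r * y \<le> 3 * (A * D)" unfolding D_eq by (simp only: mult_ac)
  have expand: "(3 * A + 4) * D = 3 * (A * D) + 4 * D" by (simp add: algebra_simps)
  have "1 * D \<le> A * D" using A_ge D_ge by (intro mult_right_mono) auto
  then have KD: "3 * (A * D) \<le> real K - D" "0 < real K - D" "real K - D \<le> real m - D"
    and SD: "3 * (A * D) + 4 * D \<le> real N - real K - real m + D" "0 < real N - real K - real m + D"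
    using K_ge rest_ge of_nat_mono[OF K_le, where 'a = real] D_ge unfolding expand by linarith+
  have small: "3 * r * y \<le> real K - D" "3 * r * y \<le> real m - D"
      "3 * r * (y + 1) \<le> real N - real K - real m + D"
    using ry KD SD r_le_D D_ge by (auto simp: distrib_left)
  have "1 * y \<le> 3 * r * y" using y r_ge by (intro mult_right_mono) auto
  then have y_le: "y \<le> real K - D" "y \<le> real m - D" using small by auto
  have "(1 - 1 / r) * D * (real N - real K - real m + real d + 1)
      \<le> (1 - 1 / r) * D * (real N - real K - real m + D + y + 1)"
    using y r_ge D_ge by (intro mult_left_mono) auto
  also have "\<dots> \<le> (real K - D - y) * (real m - D - y)"
    using KD SD small y r_ge D_ge mean_shifted by (intro shifted_product_le) auto
  also have "\<dots> \<le> (real K - real d) * (real m - real d)"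
    using y y_le by (intro mult_mono) auto
  finally show ?thesis .
qed

sublocale poisson_like_pmf "hypergeometric_pmf N K m" D r A
proof
  let ?h = "pmf (hypergeometric_pmf N K m)"
  have m_le: "m \<le> N" and K_le_m: "real K \<le> real m" using Km_le K_le by auto
  show "D = r * r" "r \<ge> 2" "A \<ge> 1" by (fact D_eq r_ge A_ge)+
  fix d
  show "(real d + 1) * ?h (Suc d) \<le> D * ?h d" if d: "D \<le> real d"
  proof (cases "d \<le> K")
    case True
    have "(real K - real d) * (real m - real d) \<le> (real K - D) * (real m - D)"
      using d True K_le_m by (intro mult_mono) auto
    also have "\<dots> \<le> D * (real N - real K - real m + real d + 1)"
      unfolding mean_shifted using d D_ge by (intro mult_left_mono) auto
    finally show ?thesis using True K_le Km_le by (intro pmf_hypergeometric_Suc_le)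
  next
    case False
    then show ?thesis using K_le m_le D_ge by (simp add: pmf_hypergeometric_eq_0)
  qed
  show "D * ?h d \<le> (real d + 1) * ?h (Suc d)" if d: "real d + 1 \<le> D"
  proof (intro pmf_hypergeometric_Suc_ge K_le Km_le)
    show "d \<le> K" using d D_le_K by linarith
    have "D * (real N - real K - real m + real d + 1) \<le> (real K - D) * (real m - D)"
      unfolding mean_shifted using d D_ge by (intro mult_left_mono) auto
    also have "\<dots> \<le> (real K - real d) * (real m - real d)"
      using d D_le_K K_le_m by (intro mult_mono) auto
    finally show "D * (real N - real K - real m + real d + 1) \<le> (real K - real d) * (real m - real d)" .
  qed
  show "(1 - 1 / r) * D * ?h d \<le> (real d + 1) * ?h (Suc d)" if "D - 1 \<le> real d" "real d \<le> D + A * r"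
  proof (intro pmf_hypergeometric_Suc_ge K_le Km_le near_product_le that)
    have "A * r \<le> A * D" using A_ge r_le_D by (intro mult_left_mono) auto
    moreover have "D + A * D \<le> (3 * A + 4) * D"
      using A_ge D_ge by (simp add: algebra_simps)
    ultimately show "d \<le> K" using that K_ge by linarith
  qed
qed

end

subsection \<open>Degrees in the null model\<close>

lemma finite_all_edges [simp]: "finite (all_edges n)"
proof -
  have "all_edges n \<subseteq> Pow {..<n}" by (auto simp: all_edges_def)
  then show ?thesis by (rule finite_subset) simp
qed

lemma card_all_edges: "card (all_edges n) = N_pairs n"
  unfolding all_edges_def N_pairs_def using n_subsets[of "{..<n}" 2] by simp

lemma real_N_pairs: "real (N_pairs n) = real n * (real n - 1) / 2"
proof (cases "n = 0")
  case False
  have "even (n * (n - 1))" by auto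
  then have "real (n * (n - 1) div 2) = real (n * (n - 1)) / real 2" by (rule real_of_nat_div)
  with False show ?thesis by (simp add: N_pairs_def choose_two of_nat_diff)
qed (simp add: N_pairs_def)

lemma incident_edges_subset: "incident_edges n v \<subseteq> all_edges n"
  by (auto simp: incident_edges_def)

lemma incident_edges_eq_image:
  assumes "v < n"
  shows "incident_edges n v = (\<lambda>u. {u, v}) ` ({..<n} - {v})"
proof (intro equalityI subsetI)
  fix e assume "e \<in> incident_edges n v"
  then have e: "e \<subseteq> {..<n}" "card e = 2" "v \<in> e"
    by (auto simp: incident_edges_def all_edges_def)
  then obtain x y where "e = {x, y}" "x \<noteq> y" by (meson card_2_iff)
  with e show "e \<in> (\<lambda>u. {u, v}) ` ({..<n} - {v})" by auto
qed (use assms in \<open>auto simp: incident_edges_def all_edges_def\<close>)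

lemma card_incident_edges:
  assumes "v < n"
  shows "card (incident_edges n v) = n - 1"
proof -
  have "inj_on (\<lambda>u. {u, v}) ({..<n} - {v})"
    by (auto simp: inj_on_def doubleton_eq_iff)
  then show ?thesis
    using assms by (simp add: incident_edges_eq_image card_image)
qed

lemma incident_edges_inter:
  assumes "u < n" "v < n" "u \<noteq> v"
  shows "incident_edges n u \<inter> incident_edges n v = {{u, v}}"
  using assms by (auto simp: incident_edges_eq_image doubleton_eq_iff)

lemma degree_eq_card_inter:
  assumes "G \<subseteq> all_edges n"
  shows "degree G v = card (G \<inter> incident_edges n v)"
proof -
  have "{e \<in> G. v \<in> e} = G \<inter> incident_edges n v"
    using assms by (auto simp: incident_edges_def)
  then show ?thesis by (simp add: degree_def)
qed

lemma max_degree_ge_iff: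
  assumes "n \<ge> 1"
  shows "t \<le> real (max_degree n G) \<longleftrightarrow> (\<exists>v<n. t \<le> real (degree G v))"
proof -
  have fin: "finite (degree G ` {..<n})" "degree G ` {..<n} \<noteq> {}" using assms
    by (auto simp: lessThan_empty_iff)
  have "max_degree n G \<in> degree G ` {..<n}" unfolding max_degree_def using fin by (rule Max_in)
  moreover have "degree G v \<le> max_degree n G" if "v < n" for v
    unfolding max_degree_def using fin that by (intro Max_ge) auto
  ultimately show ?thesis by (auto intro: order_trans)
qed

lemma P0_eq_uniform_subset: "P0 n m = uniform_subset (all_edges n) m"
  by (simp add: P0_def uniform_subset_def)

lemma set_pmf_P0:
  assumes "m \<le> N_pairs n"
  shows "set_pmf (P0 n m) = {G. G \<subseteq> all_edges n \<and> card G = m}"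
  using assms by (simp add: P0_eq_uniform_subset set_pmf_uniform_subset card_all_edges)

lemma pmf_P0:
  assumes "m \<le> N_pairs n"
  shows "pmf (P0 n m) G = (if G \<in> set_pmf (P0 n m) then 1 / real (N_pairs n choose m) else 0)"
  unfolding set_pmf_P0[OF assms]
  using assms by (simp add: P0_eq_uniform_subset pmf_uniform_subset card_all_edges)

lemma integrable_P0 [simp]:
  fixes f :: "nat set set \<Rightarrow> real"
  assumes "m \<le> N_pairs n"
  shows "integrable (measure_pmf (P0 n m)) f"
  using assms by (intro integrable_measure_pmf_finite) (simp add: set_pmf_P0)

lemma map_degree_P0:
  assumes "v < n" "m \<le> N_pairs n"
  shows "map_pmf (\<lambda>G. degree G v) (P0 n m) = hypergeometric_pmf (N_pairs n) (n - 1) m"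
proof -
  have "map_pmf (\<lambda>G. degree G v) (P0 n m)
      = map_pmf (\<lambda>G. card (G \<inter> incident_edges n v)) (P0 n m)"
    using set_pmf_P0[OF assms(2)] by (intro map_pmf_cong) (auto simp: degree_eq_card_inter)
  also have "\<dots> = hypergeometric_pmf (N_pairs n) (n - 1) m"
    unfolding P0_eq_uniform_subset using assms incident_edges_subset[of n v]
    by (subst map_card_inter_uniform_subset) (auto simp: card_all_edges card_incident_edges)
  finally show ?thesis .
qed

lemma expectation_degree_P0:
  fixes f :: "nat \<Rightarrow> real"
  assumes "v < n" "m \<le> N_pairs n"
  shows "measure_pmf.expectation (P0 n m) (\<lambda>G. f (degree G v))
       = measure_pmf.expectation (hypergeometric_pmf (N_pairs n) (n - 1) m) f"
  unfolding map_degree_P0[OF assms, symmetric] by simp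

lemma prob_degree_P0:
  assumes "v < n" "m \<le> N_pairs n"
  shows "measure_pmf.prob (P0 n m) {G. degree G v \<in> S}
       = measure_pmf.prob (hypergeometric_pmf (N_pairs n) (n - 1) m) S"
  unfolding map_degree_P0[OF assms, symmetric] by (simp add: vimage_def)

lemma prob_max_degree_ge_le:
  assumes "n \<ge> 1" "m \<le> N_pairs n"
  shows "measure_pmf.prob (P0 n m) {G. t \<le> real (max_degree n G)}
       \<le> real n * measure_pmf.prob (hypergeometric_pmf (N_pairs n) (n - 1) m) {d. t \<le> real d}"
proof -
  have "{G. t \<le> real (max_degree n G)} = (\<Union>v<n. {G. degree G v \<in> {d. t \<le> real d}})"
    using max_degree_ge_iff[OF assms(1)] by auto
  then have "measure_pmf.prob (P0 n m) {G. t \<le> real (max_degree n G)}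
      \<le> (\<Sum>v<n. measure_pmf.prob (P0 n m) {G. degree G v \<in> {d. t \<le> real d}})"
    using measure_pmf.finite_measure_subadditive_finite[of "{..<n}"] by auto
  also have "\<dots> = real n * measure_pmf.prob (hypergeometric_pmf (N_pairs n) (n - 1) m) {d. t \<le> real d}"
    using assms by (simp add: prob_degree_P0 del: mem_Collect_eq cong: sum.cong_simp)
  finally show ?thesis .
qed

subsection \<open>Planted subsets and the likelihood ratio\<close>

definition planted_subset :: "'a set \<Rightarrow> 'a set \<Rightarrow> nat \<Rightarrow> nat \<Rightarrow> 'a set pmf" where
  "planted_subset E A m k =
     do { S \<leftarrow> uniform_subset A k;
          R \<leftarrow> uniform_subset (E - S) (m - k);
          return_pmf (S \<union> R) }"

lemma pmf_map_Un_uniform_subset: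
  assumes "finite E" "S \<subseteq> E" "card S \<le> m" "m \<le> card E"
  shows "pmf (map_pmf ((\<union>) S) (uniform_subset (E - S) (m - card S))) G
       = (if G \<subseteq> E \<and> card G = m \<and> S \<subseteq> G then 1 / real ((card E - card S) choose (m - card S)) else 0)"
proof -
  let ?R = "uniform_subset (E - S) (m - card S)"
  have finite_S: "finite S" using assms finite_subset by blast
  then have card: "card (E - S) = card E - card S" using assms by (simp add: card_Diff_subset)
  then have set_R: "set_pmf ?R = {R. R \<subseteq> E - S \<and> card R = m - card S}"
    using assms by (intro set_pmf_uniform_subset) auto
  show ?thesis
  proof (cases "G \<subseteq> E \<and> card G = m \<and> S \<subseteq> G")
    case True
    then have G: "card (G - S) = m - card S" "G - S \<subseteq> E - S" "S \<union> (G - S) = G"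
      using finite_S by (auto simp: card_Diff_subset)
    have "inj_on ((\<union>) S) (set_pmf ?R)" by (auto simp: set_R inj_on_def)
    then have "pmf (map_pmf ((\<union>) S) ?R) (S \<union> (G - S)) = pmf ?R (G - S)"
      using G by (intro pmf_map_inj) (auto simp: set_R)
    also have "\<dots> = 1 / real ((card E - card S) choose (m - card S))"
      using G assms card by (subst pmf_uniform_subset) auto
    finally show ?thesis using True G(3) by simp
  next
    case False
    have "G \<notin> (\<union>) S ` set_pmf ?R"
    proof
      assume "G \<in> (\<union>) S ` set_pmf ?R"
      then obtain R where R: "G = S \<union> R" "R \<subseteq> E - S" "card R = m - card S" by (auto simp: set_R)
      then have "finite R" "S \<inter> R = {}" using assms by (auto intro: finite_subset)
      then have "card G = m" using R finite_S assms by (simp add: card_Un_disjoint)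
      with False R assms show False by auto
    qed
    with False show ?thesis by (subst pmf_map_outside) auto
  qed
qed

lemma pmf_planted_subset:
  assumes "finite E" "A \<subseteq> E" "k \<le> card A" "k \<le> m" "m \<le> card E"
  shows "pmf (planted_subset E A m k) G
       = (if G \<subseteq> E \<and> card G = m
          then real (card (G \<inter> A) choose k) / (real (card A choose k) * real ((card E - k) choose (m - k))) else 0)"
proof -
  let ?\<S> = "{S. S \<subseteq> A \<and> card S = k}" and ?c = "1 / real ((card E - k) choose (m - k))"
  have finite_A: "finite A" using assms finite_subset by blast
  have pmf_given_S: "pmf (map_pmf ((\<union>) S) (uniform_subset (E - S) (m - k))) G
      = (if G \<subseteq> E \<and> card G = m \<and> S \<subseteq> G then ?c else 0)" if "S \<in> ?\<S>" for S
  proof -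
    have "S \<subseteq> E" "card S = k" using that assms by auto
    then show ?thesis using pmf_map_Un_uniform_subset[of E S m G] assms by simp
  qed
  have "planted_subset E A m k
      = pmf_of_set ?\<S> \<bind> (\<lambda>S. map_pmf ((\<union>) S) (uniform_subset (E - S) (m - k)))"
    by (simp add: planted_subset_def uniform_subset_def[of A] map_pmf_def)
  also have "pmf \<dots> G
      = (\<Sum>S\<in>?\<S>. pmf (map_pmf ((\<union>) S) (uniform_subset (E - S) (m - k))) G) / real (card ?\<S>)"
    using subsets_of_card_nonempty[OF finite_A assms(3)] finite_A by (intro pmf_bind_pmf_of_set) auto
  also have "\<dots> = (\<Sum>S\<in>?\<S>. if G \<subseteq> E \<and> card G = m \<and> S \<subseteq> G then ?c else 0) / real (card A choose k)"
    using pmf_given_S n_subsets[OF finite_A, of k] by simp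
  also have "(\<Sum>S\<in>?\<S>. if G \<subseteq> E \<and> card G = m \<and> S \<subseteq> G then ?c else 0)
      = (if G \<subseteq> E \<and> card G = m then real (card {S \<in> ?\<S>. S \<subseteq> G}) * ?c else 0)"
    using finite_A by (cases "G \<subseteq> E \<and> card G = m") (auto simp: sum.If_cases Int_def)
  also have "{S \<in> ?\<S>. S \<subseteq> G} = {S. S \<subseteq> G \<inter> A \<and> card S = k}" by auto
  also have "card \<dots> = card (G \<inter> A) choose k" using finite_A by (intro n_subsets) auto
  finally show ?thesis by simp
qed

lemma P1_eq_planted_subset:
  "P1 n m k = pmf_of_set {..<n} \<bind> (\<lambda>v. planted_subset (all_edges n) (incident_edges n v) m k)"
  by (simp add: P1_def planted_subset_def uniform_subset_def)

definition hub_weight :: "nat \<Rightarrow> nat \<Rightarrow> nat \<Rightarrow> nat \<Rightarrow> real" where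
  "hub_weight n m k d =
     real (d choose k) * real (N_pairs n choose m)
     / (real n * real ((n - 1) choose k) * real ((N_pairs n - k) choose (m - k)))"

lemma hub_weight_eq_0: "d < k \<Longrightarrow> hub_weight n m k d = 0"
  by (simp add: hub_weight_def)

lemma hub_weight_nonneg: "hub_weight n m k d \<ge> 0"
  by (simp add: hub_weight_def)

lemma hub_weight_mono: "d \<le> d' \<Longrightarrow> hub_weight n m k d \<le> hub_weight n m k d'"
  unfolding hub_weight_def by (intro divide_right_mono mult_right_mono) (auto simp: binomial_right_mono)

definition LR_part :: "nat \<Rightarrow> nat \<Rightarrow> nat \<Rightarrow> nat set \<Rightarrow> nat set set \<Rightarrow> real" where
  "LR_part n m k S G = (\<Sum>v<n. hub_weight n m k (degree G v) * indicator S (degree G v))"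

lemma LR_part_nonneg: "LR_part n m k S G \<ge> 0"
  unfolding LR_part_def by (intro sum_nonneg mult_nonneg_nonneg hub_weight_nonneg) auto

text \<open>The planted degree of the hub: \<open>k\<close> prescribed edges, and the remaining \<open>m - k\<close> edges hit the
other \<open>n - 1 - k\<close> possible edges at the hub hypergeometrically.\<close>

definition hub_degree_pmf :: "nat \<Rightarrow> nat \<Rightarrow> nat \<Rightarrow> nat pmf" where
  "hub_degree_pmf n m k = map_pmf ((+) k) (hypergeometric_pmf (N_pairs n - k) (n - 1 - k) (m - k))"

locale planted_model =
  fixes n m k :: nat
  assumes n_pos: "1 \<le> n" and k_le: "k \<le> n - 1" and m_ge: "n - 1 \<le> m" and m_le: "m \<le> N_pairs n"
begin

abbreviation "P \<equiv> measure_pmf.prob (P0 n m)"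
abbreviation "E \<equiv> measure_pmf.expectation (P0 n m)"
abbreviation "degree_pmf \<equiv> hypergeometric_pmf (N_pairs n) (n - 1) m"

lemma pmf_P1: "pmf (P1 n m k) G = LR_part n m k UNIV G * pmf (P0 n m) G"
proof -
  let ?c = "real ((n - 1) choose k) * real ((N_pairs n - k) choose (m - k))"
  have "pmf (P1 n m k) G
      = (\<Sum>v<n. pmf (planted_subset (all_edges n) (incident_edges n v) m k) G) / real n"
    unfolding P1_eq_planted_subset using n_pos
    by (subst pmf_bind_pmf_of_set) (auto simp: lessThan_empty_iff)
  also have "\<dots> = (\<Sum>v<n. if G \<in> set_pmf (P0 n m) then real (degree G v choose k) / ?c else 0) / real n"
    using k_le m_ge m_le incident_edges_subset[of n]
    by (intro arg_cong2[where f = "(/)"] sum.cong)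
      (auto simp: pmf_planted_subset set_pmf_P0 card_all_edges card_incident_edges degree_eq_card_inter)
  also have "\<dots> = LR_part n m k UNIV G * pmf (P0 n m) G"
    using m_le by (simp add: pmf_P0 LR_part_def hub_weight_def sum_divide_distrib sum_distrib_right mult_ac)
  finally show ?thesis .
qed

lemma LR_eq_LR_part:
  assumes "G \<in> set_pmf (P0 n m)"
  shows "LR n m k G = LR_part n m k UNIV G"
  using assms by (simp add: LR_def pmf_P1 set_pmf_iff)

lemma prob_P1: "measure_pmf.prob (P1 n m k) X = E (\<lambda>G. LR_part n m k UNIV G * indicator X G)"
proof -
  let ?U = "set_pmf (P0 n m)"
  have finite: "finite ?U" using m_le by (simp add: set_pmf_P0)
  have "measure_pmf.prob (P1 n m k) X = measure_pmf.expectation (P1 n m k) (indicator X)"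
    by simp
  also have "\<dots> = (\<Sum>G\<in>?U. indicator X G * pmf (P1 n m k) G)"
    using finite by (intro integral_measure_pmf_real) (auto simp: set_pmf_iff pmf_P1)
  also have "\<dots> = (\<Sum>G\<in>?U. (LR_part n m k UNIV G * indicator X G) * pmf (P0 n m) G)"
    by (simp add: pmf_P1 mult_ac)
  also have "\<dots> = E (\<lambda>G. LR_part n m k UNIV G * indicator X G)"
    using finite by (intro integral_measure_pmf_real[symmetric]) auto
  finally show ?thesis .
qed

lemma pmf_hub_degree: "pmf (hub_degree_pmf n m k) d = real n * (hub_weight n m k d * pmf degree_pmf d)"
proof (cases "k \<le> d \<and> d \<le> n - 1")
  case True
  then have "((n - 1) choose d) * (d choose k) = ((n - 1) choose k) * ((n - 1 - k) choose (d - k))"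
    by (intro choose_mult) auto
  then have choose: "real ((n - 1) choose d) * real (d choose k)
      = real ((n - 1) choose k) * real ((n - 1 - k) choose (d - k))"
    unfolding of_nat_mult[symmetric] by simp
  have pos: "real (N_pairs n choose m) > 0" "real ((n - 1) choose k) > 0" "real n > 0"
    using n_pos k_le m_le by auto
  have diff: "N_pairs n - k - (n - 1 - k) = N_pairs n - (n - 1)" "m - k - (d - k) = m - d"
    using True k_le by auto
  have "pmf (hub_degree_pmf n m k) (k + (d - k))
      = pmf (hypergeometric_pmf (N_pairs n - k) (n - 1 - k) (m - k)) (d - k)"
    unfolding hub_degree_pmf_def by (intro pmf_map_inj') simp
  also have "\<dots> = real ((n - 1 - k) choose (d - k)) * real ((N_pairs n - (n - 1)) choose (m - d))
       / real ((N_pairs n - k) choose (m - k))"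
    using k_le m_ge m_le unfolding diff[symmetric] by (intro pmf_hypergeometric) auto
  also have "\<dots> = (real ((n - 1) choose d) * real (d choose k))
        * real ((N_pairs n - (n - 1)) choose (m - d))
       / (real ((n - 1) choose k) * real ((N_pairs n - k) choose (m - k)))"
    unfolding choose using pos by simp
  also have "\<dots> = real n * (hub_weight n m k d * pmf degree_pmf d)"
    using pos m_ge m_le by (simp add: pmf_hypergeometric hub_weight_def)
  finally show ?thesis using True by simp
next
  case False
  have "set_pmf (hypergeometric_pmf (N_pairs n - k) (n - 1 - k) (m - k)) \<subseteq> {..n - 1 - k}"
    using m_ge m_le by (intro set_pmf_hypergeometric_subset) auto
  then have "d \<notin> set_pmf (hub_degree_pmf n m k)"
    using False k_le by (force simp: hub_degree_pmf_def)
  moreover have "hub_weight n m k d * pmf degree_pmf d = 0"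
    using False m_ge m_le by (auto simp: hub_weight_eq_0 pmf_hypergeometric_eq_0 not_le)
  ultimately show ?thesis by (simp add: set_pmf_iff)
qed

lemma expectation_hub_weight:
  assumes "v < n"
  shows "E (\<lambda>G. hub_weight n m k (degree G v) * indicator S (degree G v))
       = measure_pmf.prob (hub_degree_pmf n m k) S / real n"
proof -
  have supp: "set_pmf degree_pmf \<subseteq> {..n - 1}"
    using m_ge m_le by (rule set_pmf_hypergeometric_subset)
  have "measure_pmf.prob (hub_degree_pmf n m k) S
        = measure_pmf.expectation (hub_degree_pmf n m k) (indicator S)"
    by simp
  also have "\<dots> = (\<Sum>d\<le>n - 1. indicator S d * pmf (hub_degree_pmf n m k) d)"
    using supp by (intro integral_measure_pmf_real) (auto simp: set_pmf_iff pmf_hub_degree)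
  also have "\<dots> = real n * (\<Sum>d\<le>n - 1. (hub_weight n m k d * indicator S d) * pmf degree_pmf d)"
    unfolding sum_distrib_left by (intro sum.cong refl) (simp add: pmf_hub_degree)
  also have "(\<Sum>d\<le>n - 1. (hub_weight n m k d * indicator S d) * pmf degree_pmf d)
      = measure_pmf.expectation degree_pmf (\<lambda>d. hub_weight n m k d * indicator S d)"
    using supp by (intro integral_measure_pmf_real[symmetric]) auto
  also have "\<dots> = E (\<lambda>G. hub_weight n m k (degree G v) * indicator S (degree G v))"
    using assms m_le by (intro expectation_degree_P0[symmetric])
  finally show ?thesis using n_pos by simp
qed

lemma expectation_LR_part: "E (LR_part n m k S) = measure_pmf.prob (hub_degree_pmf n m k) S"
  unfolding LR_part_def using m_le n_pos
    by (subst Bochner_Integration.integral_sum) (auto simp: expectation_hub_weight)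

end

subsection \<open>Approximate independence of two degrees\<close>

lemma shifted_ratio_bounds:
  fixes u v i :: real
  assumes "0 < u" "0 < v" "0 \<le> i"
  shows "u / (v + i) \<le> (u + i) / v" "(u + i) / v \<le> exp (i / u + i / v) * (u / (v + i))"
proof -
  show "u / (v + i) \<le> (u + i) / v" using assms by (intro frac_le) auto
  have "(u + i) / v = (1 + i / u) * (1 + i / v) * (u / (v + i))"
    using assms by (simp add: add_divide_distrib[symmetric] divide_simps)
  also have "\<dots> \<le> (exp (i / u) * exp (i / v)) * (u / (v + i))"
    using assms by (intro mult_right_mono mult_mono exp_ge_add_one_self) auto
  finally show "(u + i) / v \<le> exp (i / u + i / v) * (u / (v + i))" by (simp add: exp_add)
qed

lemma binomial_shift_le:
  fixes X m c :: nat
  defines "e \<equiv> \<lambda>j. real (X choose (m - j))"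
  assumes m: "0 < m" "4 * c \<le> m" "2 * m \<le> X" and "i \<le> c"
    and st: "s + i \<le> 2 * c" "t + i \<le> 2 * c" "s \<le> t + c" "t \<le> s + c"
  shows "e (s + i) * e t \<le> exp (3 * real c / real m) ^ c * (e (t + i) * e s)"
proof -
  let ?\<Theta> = "exp (3 * real c / real m)" and ?q = "\<lambda>j. e (j + i) / e j"
  have e_pos: "e j > 0" for j using m by (simp add: e_def)
  have step: "?q (Suc j) \<le> ?\<Theta> * ?q j \<and> ?q j \<le> ?\<Theta> * ?q (Suc j)" if "j < 2 * c - i" for j
  proof -
    define u v where "u = real m - real (j + i)" and "v = real X - real m + real j + 1"
    have "real (j + i) \<le> real m / 2" "real i \<le> real c" "2 * real m \<le> real X" "0 < real m"
      using that m \<open>i \<le> c\<close> by auto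
    then have uv: "real m / 2 \<le> u" "real m \<le> v" "0 < u" "0 < v" "real i \<le> real c" "0 < real m"
      by (auto simp: u_def v_def)
    have e_Suc: "e (Suc j) = (u + real i) / v * e j" "e (Suc (j + i)) = u / (v + real i) * e (j + i)"
      using binomial_diff_Suc[of j m X] binomial_diff_Suc[of "j + i" m X] uv m
      by (auto simp: e_def u_def v_def field_simps)
    have q_Suc: "?q (Suc j) = (u / (v + real i)) / ((u + real i) / v) * ?q j"
      using e_Suc by (simp add: mult_ac)
    have q_nonneg: "0 \<le> ?q j" using e_pos[of j] e_pos[of "j + i"] by simp
    have pos: "0 < (u + real i) / v" using uv by simp
    note ratio = shifted_ratio_bounds[OF uv(3,4), of "real i"]
    have "real i / u \<le> real c / (real m / 2)" "real i / v \<le> real c / real m"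
      using uv by (intro frac_le; simp)+
    then have "exp (real i / u + real i / v) \<le> ?\<Theta>"
      by (simp add: add_divide_distrib[symmetric])
    then have "exp (real i / u + real i / v) * (u / (v + real i)) \<le> ?\<Theta> * (u / (v + real i))"
      using uv by (intro mult_right_mono) auto
    with ratio have up: "(u + real i) / v \<le> ?\<Theta> * (u / (v + real i))" by simp
    have "(u / (v + real i)) / ((u + real i) / v) \<le> 1" using ratio(1) pos
      by (simp only: divide_le_eq_1_pos)
    also have "1 \<le> ?\<Theta>" by simp
    finally have "?q (Suc j) \<le> ?\<Theta> * ?q j"
      unfolding q_Suc using q_nonneg by (rule mult_right_mono)
    moreover have "1 * ?q j \<le> ?\<Theta> * ((u / (v + real i)) / ((u + real i) / v)) * ?q j"
      using up pos q_nonneg by (intro mult_right_mono) (simp_all only: times_divide_eq_right pos_le_divide_eq mult_1)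
    ultimately show ?thesis unfolding q_Suc by (simp only: mult.assoc mult_1)
  qed
  have "?q s \<le> ?\<Theta> ^ c * ?q t"
    using step st e_pos by (intro ratio_chain_le[where M = "2 * c - i"]) (auto intro: less_imp_le)
  then show ?thesis using e_pos[of s] e_pos[of t] by (simp add: field_simps)
qed

lemma binomial_cross_ratio_le:
  fixes X m c :: nat
  defines "e \<equiv> \<lambda>j. real (X choose (m - j))"
  assumes "0 < m" "4 * c \<le> m" "2 * m \<le> X" and "a \<le> c" "b \<le> c" "a' \<le> c" "b' \<le> c"
  shows "e (a + b) * e (a' + b') \<le> exp (3 * real c / real m) ^ c * (e (a + b') * e (a' + b))"
proof (cases "a \<le> a'")
  case True
  have "e (a + b' + (a' - a)) * e (a + b)
        \<le> exp (3 * real c / real m) ^ c * (e (a + b + (a' - a)) * e (a + b'))"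
    unfolding e_def using assms True by (intro binomial_shift_le) auto
  then show ?thesis using True by (simp add: mult_ac add_ac)
next
  case False
  have "e (a' + b + (a - a')) * e (a' + b')
        \<le> exp (3 * real c / real m) ^ c * (e (a' + b' + (a - a')) * e (a' + b))"
    unfolding e_def using assms False by (intro binomial_shift_le) auto
  then show ?thesis using False by (simp add: mult_ac add_ac)
qed

lemma degree_eq_card_inter_add:
  assumes "u < n" "v < n" "u \<noteq> v" "G \<subseteq> all_edges n"
  shows "degree G u = card (G \<inter> {{u, v}}) + card (G \<inter> (incident_edges n u - {{u, v}}))"
proof -
  have "G \<inter> incident_edges n u = (G \<inter> {{u, v}}) \<union> (G \<inter> (incident_edges n u - {{u, v}}))"
    using incident_edges_inter[OF assms(1-3)] by auto
  moreover have "finite G" using assms finite_all_edges finite_subset by blast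
  ultimately show ?thesis
    using assms by (simp add: degree_eq_card_inter) (subst card_Un_disjoint; auto)
qed

lemma card_incident_edges_minus:
  assumes "u < n" "v < n" "u \<noteq> v"
  shows "card (incident_edges n u - {{u, v}}) = n - 2"
proof -
  have "{u, v} \<in> incident_edges n u" using incident_edges_inter[OF assms] by auto
  then show ?thesis using assms by (simp add: card_incident_edges)
qed

definition star_degree_graphs :: "nat \<Rightarrow> nat \<Rightarrow> nat \<Rightarrow> nat \<Rightarrow> nat \<Rightarrow> nat \<Rightarrow> nat \<Rightarrow> nat set set set" where
  "star_degree_graphs n m u v c a b = {G. G \<subseteq> all_edges n \<and> card G = m \<and> card (G \<inter> {{u, v}}) = c
     \<and> card (G \<inter> (incident_edges n u - {{u, v}})) = a \<and> card (G \<inter> (incident_edges n v - {{u, v}})) = b}"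

lemma card_star_degree_graphs:
  assumes "u < n" "v < n" "u \<noteq> v" "a + b + c \<le> m"
  shows "card (star_degree_graphs n m u v c a b)
        = (1 choose c) * ((n - 2) choose a) * ((n - 2) choose b)
         * ((N_pairs n - (2 * n - 3)) choose (m - (a + b + c)))"
proof -
  have "1 + (n - 2) + (n - 2) = 2 * n - 3" using assms by auto
  then have "N_pairs n - 1 - (n - 2) - (n - 2) = N_pairs n - (2 * n - 3)"
      "m - c - a - b = m - (a + b + c)"
    by (simp_all add: add_ac)
  then show ?thesis
    using card_subsets_with_three_inters[of "all_edges n" "incident_edges n u - {{u, v}}"
        "incident_edges n v - {{u, v}}" "{{u, v}}" a b c m]
      incident_edges_inter[OF assms(1-3)] incident_edges_subset[of n u] incident_edges_subset[of n v] assms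
      card_incident_edges_minus[of u n v] card_incident_edges_minus[of v n u]
    by (simp add: star_degree_graphs_def card_all_edges insert_commute[of v u]) blast
qed

lemma degree_pair_graphs_eq:
  assumes "u < n" "v < n" "u \<noteq> v"
  shows "{G. G \<subseteq> all_edges n \<and> card G = m \<and> degree G u = a \<and> degree G v = b}
       = star_degree_graphs n m u v 0 a b
         \<union> (if a = 0 \<or> b = 0 then {} else star_degree_graphs n m u v 1 (a - 1) (b - 1))"
    (is "?pair = ?stars")
proof (rule set_eqI)
  fix G
  show "G \<in> ?pair \<longleftrightarrow> G \<in> ?stars"
  proof (cases "G \<subseteq> all_edges n")
    case True
    have "card (G \<inter> {{u, v}}) \<le> 1" using card_mono[of "{{u, v}}" "G \<inter> {{u, v}}"] by simp
    then have "card (G \<inter> {{u, v}}) = 0 \<or> card (G \<inter> {{u, v}}) = 1" by linarith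
    moreover have "degree G v = card (G \<inter> {{u, v}}) + card (G \<inter> (incident_edges n v - {{u, v}}))"
      using degree_eq_card_inter_add[of v n u G] assms True by (simp add: insert_commute)
    moreover note degree_eq_card_inter_add[OF assms True]
    ultimately show ?thesis using True by (auto simp: star_degree_graphs_def)
  qed (auto simp: star_degree_graphs_def)
qed

lemma card_degree_pair_graphs:
  assumes "u < n" "v < n" "u \<noteq> v"
  shows "card {G. G \<subseteq> all_edges n \<and> card G = m \<and> degree G u = a \<and> degree G v = b}
       = card (star_degree_graphs n m u v 0 a b)
         + (if a = 0 \<or> b = 0 then 0 else card (star_degree_graphs n m u v 1 (a - 1) (b - 1)))"
proof -
  have "finite (star_degree_graphs n m u v c a b)" for c a b
    by (rule finite_subset[of _ "Pow (all_edges n)"]) (auto simp: star_degree_graphs_def)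
  moreover have "G \<in> star_degree_graphs n m u v c a b \<Longrightarrow> card (G \<inter> {{u, v}}) = c" for G c a b
    by (simp add: star_degree_graphs_def)
  then have "star_degree_graphs n m u v 0 a b \<inter> star_degree_graphs n m u v 1 a' b' = {}" for a' b'
    by (metis disjoint_iff zero_neq_one)
  ultimately show ?thesis
    unfolding degree_pair_graphs_eq[OF assms]
    by (cases "a = 0 \<or> b = 0") (simp_all only: if_True if_False Un_empty_right add_0_right card_Un_disjoint)
qed

lemma pmf_degree_pair:
  assumes "u < n" "v < n" "u \<noteq> v" "a + b \<le> m" "m \<le> N_pairs n"
  defines "e \<equiv> \<lambda>j. real ((N_pairs n - (2 * n - 3)) choose (m - j))"
  shows "pmf (map_pmf (\<lambda>G. (degree G u, degree G v)) (P0 n m)) (a, b) * real (N_pairs n choose m)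
       = real ((n - 2) choose a) * real ((n - 2) choose b) * e (a + b)
       + (if a = 0 \<or> b = 0 then 0
          else real ((n - 2) choose (a - 1)) * real ((n - 2) choose (b - 1)) * e (a + b - 1))"
    (is "_ = ?rhs")
proof -
  let ?pair = "{G. G \<subseteq> all_edges n \<and> card G = m \<and> degree G u = a \<and> degree G v = b}"
  note card_pair = card_degree_pair_graphs[OF assms(1-3), of m a b]
  have card_0: "card (star_degree_graphs n m u v 0 a b)
      = ((n - 2) choose a) * ((n - 2) choose b) * ((N_pairs n - (2 * n - 3)) choose (m - (a + b)))"
    using card_star_degree_graphs[OF assms(1-3), of a b 0 m] assms(4) by simp
  have "real (card ?pair) = ?rhs"
  proof (cases "a = 0 \<or> b = 0")
    case True
    then show ?thesis using card_pair card_0 by (auto simp: e_def)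
  next
    case False
    then have "a - 1 + (b - 1) + 1 = a + b - 1" "a + b - 1 \<le> m" using assms by linarith+
    then show ?thesis
      using False card_pair card_0 card_star_degree_graphs[OF assms(1-3), of "a - 1" "b - 1" 1 m]
      unfolding e_def by simp
  qed
  moreover have "pmf (map_pmf (\<lambda>G. (degree G u, degree G v)) (P0 n m)) (a, b)
      = real (card ?pair) / real (N_pairs n choose m)"
    using assms by (simp add: pmf_map P0_eq_uniform_subset prob_uniform_subset card_all_edges vimage_def)
  ultimately show ?thesis using assms by simp
qed

lemma binomial_le_binomial_Suc:
  assumes "Suc x \<le> c" "2 * c + 2 \<le> n"
  shows "real ((n - 2) choose x) \<le> 2 * real c / real n * real ((n - 2) choose Suc x)"
proof -
  have "real (n - 2) - real x \<ge> real n / 2" using assms by (simp add: of_nat_diff)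
  moreover have "(real x + 1) * real ((n - 2) choose Suc x)
        = (real (n - 2) - real x) * real ((n - 2) choose x)"
    using assms by (intro real_Suc_times_binomial_Suc) simp
  ultimately have "real n / 2 * real ((n - 2) choose x) \<le> (real x + 1) * real ((n - 2) choose Suc x)"
    by (metis mult_right_mono of_nat_0_le_iff)
  also have "\<dots> \<le> real c * real ((n - 2) choose Suc x)"
    using assms by (intro mult_right_mono) auto
  finally show ?thesis using assms by (simp add: field_simps)
qed

locale sparse_degrees =
  fixes n m c :: nat
  assumes m_pos: "0 < m" and c_le_m: "4 * c \<le> m" and c_le_n: "2 * c + 2 \<le> n"
    and m_le_N: "2 * m + 2 * n \<le> N_pairs n"
begin

abbreviation "rest \<equiv> \<lambda>j. real ((N_pairs n - (2 * n - 3)) choose (m - j))"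

lemma rest_le_rest_Suc:
  assumes "Suc j \<le> 2 * c"
  shows "rest j \<le> (real n)\<^sup>2 / real m * rest (Suc j)"
proof -
  let ?X = "N_pairs n - (2 * n - 3)"
  have "real ?X \<le> real (N_pairs n)" by simp
  also have "\<dots> \<le> (real n)\<^sup>2 / 2" by (simp add: real_N_pairs power2_eq_square algebra_simps)
  finally have X: "real ?X - real m + real j + 1 \<le> (real n)\<^sup>2 / 2" using assms c_le_m by linarith
  have "real m / 2 * rest j \<le> (real m - real j) * rest j"
    using assms c_le_m by (intro mult_right_mono) auto
  also have "\<dots> = (real ?X - real m + real j + 1) * rest (Suc j)"
    using assms c_le_m m_le_N by (intro binomial_diff_Suc[symmetric]) auto
  also have "\<dots> \<le> (real n)\<^sup>2 / 2 * rest (Suc j)"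
    using X by (intro mult_right_mono) auto
  finally show ?thesis using m_pos by (simp add: field_simps)
qed

lemma pmf_degree_pair_bounds:
  assumes "u < n" "v < n" "u \<noteq> v" "a \<le> c" "b \<le> c"
  defines "J \<equiv> pmf (map_pmf (\<lambda>G. (degree G u, degree G v)) (P0 n m)) (a, b) * real (N_pairs n choose m)"
    and "I \<equiv> real ((n - 2) choose a) * real ((n - 2) choose b) * rest (a + b)"
  shows "I \<le> J" "J \<le> exp (4 * (real c)\<^sup>2 / real m) * I"
proof -
  have J: "J = I + (if a = 0 \<or> b = 0 then 0
      else real ((n - 2) choose (a - 1)) * real ((n - 2) choose (b - 1)) * rest (a + b - 1))"
    unfolding J_def I_def using assms c_le_m m_le_N by (intro pmf_degree_pair) auto
  show "I \<le> J" unfolding J by simp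
  have "J \<le> (1 + 4 * (real c)\<^sup>2 / real m) * I"
  proof (cases "a = 0 \<or> b = 0")
    case False
    then obtain x y where xy: "a = Suc x" "b = Suc y" by (meson not0_implies_Suc)
    have "real ((n - 2) choose x) * real ((n - 2) choose y) * rest (Suc (x + y))
        \<le> (2 * real c / real n * real ((n - 2) choose a)) * (2 * real c / real n * real ((n - 2) choose b))
          * ((real n)\<^sup>2 / real m * rest (Suc (Suc (x + y))))"
      unfolding xy using assms xy c_le_n
      by (intro mult_mono binomial_le_binomial_Suc rest_le_rest_Suc) auto
    also have "\<dots> = 4 * (real c)\<^sup>2 / real m * I"
      using c_le_n by (simp add: I_def xy power2_eq_square)
    finally show ?thesis using J xy by (simp add: distrib_right)
  qed (use J in \<open>auto simp: I_def distrib_right\<close>)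
  also have "\<dots> \<le> exp (4 * (real c)\<^sup>2 / real m) * I"
    unfolding I_def by (intro mult_right_mono exp_ge_add_one_self) auto
  finally show "J \<le> exp (4 * (real c)\<^sup>2 / real m) * I" .
qed

lemma pmf_degree_pair_cross_ratio_le:
  assumes "u < n" "v < n" "u \<noteq> v" "a \<le> c" "b \<le> c" "a' \<le> c" "b' \<le> c"
  defines "J \<equiv> \<lambda>a b. pmf (map_pmf (\<lambda>G. (degree G u, degree G v)) (P0 n m)) (a, b)"
  shows "J a b * J a' b' \<le> exp (11 * (real c)\<^sup>2 / real m) * (J a b' * J a' b)"
proof -
  define \<delta> where "\<delta> = (real c)\<^sup>2 / real m"
  define Z where "Z = real (N_pairs n choose m)"
  define F where "F a b = J a b * Z" for a b
  define H where "H a b = real ((n - 2) choose a) * real ((n - 2) choose b) * rest (a + b)" for a b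
  have Z: "Z > 0" using m_le_N by (simp add: Z_def)
  have bounds: "H a b \<le> F a b" "F a b \<le> exp (4 * \<delta>) * H a b" if "a \<le> c" "b \<le> c" for a b
    using pmf_degree_pair_bounds[OF assms(1-3) that] by (simp_all add: F_def H_def J_def Z_def \<delta>_def)
  have nonneg: "0 \<le> H a b" "0 \<le> F a b" for a b using Z by (auto simp: H_def F_def J_def)
  have H_cross: "H a b * H a' b' \<le> exp (3 * \<delta>) * (H a b' * H a' b)"
  proof -
    have "exp (3 * \<delta>) = exp (3 * real c / real m) ^ c"
      by (simp add: \<delta>_def power2_eq_square flip: exp_of_nat_mult)
    then have "rest (a + b) * rest (a' + b') \<le> exp (3 * \<delta>) * (rest (a + b') * rest (a' + b))"
      using binomial_cross_ratio_le[of m c "N_pairs n - (2 * n - 3)" a b a' b']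
        assms m_pos c_le_m m_le_N
      by simp
    then have "(real ((n - 2) choose a) * real ((n - 2) choose b) * real ((n - 2) choose a')
          * real ((n - 2) choose b'))
          * (rest (a + b) * rest (a' + b'))
        \<le> (real ((n - 2) choose a) * real ((n - 2) choose b) * real ((n - 2) choose a') * real ((n - 2) choose b'))
          * (exp (3 * \<delta>) * (rest (a + b') * rest (a' + b)))"
      by (rule mult_left_mono) simp
    then show ?thesis unfolding H_def by (simp only: mult_ac)
  qed
  have "F a b * F a' b' \<le> (exp (4 * \<delta>) * H a b) * (exp (4 * \<delta>) * H a' b')"
    using bounds[of a b] bounds[of a' b'] assms nonneg by (intro mult_mono[of "F a b"]) auto
  also have "\<dots> = exp (8 * \<delta>) * (H a b * H a' b')"
    using exp_add[of "4 * \<delta>" "4 * \<delta>"] by simp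
  also have "\<dots> \<le> exp (8 * \<delta>) * (exp (3 * \<delta>) * (H a b' * H a' b))"
    using H_cross by simp
  also have "\<dots> = exp (11 * \<delta>) * (H a b' * H a' b)"
    using exp_add[of "8 * \<delta>" "3 * \<delta>"] by simp
  also have "\<dots> \<le> exp (11 * \<delta>) * (F a b' * F a' b)"
    using bounds assms nonneg by (intro mult_left_mono[OF mult_mono]) auto
  finally have "(J a b * J a' b') * (Z * Z) \<le> (exp (11 * \<delta>) * (J a b' * J a' b)) * (Z * Z)"
    by (simp only: F_def mult_ac)
  then show ?thesis using Z by (simp add: \<delta>_def)
qed

lemma expectation_degree_mult_le:
  fixes f g :: "nat \<Rightarrow> real"
  assumes "u < n" "v < n" "u \<noteq> v"
    and f: "\<And>d. 0 \<le> f d" "\<And>d. c < d \<Longrightarrow> f d = 0" and g: "\<And>d. 0 \<le> g d" "\<And>d. c < d \<Longrightarrow> g d = 0"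
    and tail: "measure_pmf.prob (hypergeometric_pmf (N_pairs n) (n - 1) m) {c<..} \<le> \<tau>"
  defines "E \<equiv> measure_pmf.expectation (P0 n m)"
  shows "(1 - 2 * \<tau>) * E (\<lambda>G. f (degree G u) * g (degree G v))
       \<le> exp (11 * (real c)\<^sup>2 / real m) * (E (\<lambda>G. f (degree G u)) * E (\<lambda>G. g (degree G v)))"
proof -
  have m_le: "m \<le> N_pairs n" using m_le_N by simp
  define p where "p = map_pmf (\<lambda>G. (degree G u, degree G v)) (P0 n m)"
  have "({G. (degree G u, degree G v) \<in> {..c} \<times> {..c}} \<union> {G. degree G u \<in> {c<..}}) \<union> {G. degree G v \<in> {c<..}} = UNIV"
    by auto
  then have "1 = measure_pmf.prob (P0 n m)
      (({G. (degree G u, degree G v) \<in> {..c} \<times> {..c}} \<union> {G. degree G u \<in> {c<..}}) \<union> {G. degree G v \<in> {c<..}})"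
    by (simp only:) simp
  also have "\<dots> \<le> (measure_pmf.prob (P0 n m) {G. (degree G u, degree G v) \<in> {..c} \<times> {..c}}
      + measure_pmf.prob (P0 n m) {G. degree G u \<in> {c<..}}) + measure_pmf.prob (P0 n m) {G. degree G v \<in> {c<..}}"
    by (intro order_trans[OF measure_Un_le] add_right_mono measure_Un_le) auto
  also have "\<dots> \<le> measure_pmf.prob p ({..c} \<times> {..c}) + \<tau> + \<tau>"
    using tail assms m_le prob_degree_P0[of u n m "{c<..}"] prob_degree_P0[of v n m "{c<..}"]
    by (intro add_mono) (auto simp: p_def vimage_def)
  finally have "1 - 2 * \<tau> \<le> measure_pmf.prob p ({..c} \<times> {..c})" by simp
  moreover have "0 \<le> E (\<lambda>G. f (degree G u) * g (degree G v))"
    using f g by (simp add: E_def integral_nonneg_AE)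
  ultimately have "(1 - 2 * \<tau>) * E (\<lambda>G. f (degree G u) * g (degree G v))
      \<le> E (\<lambda>G. f (degree G u) * g (degree G v)) * measure_pmf.prob p ({..c} \<times> {..c})"
    by (subst mult.commute) (rule mult_left_mono)
  also have "\<dots> = measure_pmf.expectation p (\<lambda>(a, b). f a * g b) * measure_pmf.prob p ({..c} \<times> {..c})"
    by (simp add: E_def p_def)
  also have "\<dots> \<le> exp (11 * (real c)\<^sup>2 / real m)
      * (measure_pmf.expectation p (\<lambda>(a, b). f a) * measure_pmf.expectation p (\<lambda>(a, b). g b))"
    unfolding p_def using assms m_le
    by (intro expectation_mult_le_of_cross_ratio pmf_degree_pair_cross_ratio_le) (auto simp: set_pmf_P0)
  also have "\<dots> = exp (11 * (real c)\<^sup>2 / real m) * (E (\<lambda>G. f (degree G u)) * E (\<lambda>G. g (degree G v)))"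
    by (simp add: E_def p_def)
  finally show ?thesis .
qed

end

subsection \<open>Second moment bounds\<close>

context planted_model
begin

lemma second_moment_LR_part_le:
  assumes "sparse_degrees n m c" and S: "S \<subseteq> {..c}" "\<And>d. d \<in> S \<Longrightarrow> hub_weight n m k d \<le> \<omega>"
    and tail: "measure_pmf.prob degree_pmf {c<..} \<le> \<tau>" "\<tau> < 1 / 2"
  defines "q \<equiv> measure_pmf.prob (hub_degree_pmf n m k) S"
  shows "E (\<lambda>G. (LR_part n m k S G)\<^sup>2) \<le> \<omega> * q + exp (11 * (real c)\<^sup>2 / real m) / (1 - 2 * \<tau>) * q\<^sup>2"
proof -
  interpret sparse_degrees n m c by fact
  define g where "g d = hub_weight n m k d * indicator S d" for d
  let ?\<theta> = "exp (11 * (real c)\<^sup>2 / real m) / (1 - 2 * \<tau>)"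
  have g: "0 \<le> g d" "c < d \<Longrightarrow> g d = 0" "g d * g d \<le> \<omega> * g d" for d
    using S hub_weight_nonneg[of n m k d] by (auto simp: g_def indicator_def intro: mult_right_mono)
  have LR_part_eq: "LR_part n m k S G = (\<Sum>v<n. g (degree G v))" for G
    by (simp add: LR_part_def g_def)
  have mean: "E (\<lambda>G. g (degree G v)) = q / real n" if "v < n" for v
    unfolding g_def q_def using that by (rule expectation_hub_weight)
  have pair: "E (\<lambda>G. g (degree G u) * g (degree G v))
      \<le> (if u = v then \<omega> * (q / real n) else 0) + ?\<theta> * (q / real n)\<^sup>2" if uv: "u < n" "v < n" for u v
  proof (cases "u = v")
    case True
    have "E (\<lambda>G. g (degree G u) * g (degree G v)) \<le> E (\<lambda>G. \<omega> * g (degree G v))"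
      using True g m_le by (intro integral_mono) auto
    also have "\<dots> = \<omega> * (q / real n)" using uv by (simp add: mean)
    finally show ?thesis using True tail by (simp add: add_increasing2)
  next
    case False
    have divide: "x \<le> e / (1 - 2 * \<tau>) * y" if "(1 - 2 * \<tau>) * x \<le> e * y" for x y e :: real
      using that tail by (simp add: field_simps)
    have "(1 - 2 * \<tau>) * E (\<lambda>G. g (degree G u) * g (degree G v))
        \<le> exp (11 * (real c)\<^sup>2 / real m) * (q / real n * (q / real n))"
      using expectation_degree_mult_le[OF uv False, of g g] g tail by (simp add: mean uv)
    then have "E (\<lambda>G. g (degree G u) * g (degree G v)) \<le> ?\<theta> * (q / real n * (q / real n))"
      by (rule divide)
    then show ?thesis using False by (simp add: power2_eq_square)
  qed
  have "E (\<lambda>G. (LR_part n m k S G)\<^sup>2) = (\<Sum>u<n. \<Sum>v<n. E (\<lambda>G. g (degree G u) * g (degree G v)))"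
    using m_le by (simp add: LR_part_eq power2_eq_square sum_product)
  also have "\<dots> \<le> (\<Sum>u<n. \<Sum>v<n. (if u = v then \<omega> * (q / real n) else 0) + ?\<theta> * (q / real n)\<^sup>2)"
    using pair by (intro sum_mono) auto
  also have "\<dots> = \<omega> * q + ?\<theta> * q\<^sup>2"
    using n_pos by (simp add: sum.distrib power2_eq_square distrib_left)
  finally show ?thesis .
qed

end

text \<open>Vertices of degree below \<open>s\<close> concentrate in sum, a single vertex of degree at least \<open>s'\<close> forces
both events, and the window between carries little planted mass.\<close>

locale detection_window = planted_model +
  fixes s t s' c\<^sub>0 v :: real
  assumes window: "s \<le> t" "t \<le> s'"
    and heavy: "\<And>d. s' \<le> real d \<Longrightarrow> 1 \<le> hub_weight n m k d"
    and upper: "0 < c\<^sub>0" "c\<^sub>0 \<le> measure_pmf.prob (hub_degree_pmf n m k) {d. t \<le> real d}"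
    and second_moment: "E (\<lambda>G. (LR_part n m k {d. real d < s} G)\<^sup>2)
        \<le> (measure_pmf.prob (hub_degree_pmf n m k) {d. real d < s})\<^sup>2 + v"
begin

abbreviation "A \<equiv> {G. 1 \<le> LR n m k G}"
abbreviation "B \<equiv> {G. t \<le> real (max_degree n G)}"
abbreviation "Y \<equiv> LR_part n m k {d. real d < s}"
abbreviation "W \<equiv> LR_part n m k {d. s \<le> real d \<and> real d < s'}"

lemma LR_part_eq_add_on_sym_diff:
  assumes "G \<in> set_pmf (P0 n m)" "G \<in> sym_diff A B"
  shows "LR_part n m k UNIV G = Y G + W G"
proof -
  have "real (degree G u) < s'" if u: "u < n" for u
  proof (rule ccontr)
    assume "\<not> real (degree G u) < s'"
    then have d: "s' \<le> real (degree G u)" by simp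
    have "1 \<le> hub_weight n m k (degree G u)" using d by (rule heavy)
    also have "\<dots> \<le> LR_part n m k UNIV G"
      unfolding LR_part_def using u hub_weight_nonneg
        member_le_sum[of u "{..<n}" "\<lambda>v. hub_weight n m k (degree G v)"] by simp
    finally have "G \<in> A" using assms by (simp add: LR_eq_LR_part)
    moreover have "G \<in> B" using u d window max_degree_ge_iff[OF n_pos, of t G] by force
    ultimately show False using assms by auto
  qed
  then show ?thesis
    unfolding LR_part_def sum.distrib[symmetric] by (intro sum.cong) (auto simp: indicator_def)
qed

lemma expectation_Y_le: "E Y \<le> 1 - c\<^sub>0"
proof -
  have "E Y + c\<^sub>0 \<le> measure_pmf.prob (hub_degree_pmf n m k) ({d. real d < s} \<union> {d. t \<le> real d})"
    using upper window
    by (subst measure_pmf.finite_measure_Union) (auto simp: expectation_LR_part)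
  also have "\<dots> \<le> 1" by simp
  finally show ?thesis by simp
qed

lemma variance_Y_le: "measure_pmf.variance (P0 n m) Y \<le> v"
  using second_moment m_le by (subst measure_pmf.variance_eq) (auto simp: expectation_LR_part)

lemma expectation_Y_sq_le: "E (\<lambda>G. (Y G)\<^sup>2) \<le> 1 + v"
proof -
  have "(measure_pmf.prob (hub_degree_pmf n m k) {d. real d < s})\<^sup>2 \<le> 1" by (simp add: power_le_one)
  then show ?thesis using second_moment by linarith
qed

lemma prob_P0_sym_diff_le:
  "P (sym_diff A B) \<le> P B + 4 / c\<^sub>0\<^sup>2 * v + 2 / c\<^sub>0 * E W"
proof -
  have "P (sym_diff A B) = P (sym_diff A B \<inter> set_pmf (P0 n m))"
    by (simp add: measure_Int_set_pmf)
  also have "\<dots> \<le> P (B \<union> {G \<in> space (P0 n m). 1 \<le> Y G + W G})"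
    using LR_part_eq_add_on_sym_diff LR_eq_LR_part
    by (intro measure_pmf.finite_measure_mono) fastforce+
  also have "\<dots> \<le> P B + P {G \<in> space (P0 n m). 1 \<le> Y G + W G}"
    by (rule measure_Un_le) auto
  also have "P {G \<in> space (P0 n m). 1 \<le> Y G + W G}
      \<le> 4 / c\<^sub>0\<^sup>2 * measure_pmf.variance (P0 n m) Y + 2 / c\<^sub>0 * E W"
    using m_le upper expectation_Y_le LR_part_nonneg by (intro measure_pmf.prob_sum_ge_one_le) auto
  also have "4 / c\<^sub>0\<^sup>2 * measure_pmf.variance (P0 n m) Y \<le> 4 / c\<^sub>0\<^sup>2 * v"
    by (intro mult_left_mono variance_Y_le) simp
  finally show ?thesis by simp
qed

lemma prob_P1_sym_diff_le:
  assumes "0 < b"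
  shows "measure_pmf.prob (P1 n m k) (sym_diff A B) \<le> b * P (sym_diff A B) + (1 + v) / b + E W"
proof -
  have "measure_pmf.prob (P1 n m k) (sym_diff A B)
        = E (\<lambda>G. LR_part n m k UNIV G * indicator (sym_diff A B) G)"
    by (rule prob_P1)
  also have "\<dots> \<le> E (\<lambda>G. Y G * indicator (sym_diff A B) G + W G)"
  proof (rule integral_mono_AE)
    show "AE G in P0 n m. LR_part n m k UNIV G * indicator (sym_diff A B) G
          \<le> Y G * indicator (sym_diff A B) G + W G"
      using LR_part_eq_add_on_sym_diff LR_part_nonneg
      by (auto simp: AE_measure_pmf_iff indicator_def)
  qed (use m_le in auto)
  also have "\<dots> = E (\<lambda>G. Y G * indicator (sym_diff A B) G) + E W"
    using m_le by simp
  also have "E (\<lambda>G. Y G * indicator (sym_diff A B) G) \<le> b * P (sym_diff A B) + E (\<lambda>G. (Y G)\<^sup>2) / b"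
    using assms m_le LR_part_nonneg by (intro measure_pmf.expectation_mult_indicator_le) auto
  also have "E (\<lambda>G. (Y G)\<^sup>2) / b \<le> (1 + v) / b"
    using assms expectation_Y_sq_le by (intro divide_right_mono) auto
  finally show ?thesis by simp
qed

end

subsection \<open>The weight of a single vertex\<close>

lemma binomial_ratio_eq_prod:
  assumes "k \<le> a" "k \<le> b"
  shows "real (a choose k) / real (b choose k) = (\<Prod>i<k. (real a - real i) / (real b - real i))"
proof -
  have "real (a choose k) / real (b choose k)
      = (\<Prod>i<k. real (a - i) / real (k - i)) / (\<Prod>i<k. real (b - i) / real (k - i))"
    using assms by (simp add: binomial_altdef_of_nat lessThan_atLeast0)
  also have "\<dots> = (\<Prod>i<k. (real a - real i) / (real b - real i))"
    unfolding prod_dividef[symmetric] using assms by (intro prod.cong) (auto simp: of_nat_diff)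
  finally show ?thesis .
qed

definition mean_degree :: "nat \<Rightarrow> nat \<Rightarrow> real" where
  "mean_degree n m = 2 * real m / real n"

lemma mean_degree_N_pairs:
  assumes "1 \<le> n"
  shows "real (n - 1) * real m = mean_degree n m * real (N_pairs n)"
  using assms by (simp add: mean_degree_def real_N_pairs of_nat_diff)

context planted_model
begin

abbreviation "D \<equiv> mean_degree n m"

lemma hub_weight_eq_prod:
  assumes "k \<le> d"
  shows "real n * hub_weight n m k d
       = (\<Prod>i<k. ((real d - real i) / (real (n - 1) - real i)) * ((real (N_pairs n) - real i) / (real m - real i)))"
proof -
  let ?N = "N_pairs n"
  have le: "k \<le> m" "k \<le> ?N" using k_le m_ge m_le by auto
  have "(?N choose m) * (m choose k) = (?N choose k) * ((?N - k) choose (m - k))"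
    using le m_le by (intro choose_mult) auto
  then have "real (?N choose m) * real (m choose k)
        = real (?N choose k) * real ((?N - k) choose (m - k))"
    unfolding of_nat_mult[symmetric] by simp
  moreover have "real (m choose k) > 0" "real ((?N - k) choose (m - k)) > 0" using le m_le by auto
  ultimately have ratio: "real (?N choose m) / real ((?N - k) choose (m - k))
        = real (?N choose k) / real (m choose k)"
    by (simp add: field_simps)
  have "real n * hub_weight n m k d
      = (real (d choose k) / real ((n - 1) choose k)) * (real (?N choose m) / real ((?N - k) choose (m - k)))"
    using n_pos by (simp add: hub_weight_def)
  also have "\<dots> = (\<Prod>i<k. ((real d - real i) / (real (n - 1) - real i))
        * ((real ?N - real i) / (real m - real i)))"
    unfolding ratio prod.distrib
    using assms k_le le binomial_ratio_eq_prod[of k d "n - 1"] binomial_ratio_eq_prod[of k ?N m] by simp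
  finally show ?thesis .
qed

lemma hub_factor_eq:
  assumes "0 < m" "2 \<le> n" "i < n - 1"
  shows "(x / (real (n - 1) - real i)) * ((real (N_pairs n) - real i) / (real m - real i))
       = (x / D) * ((real (N_pairs n) - real i) / real (N_pairs n))
         * ((real (n - 1) / (real (n - 1) - real i)) * (real m / (real m - real i)))"
proof -
  have "0 < real (n - 1)" "0 < real (N_pairs n)" using assms m_le by auto
  moreover from this have "D = real (n - 1) * real m / real (N_pairs n)"
    using mean_degree_N_pairs[OF n_pos, of m] by (simp add: field_simps)
  ultimately show ?thesis using assms by simp
qed

lemma hub_factor_le_exp:
  assumes "2 \<le> n" "2 * i < n - 1" "i \<le> d" "i \<le> k"
  shows "((real d - real i) / (real (n - 1) - real i))
        * ((real (N_pairs n) - real i) / (real m - real i))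
       \<le> exp ((real d - real i) / D - 1 + 4 * real k / real (n - 1))"
proof -
  define M where "M = real (n - 1)"
  let ?N = "real (N_pairs n)"
  have pos: "0 < M" "0 < m" "M / 2 \<le> M - real i" "M / 2 \<le> real m - real i" "real i \<le> ?N" "0 < ?N"
      "0 < D"
    using assms m_ge m_le by (auto simp: M_def mean_degree_def)
  have le_exp: "y / (y - real i) \<le> exp (2 * real k / M)" if "M / 2 \<le> y - real i" for y
  proof -
    have "y / (y - real i) = 1 + real i / (y - real i)" using that pos by (simp add: field_simps)
    also have "real i / (y - real i) \<le> real k / (M / 2)" using that pos assms by (intro frac_le) auto
    also have "1 + real k / (M / 2) \<le> exp (2 * real k / M)"
      using exp_ge_add_one_self[of "2 * real k / M"] by (simp add: mult.commute)
    finally show ?thesis by simp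
  qed
  have "((real d - real i) / (M - real i)) * ((?N - real i) / (real m - real i))
      = (real d - real i) / D * ((?N - real i) / ?N) * ((M / (M - real i)) * (real m / (real m - real i)))"
    unfolding M_def using assms pos by (intro hub_factor_eq) auto
  also have "\<dots> \<le> (exp ((real d - real i) / D - 1) * 1) * (exp (2 * real k / M) * exp (2 * real k / M))"
  proof (intro mult_mono le_exp)
    show "(real d - real i) / D \<le> exp ((real d - real i) / D - 1)"
      using exp_ge_add_one_self[of "(real d - real i) / D - 1"] by simp
  qed (use assms pos in auto)
  also have "\<dots> = exp ((real d - real i) / D - 1 + 4 * real k / M)"
    by (simp flip: exp_add)
  finally show ?thesis by (simp only: M_def)
qed

lemma hub_factor_ge_exp:
  assumes "2 \<le> n" "i < n - 1" "i \<le> k" "2 * k \<le> N_pairs n"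
    and b: "\<bar>real d - real i - D\<bar> \<le> b" "b \<le> D / 2"
  shows "exp ((real d - real i) / D - 1 - (2 * b\<^sup>2 / D\<^sup>2 + 2 * real k / real (N_pairs n)))
       \<le> ((real d - real i) / (real (n - 1) - real i)) * ((real (N_pairs n) - real i) / (real m - real i))"
proof -
  define z where "z = (real d - real i) / D - 1"
  let ?M = "real (n - 1)" and ?N = "real (N_pairs n)"
  have pos: "0 < m" "real i < real m" "0 < D" "0 < ?N" "2 * real k \<le> ?N"
    using assms m_ge m_le by (auto simp: mean_degree_def)
  have "z = (real d - real i - D) / D" using pos by (simp add: z_def diff_divide_distrib)
  then have "\<bar>z\<bar> \<le> b / D" using pos b by (simp add: divide_right_mono abs_divide)
  moreover have "b / D \<le> 1 / 2" using b pos by (simp add: field_simps)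
  ultimately have z: "\<bar>z\<bar> \<le> 1 / 2" "z\<^sup>2 \<le> b\<^sup>2 / D\<^sup>2"
    using power_mono[of "\<bar>z\<bar>" "b / D" 2] by (linarith, simp add: power_divide)
  have z_le: "exp (z - 2 * b\<^sup>2 / D\<^sup>2) \<le> 1 + z"
    using exp_diff_sq_le_one_plus[OF z(1)] z(2) by (elim order_trans[rotated]) simp
  have N_le: "exp (- (2 * real k / ?N)) \<le> (?N - real i) / ?N"
  proof -
    have q: "0 \<le> real k / ?N" "real k / ?N \<le> 1 / 2" using pos by (auto simp: field_simps)
    then have "- (2 * real k / ?N) \<le> - (real k / ?N) - 2 * (- (real k / ?N))\<^sup>2"
      using mult_left_mono[OF q(2) q(1)] by (simp add: power2_eq_square)
    then have "exp (- (2 * real k / ?N)) \<le> exp (- (real k / ?N) - 2 * (- (real k / ?N))\<^sup>2)" by simp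
    also have "\<dots> \<le> 1 + - (real k / ?N)" using q by (intro exp_diff_sq_le_one_plus) auto
    also have "\<dots> \<le> (?N - real i) / ?N" using assms pos by (simp add: field_simps)
    finally show ?thesis .
  qed
  have "exp ((real d - real i) / D - 1 - (2 * b\<^sup>2 / D\<^sup>2 + 2 * real k / ?N))
      = exp (z - 2 * b\<^sup>2 / D\<^sup>2) * exp (- (2 * real k / ?N)) * (1 * 1)"
    by (simp add: z_def mult_exp_exp algebra_simps)
  also have "\<dots> \<le> (1 + z) * ((?N - real i) / ?N) * ((?M / (?M - real i)) * (real m / (real m - real i)))"
  proof (intro mult_mono z_le N_le)
    show "0 \<le> 1 + z" "0 \<le> (1 + z) * ((?N - real i) / ?N)" using z pos assms by auto
  qed (use assms pos in auto)
  also have "\<dots> = ((real d - real i) / (?M - real i)) * ((?N - real i) / (real m - real i))"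
    unfolding z_def using assms pos by (subst hub_factor_eq) auto
  finally show ?thesis .
qed

lemma sum_hub_exponent:
  assumes "0 < D"
  shows "(\<Sum>i<k. (real d - real i) / D - 1 + x)
       = real k * (real d - D) / D - (real k)\<^sup>2 / (2 * D) + real k / (2 * D) + real k * x"
proof -
  have "(\<Sum>i<k. (real d - real i) / D - 1 + x) = real k * (real d / D - 1 + x) - (\<Sum>i<k. real i) / D"
    by (simp add: diff_divide_distrib sum.distrib sum_subtractf sum_divide_distrib algebra_simps)
  then show ?thesis
    unfolding sum_lessThan_real using assms by (simp add: field_simps power2_eq_square)
qed

lemma hub_weight_le_exp:
  assumes k: "2 * k \<le> n - 1" and n: "2 \<le> n"
  shows "real n * hub_weight n m k d
       \<le> exp (real k * (real d - D) / D - (real k)\<^sup>2 / (2 * D) + real k / (2 * D) + 4 * (real k)\<^sup>2 / real (n - 1))"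
proof (cases "k \<le> d")
  case True
  let ?x = "4 * real k / real (n - 1)"
  have D_pos: "0 < D" using n m_ge by (auto simp: mean_degree_def)
  have "real n * hub_weight n m k d
      = (\<Prod>i<k. ((real d - real i) / (real (n - 1) - real i)) * ((real (N_pairs n) - real i) / (real m - real i)))"
    using True by (rule hub_weight_eq_prod)
  also have "\<dots> \<le> (\<Prod>i<k. exp ((real d - real i) / D - 1 + ?x))"
  proof (intro prod_mono conjI hub_factor_le_exp)
    fix i assume i: "i \<in> {..<k}"
    then have "real i \<le> real d" "real i \<le> real (n - 1)" "real i \<le> real (N_pairs n)" "real i \<le> real m"
      using True k m_ge m_le by auto
    then show "0 \<le> ((real d - real i) / (real (n - 1) - real i))
          * ((real (N_pairs n) - real i) / (real m - real i))"
      by (intro mult_nonneg_nonneg divide_nonneg_nonneg) auto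
  qed (use True k n in auto)
  also have "\<dots> = exp (\<Sum>i<k. (real d - real i) / D - 1 + ?x)"
    by (simp add: exp_sum)
  finally show ?thesis
    using D_pos by (simp only: sum_hub_exponent) (simp add: power2_eq_square mult_ac)
qed (simp add: hub_weight_eq_0)

lemma hub_weight_ge_exp:
  assumes k: "2 * k \<le> n - 1" "2 \<le> n" "n - 1 \<le> N_pairs n" "k \<le> d"
    and b: "real d - D \<le> b" "- b \<le> real d - D - real k" "b \<le> D / 2"
  shows "exp (real k * (real d - D) / D - (real k)\<^sup>2 / (2 * D) - 2 * real k * b\<^sup>2 / D\<^sup>2
        - 2 * (real k)\<^sup>2 / real (N_pairs n))
       \<le> real n * hub_weight n m k d"
proof -
  let ?c = "2 * b\<^sup>2 / D\<^sup>2 + 2 * real k / real (N_pairs n)"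
  have D_pos: "0 < D" using k m_ge by (auto simp: mean_degree_def)
  have "real k * (real d - D) / D - (real k)\<^sup>2 / (2 * D) - 2 * real k * b\<^sup>2 / D\<^sup>2
        - 2 * (real k)\<^sup>2 / real (N_pairs n)
      \<le> (\<Sum>i<k. (real d - real i) / D - 1 + - ?c)"
    using D_pos by (simp only: sum_hub_exponent) (simp add: power2_eq_square algebra_simps)
  then have "exp (real k * (real d - D) / D - (real k)\<^sup>2 / (2 * D) - 2 * real k * b\<^sup>2 / D\<^sup>2
        - 2 * (real k)\<^sup>2 / real (N_pairs n))
      \<le> exp (\<Sum>i<k. (real d - real i) / D - 1 + - ?c)"
    by simp
  also have "\<dots> = (\<Prod>i<k. exp ((real d - real i) / D - 1 - ?c))"
    by (simp only: exp_sum[OF finite_lessThan] diff_conv_add_uminus)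
  also have "\<dots> \<le> (\<Prod>i<k. ((real d - real i) / (real (n - 1) - real i))
        * ((real (N_pairs n) - real i) / (real m - real i)))"
    using k b by (intro prod_mono conjI hub_factor_ge_exp) auto
  also have "\<dots> = real n * hub_weight n m k d"
    using k by (intro hub_weight_eq_prod[symmetric])
  finally show ?thesis .
qed

end

subsection \<open>The asymptotic regime\<close>

locale planted_regime =
  fixes \<gamma> \<alpha> :: real and k m :: "nat \<Rightarrow> nat"
  assumes alpha: "\<alpha> > 1" and k_pos: "k n > 0"
    and log_sq_over_k_tendsto_0: "(\<lambda>n. (ln (real n))\<^sup>2 / real (k n)) \<longlonglongrightarrow> 0"
    and k_over_sqrt_n_tendsto_0: "(\<lambda>n. real (k n) / sqrt (real n)) \<longlonglongrightarrow> 0"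
    and m_eq: "m n = nat (round (real (k n) ^ 2 * real n / (4 * ln (real n))
          * (1 + \<gamma> / sqrt (ln (real n)))))"
begin

abbreviation "L n \<equiv> ln (real n)"
abbreviation "K n \<equiv> real (k n)"
abbreviation "N n \<equiv> real (N_pairs n)"
abbreviation "D n \<equiv> mean_degree n (m n)"

lemma L_at_top: "filterlim L at_top sequentially"
  by (rule filterlim_compose[OF ln_at_top filterlim_real_sequentially])

lemma sqrt_L_at_top: "filterlim (\<lambda>n. sqrt (L n)) at_top sequentially"
  by (rule filterlim_compose[OF sqrt_at_top L_at_top])

lemma eventually_L_ge: "eventually (\<lambda>n. c \<le> L n) sequentially"
  using L_at_top by (simp add: filterlim_at_top)

lemma eventually_n_ge: "eventually (\<lambda>n. c \<le> real n) sequentially"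
  using filterlim_real_sequentially by (simp add: filterlim_at_top)

lemma eventually_n_pos: "eventually (\<lambda>n. 0 < real n) sequentially"
  using eventually_gt_at_top[of 0] by eventually_elim simp

lemma K_ge_1: "1 \<le> K n" using k_pos[of n] by simp

lemma K_sq_over_n_tendsto_0: "(\<lambda>n. (K n)\<^sup>2 / real n) \<longlonglongrightarrow> 0"
  using tendsto_power[OF k_over_sqrt_n_tendsto_0, of 2] by (simp add: power_divide)

lemma L_over_K_tendsto_0: "(\<lambda>n. L n / K n) \<longlonglongrightarrow> 0"
proof -
  have "(\<lambda>n. (L n)\<^sup>2 / K n * (1 / L n)) \<longlonglongrightarrow> 0 * 0"
    by (intro tendsto_mult log_sq_over_k_tendsto_0 tendsto_divide_0[OF tendsto_const]
        filterlim_at_top_imp_at_infinity L_at_top)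
  moreover have "eventually (\<lambda>n. (L n)\<^sup>2 / K n * (1 / L n) = L n / K n) sequentially"
    using eventually_L_ge[of 1] by eventually_elim (simp add: power2_eq_square)
  ultimately show ?thesis by (simp add: tendsto_cong)
qed

definition D_ratio :: "nat \<Rightarrow> real" (\<open>\<rho>\<close>) where
  "\<rho> n = 2 * L n * D n / (K n)\<^sup>2"

lemma eventually_m_rounding:
  "eventually (\<lambda>n. \<bar>real (m n) - (K n)\<^sup>2 * real n / (4 * L n) * (1 + \<gamma> / sqrt (L n))\<bar>
        \<le> 1 / 2) sequentially"
  using eventually_L_ge[of "max 1 (\<gamma>\<^sup>2)"]
proof eventually_elim
  case (elim n)
  define q where "q = (K n)\<^sup>2 * real n / (4 * L n) * (1 + \<gamma> / sqrt (L n))"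
  have "\<bar>\<gamma>\<bar> \<le> sqrt (L n)" using real_sqrt_le_mono[of "\<gamma>\<^sup>2" "L n"] elim by simp
  then have "0 \<le> 1 + \<gamma> / sqrt (L n)" using elim by (simp add: field_simps abs_le_iff)
  then have "0 \<le> q" unfolding q_def using elim by simp
  then have "0 \<le> round q" by (metis round_0 round_mono)
  then have "real (m n) = real_of_int (round q)" by (simp add: m_eq q_def)
  then show ?case unfolding q_def[symmetric] by (simp only: of_int_round_abs_le)
qed

lemma D_ratio_rate_tendsto: "(\<lambda>n. sqrt (L n) * (\<rho> n - 1)) \<longlonglongrightarrow> \<gamma>"
proof -
  have "eventually (\<lambda>n. norm (sqrt (L n) * (\<rho> n - 1) - \<gamma>) \<le> 2 * ((L n)\<^sup>2 / K n)) sequentially"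
    using eventually_m_rounding eventually_L_ge[of 1] eventually_n_ge[of 2]
  proof eventually_elim
    case (elim n)
    define err where "err = real (m n) - (K n)\<^sup>2 * real n / (4 * L n) * (1 + \<gamma> / sqrt (L n))"
    have K: "1 \<le> K n" by (rule K_ge_1)
    have sqrt_L: "1 \<le> sqrt (L n)" "sqrt (L n) * sqrt (L n) = L n" using elim by auto
    have "\<rho> n = 4 * L n * real (m n) / ((K n)\<^sup>2 * real n)"
      by (simp add: D_ratio_def mean_degree_def mult_ac)
    also have "real (m n) = (K n)\<^sup>2 * real n / (4 * L n) * (1 + \<gamma> / sqrt (L n)) + err"
      by (simp add: err_def)
    also have "4 * L n * \<dots> / ((K n)\<^sup>2 * real n)
          = 1 + \<gamma> / sqrt (L n) + 4 * L n * err / ((K n)\<^sup>2 * real n)"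
      using K elim by (simp add: distrib_left add_divide_distrib)
    finally have "sqrt (L n) * (\<rho> n - 1) - \<gamma> = sqrt (L n) * (4 * L n * err / ((K n)\<^sup>2 * real n))"
      using sqrt_L by (simp add: distrib_left)
    then have "norm (sqrt (L n) * (\<rho> n - 1) - \<gamma>) = sqrt (L n) * (4 * L n * \<bar>err\<bar>) / ((K n)\<^sup>2 * real n)"
      using elim by (simp add: abs_mult)
    also have "\<dots> \<le> L n * (4 * L n * (1 / 2)) / K n"
    proof (intro frac_le mult_mono)
      show "sqrt (L n) \<le> L n" using mult_left_mono[OF sqrt_L(1), of "sqrt (L n)"] sqrt_L by simp
      have "K n * 1 \<le> K n * (K n * real n)" using K elim mult_mono[of 1 "K n" 1 "real n"]
        by (intro mult_left_mono) auto
      then show "K n \<le> (K n)\<^sup>2 * real n" by (simp add: power2_eq_square mult_ac)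
    qed (use elim K in \<open>auto simp: err_def\<close>)
    finally show ?case by (simp add: power2_eq_square mult_ac)
  qed
  then have "(\<lambda>n. sqrt (L n) * (\<rho> n - 1) - \<gamma>) \<longlonglongrightarrow> 0"
    using tendsto_mult_right_zero[OF log_sq_over_k_tendsto_0, of 2] by (rule Lim_null_comparison)
  then show ?thesis by (simp add: LIM_zero_iff)
qed

lemma D_ratio_tendsto_1: "\<rho> \<longlonglongrightarrow> 1"
proof -
  have "(\<lambda>n. sqrt (L n) * (\<rho> n - 1) * (1 / sqrt (L n)) + 1) \<longlonglongrightarrow> \<gamma> * 0 + 1"
    by (intro tendsto_intros D_ratio_rate_tendsto tendsto_divide_0[OF tendsto_const]
        filterlim_at_top_imp_at_infinity sqrt_L_at_top)
  moreover have "eventually (\<lambda>n. sqrt (L n) * (\<rho> n - 1) * (1 / sqrt (L n)) + 1 = \<rho> n) sequentially"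
    using eventually_L_ge[of 1] by eventually_elim simp
  ultimately show ?thesis by (simp add: tendsto_cong)
qed

lemma D_eq_D_ratio: "0 < L n \<Longrightarrow> D n = \<rho> n * (K n)\<^sup>2 / (2 * L n)"
  using K_ge_1[of n] by (simp add: D_ratio_def)

lemma eventually_D_ratio_pos: "eventually (\<lambda>n. 0 < \<rho> n) sequentially"
  using D_ratio_tendsto_1 by (rule order_tendstoD) simp

lemma tendsto_0_via_D_ratio:
  assumes f: "f \<longlonglongrightarrow> 0" and h: "isCont h 1"
    and g: "\<And>n. \<lbrakk>0 < L n; 0 < \<rho> n; 0 < real n; D n = \<rho> n * (K n)\<^sup>2 / (2 * L n)\<rbrakk> \<Longrightarrow> h (\<rho> n) * f n = g n"
  shows "g \<longlonglongrightarrow> (0::real)"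
proof (rule Lim_transform_eventually)
  have "(\<lambda>n. h (\<rho> n) * f n) \<longlonglongrightarrow> h 1 * 0"
    by (intro tendsto_mult f isCont_tendsto_compose[OF h] D_ratio_tendsto_1)
  then show "(\<lambda>n. h (\<rho> n) * f n) \<longlonglongrightarrow> 0" by simp
  show "eventually (\<lambda>n. h (\<rho> n) * f n = g n) sequentially"
    using eventually_D_ratio_pos eventually_L_ge[of 1] eventually_n_ge[of 1]
  proof eventually_elim
    case (elim n)
    have pos: "0 < L n" "0 < real n" using elim by linarith+
    show ?case by (rule g[OF pos(1) elim(1) pos(2) D_eq_D_ratio[OF pos(1)]])
  qed
qed

lemma K_over_D_tendsto_0: "(\<lambda>n. K n / D n) \<longlonglongrightarrow> 0"
  by (rule tendsto_0_via_D_ratio[where h = "\<lambda>x. 2 / x", OF L_over_K_tendsto_0])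
    (use k_pos in \<open>auto simp: power2_eq_square\<close>)

text \<open>The cubic Taylor error is negligible exactly because \<open>k \<gg> (log n)\<^sup>2\<close>.\<close>

lemma K_cubed_over_D_sq_tendsto_0: "(\<lambda>n. K n ^ 3 / (D n)\<^sup>2) \<longlonglongrightarrow> 0"
  by (rule tendsto_0_via_D_ratio[where h = "\<lambda>x. 4 / x\<^sup>2", OF log_sq_over_k_tendsto_0])
    (use k_pos in \<open>auto simp: power2_eq_square power3_eq_cube\<close>)

lemma L_D_over_n_tendsto_0: "(\<lambda>n. L n * D n / real n) \<longlonglongrightarrow> 0"
  by (rule tendsto_0_via_D_ratio[where h = "\<lambda>x. x / 2", OF K_sq_over_n_tendsto_0]) auto

lemma D_over_n_tendsto_0: "(\<lambda>n. D n / real n) \<longlonglongrightarrow> 0"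
proof (rule tendsto_sandwich[OF _ _ tendsto_const L_D_over_n_tendsto_0])
  show "eventually (\<lambda>n. D n / real n \<le> L n * D n / real n) sequentially"
    using eventually_L_ge[of 1]
  proof eventually_elim
    case (elim n)
    then have "1 * D n \<le> L n * D n" by (intro mult_right_mono) (auto simp: mean_degree_def)
    then show ?case by (simp add: divide_right_mono)
  qed
qed (simp add: mean_degree_def)

lemma D_at_top: "filterlim D at_top sequentially"
proof (rule filterlim_at_top_mono[OF L_at_top])
  have "(\<lambda>n. L n / D n) \<longlonglongrightarrow> 0"
    by (rule tendsto_0_via_D_ratio[where h = "\<lambda>x. 2 / x" and f = "\<lambda>n. L n / K n * (L n / K n)"])
      (use k_pos tendsto_mult[OF L_over_K_tendsto_0 L_over_K_tendsto_0] in \<open>auto simp: power2_eq_square\<close>)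
  from order_tendstoD(2)[OF this zero_less_one]
  show "eventually (\<lambda>n. L n \<le> D n) sequentially"
    using eventually_D_ratio_pos eventually_L_ge[of 1]
  proof eventually_elim
    case (elim n)
    have "0 < D n" using elim k_pos[of n] D_eq_D_ratio[of n] by simp
    then show ?case using elim by (simp add: divide_less_eq_1)
  qed
qed

lemma eventually_D_ge: "eventually (\<lambda>n. c \<le> D n) sequentially"
  using D_at_top by (simp add: filterlim_at_top)

lemma D_nonneg: "0 \<le> D n" by (simp add: mean_degree_def)

lemma eventually_D_pos: "eventually (\<lambda>n. 0 < D n) sequentially"
  using eventually_D_ge[of 1] by eventually_elim simp

lemma eventually_K_sq_le: "0 < \<delta> \<Longrightarrow> eventually (\<lambda>n. (K n)\<^sup>2 \<le> \<delta> * real n) sequentially"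
  by (rule eventually_le_mult_of_ratio_tendsto_0[OF K_sq_over_n_tendsto_0 eventually_n_pos])

lemma eventually_D_le: "0 < \<delta> \<Longrightarrow> eventually (\<lambda>n. D n \<le> \<delta> * real n) sequentially"
  by (rule eventually_le_mult_of_ratio_tendsto_0[OF D_over_n_tendsto_0 eventually_n_pos])

lemma eventually_K_le: "0 < \<delta> \<Longrightarrow> eventually (\<lambda>n. K n \<le> \<delta> * D n) sequentially"
  by (rule eventually_le_mult_of_ratio_tendsto_0[OF K_over_D_tendsto_0 eventually_D_pos])

lemma eventually_K_cubed_le: "0 < \<delta> \<Longrightarrow> eventually (\<lambda>n. K n ^ 3 \<le> \<delta> * (D n)\<^sup>2) sequentially"
  using eventually_D_pos
  by (intro eventually_le_mult_of_ratio_tendsto_0[OF K_cubed_over_D_sq_tendsto_0]) (auto elim: eventually_mono)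

lemma sqrt_D_at_top: "filterlim (\<lambda>n. sqrt (D n)) at_top sequentially"
  by (rule filterlim_compose[OF sqrt_at_top D_at_top])

lemma eventually_sizes:
  "eventually (\<lambda>n. 32 \<le> n \<and> 8 * (K n)\<^sup>2 \<le> real (n - 1) \<and> 2 * k n \<le> n - 1 \<and> n - 1 \<le> m n
     \<and> 2 * m n + 2 * n \<le> N_pairs n) sequentially"
  using eventually_K_sq_le[of "1/16", simplified] eventually_D_le[of "1/16", simplified]
    eventually_D_ge[of 2] eventually_n_ge[of 32]
proof eventually_elim
  case (elim n)
  then have n: "32 \<le> real n" "real (n - 1) = real n - 1" by (auto simp: of_nat_diff)
  then have K: "8 * (K n)\<^sup>2 \<le> real (n - 1)" using elim by simp
  have "K n * 1 \<le> K n * K n" using K_ge_1[of n] by (intro mult_left_mono) auto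
  then have "2 * K n \<le> real (n - 1)" using K unfolding power2_eq_square by linarith
  then have "2 * k n \<le> n - 1" by linarith
  have m: "real (m n) = D n * real n / 2" using n by (simp add: mean_degree_def)
  have "2 * real n \<le> D n * real n" "D n * real n \<le> real n / 16 * real n"
    using elim n by (intro mult_right_mono; simp)+
  moreover have "32 * real n \<le> real n * real n" using n by (intro mult_right_mono) auto
  ultimately have "real n \<le> real (m n)" "real (2 * m n + 2 * n) \<le> real (N_pairs n)"
    unfolding m real_N_pairs by (simp_all add: m algebra_simps)
  then have "n \<le> m n" "2 * m n + 2 * n \<le> N_pairs n" by (simp_all only: of_nat_le_iff)
  then show ?case using n K \<open>2 * k n \<le> n - 1\<close> by auto
qed

lemma eventually_planted_model: "eventually (\<lambda>n. planted_model n (m n) (k n)) sequentially"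
  using eventually_sizes by eventually_elim (auto simp: planted_model_def)

subsection \<open>Threshold and hub shift in units of \<open>sqrt D\<close>\<close>

definition std_threshold :: "nat \<Rightarrow> real" where
  "std_threshold n = (t_star \<alpha> n (m n) - D n) / sqrt (D n)"

definition std_shift :: "nat \<Rightarrow> real" where
  "std_shift n = K n / sqrt (D n)"

lemma t_star_eq: "0 < D n \<Longrightarrow> t_star \<alpha> n (m n) = D n + std_threshold n * sqrt (D n)"
  by (simp add: std_threshold_def)

lemma K_eq_std_shift: "0 < D n \<Longrightarrow> K n = std_shift n * sqrt (D n)"
  by (simp add: std_shift_def)

lemma scaled_ln_L_bounds:
  assumes "1 \<le> L n"
  shows "0 \<le> 1 / \<alpha> * ln (L n)" "1 / \<alpha> * ln (L n) \<le> ln (L n)" "ln (L n) \<le> L n"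
  using assms alpha ln_le_minus_one[of "L n"] by (auto simp: divide_le_eq mult_le_cancel_left1)

lemma L_edge_density_tendsto_0: "(\<lambda>n. L n * (real (m n) / N n)) \<longlonglongrightarrow> 0"
proof (rule Lim_null_comparison)
  show "(\<lambda>n. 2 * (L n * D n / real n)) \<longlonglongrightarrow> 0"
    using tendsto_mult_right_zero[OF L_D_over_n_tendsto_0, of 2] .
  show "eventually (\<lambda>n. norm (L n * (real (m n) / N n)) \<le> 2 * (L n * D n / real n)) sequentially"
    using eventually_L_ge[of 1] eventually_n_ge[of 2]
  proof eventually_elim
    case (elim n)
    have "real (m n) / N n = D n / (real n - 1)"
      using elim by (simp add: mean_degree_def real_N_pairs field_simps)
    also have "\<dots> \<le> D n / (real n / 2)" using elim D_nonneg by (intro divide_left_mono) auto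
    finally have "L n * (real (m n) / N n) \<le> L n * (D n / (real n / 2))" using elim
      by (intro mult_left_mono) auto
    then show ?case using elim by (simp add: mult_ac)
  qed
qed

lemma eventually_std_threshold_sq_bounds:
  "eventually (\<lambda>n. 0 \<le> std_threshold n
     \<and> 2 * L n - 1 / \<alpha> * ln (L n) - 1 \<le> (std_threshold n)\<^sup>2
     \<and> (std_threshold n)\<^sup>2 \<le> 2 * L n) sequentially"
  using order_tendstoD(2)[OF L_edge_density_tendsto_0 half_gt_zero[OF zero_less_one]]
    eventually_L_ge[of 1] eventually_sizes eventually_D_pos
proof eventually_elim
  case (elim n)
  define p x where "p = real (m n) / N n" and "x = 2 * L n - 1 / \<alpha> * ln (L n)"
  have p: "0 \<le> p" "p \<le> 1" "L n * p \<le> 1 / 2" using elim by (auto simp: p_def divide_le_eq_1)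
  have x: "0 \<le> x" "x \<le> 2 * L n" unfolding x_def using scaled_ln_L_bounds[OF elim(2)] elim(2)
    by linarith+
  have "t_star \<alpha> n (m n) - D n = sqrt (D n * (1 - p)) * sqrt x"
    by (simp add: t_star_def mean_degree_def p_def x_def)
  then have z: "std_threshold n = sqrt (1 - p) * sqrt x"
    using elim by (simp add: std_threshold_def real_sqrt_mult[of "D n"])
  then have z_sq: "(std_threshold n)\<^sup>2 = (1 - p) * x" using p x by (simp add: power_mult_distrib)
  have "p * x \<le> p * (2 * L n)" "0 \<le> p * x" using p x by (auto intro: mult_left_mono)
  moreover have "(1 - p) * x = x - p * x" "p * (2 * L n) = 2 * (L n * p)"
    by (simp_all add: left_diff_distrib)
  ultimately have "x - 1 \<le> (1 - p) * x" "(1 - p) * x \<le> 2 * L n" using p x by linarith+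
  then show ?case using z p x unfolding z_sq x_def by simp
qed

lemma std_threshold_minus_tendsto_0: "(\<lambda>n. std_threshold n - sqrt (2 * L n)) \<longlonglongrightarrow> 0"
proof (rule Lim_null_comparison)
  have "((\<lambda>x::real. (ln x + 1) / sqrt (2 * x)) \<longlongrightarrow> 0) at_top" by real_asymp
  from filterlim_compose[OF this L_at_top] show "(\<lambda>n. (ln (L n) + 1) / sqrt (2 * L n)) \<longlonglongrightarrow> 0" .
  show "eventually (\<lambda>n. norm (std_threshold n - sqrt (2 * L n))
        \<le> (ln (L n) + 1) / sqrt (2 * L n)) sequentially"
    using eventually_std_threshold_sq_bounds eventually_L_ge[of 1]
  proof eventually_elim
    case (elim n)
    let ?z = "std_threshold n" and ?a = "sqrt (2 * L n)"
    have a: "0 < ?a" "?a\<^sup>2 = 2 * L n" using elim by auto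
    have "2 * L n - 1 / \<alpha> * ln (L n) - 1 \<le> ?z\<^sup>2" "?z\<^sup>2 \<le> 2 * L n" and "0 \<le> ?z"
      using elim by auto
    then have sq: "\<bar>?z\<^sup>2 - ?a\<^sup>2\<bar> \<le> ln (L n) + 1"
      unfolding a using scaled_ln_L_bounds[of n] elim(2) by linarith
    have "\<bar>?z - ?a\<bar> * ?a \<le> \<bar>?z - ?a\<bar> * (?z + ?a)" using elim by (intro mult_left_mono) auto
    also have "\<dots> = \<bar>(?z - ?a) * (?z + ?a)\<bar>" using \<open>0 \<le> ?z\<close> a(1) by (simp add: abs_mult)
    also have "(?z - ?a) * (?z + ?a) = ?z\<^sup>2 - ?a\<^sup>2" by algebra
    also note sq
    finally show ?case using a by (simp add: pos_le_divide_eq)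
  qed
qed

lemma std_shift_minus_tendsto: "(\<lambda>n. std_shift n - sqrt (2 * L n)) \<longlonglongrightarrow> - \<gamma> / sqrt 2"
proof (rule Lim_transform_eventually)
  have "(\<lambda>n. - (2 * (sqrt (L n) * (\<rho> n - 1)) / (\<rho> n * (sqrt (2 / \<rho> n) + sqrt 2))))
      \<longlonglongrightarrow> - (2 * \<gamma> / (1 * (sqrt (2 / 1) + sqrt 2)))"
    by (intro tendsto_intros D_ratio_rate_tendsto D_ratio_tendsto_1) (auto simp: add_nonneg_eq_0_iff)
  also have "- (2 * \<gamma> / (1 * (sqrt (2 / 1) + sqrt 2))) = - \<gamma> / sqrt 2" by (simp add: field_simps)
  finally show "(\<lambda>n. - (2 * (sqrt (L n) * (\<rho> n - 1)) / (\<rho> n * (sqrt (2 / \<rho> n) + sqrt 2))))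
        \<longlonglongrightarrow> - \<gamma> / sqrt 2" .
  show "eventually (\<lambda>n. - (2 * (sqrt (L n) * (\<rho> n - 1)) / (\<rho> n * (sqrt (2 / \<rho> n) + sqrt 2)))
      = std_shift n - sqrt (2 * L n)) sequentially"
    using eventually_D_ratio_pos eventually_L_ge[of 1]
  proof eventually_elim
    case (elim n)
    define s l where "s = sqrt (2 / \<rho> n)" and "l = sqrt (L n)"
    have pos: "0 < s" "0 < l" "s\<^sup>2 = 2 / \<rho> n" "\<rho> n = 2 / s\<^sup>2" using elim by (auto simp: s_def l_def)
    have "std_shift n = sqrt ((K n)\<^sup>2 / D n)" by (simp add: std_shift_def real_sqrt_divide)
    also have "(K n)\<^sup>2 / D n = L n * (2 / \<rho> n)" using elim D_eq_D_ratio[of n] k_pos[of n] by simp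
    finally have "std_shift n = l * s" by (simp only: real_sqrt_mult s_def l_def)
    then have shift: "std_shift n - sqrt (2 * L n) = l * (s - sqrt 2)"
      by (simp add: real_sqrt_mult l_def algebra_simps)
    have "s - sqrt 2 = (s\<^sup>2 - 2) / (s + sqrt 2)"
      using pos by (simp add: field_simps power2_eq_square add_pos_pos[THEN less_imp_neq, symmetric])
    also have "s\<^sup>2 - 2 = - (2 * (\<rho> n - 1) / \<rho> n)" using elim pos(3) by (simp add: field_simps)
    finally show ?case unfolding shift s_def[symmetric] l_def[symmetric] by (simp add: mult_ac)
  qed
qed

lemma eventually_std_threshold_near:
  assumes "0 < \<delta>"
  shows "eventually (\<lambda>n. \<bar>std_threshold n - sqrt (2 * L n)\<bar> \<le> \<delta>) sequentially"
  using tendstoD[OF std_threshold_minus_tendsto_0 assms] by eventually_elim (simp add: dist_real_def)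

lemma eventually_std_shift_near: "eventually (\<lambda>n. \<bar>std_shift n - sqrt (2 * L n)\<bar>
      \<le> \<bar>\<gamma>\<bar> + 1) sequentially"
proof -
  have "\<bar>\<gamma>\<bar> / sqrt 2 \<le> \<bar>\<gamma>\<bar> / 1" by (intro divide_left_mono) auto
  then have "\<bar>- \<gamma> / sqrt 2\<bar> < \<bar>\<gamma>\<bar> + 1" by (simp add: abs_divide)
  from order_tendstoD(2)[OF tendsto_rabs[OF std_shift_minus_tendsto] this] show ?thesis
    by (auto elim: eventually_mono)
qed

lemma eventually_sqrt_2_L_ge: "eventually (\<lambda>n. c \<le> sqrt (2 * L n)) sequentially"
  using eventually_L_ge[of "c\<^sup>2"]
proof eventually_elim
  case (elim n)
  have "c\<^sup>2 \<le> 2 * L n" using elim zero_le_power2[of c] by linarith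
  then show ?case by (rule real_le_rsqrt)
qed

lemma eventually_std_shift_ge: "eventually (\<lambda>n. c \<le> std_shift n) sequentially"
  using eventually_std_shift_near eventually_sqrt_2_L_ge[of "c + \<bar>\<gamma>\<bar> + 1"]
  by eventually_elim linarith

lemma eventually_std_threshold_between:
  "eventually (\<lambda>n. sqrt (L n) \<le> std_threshold n \<and> std_threshold n \<le> 2 * std_shift n) sequentially"
  using eventually_std_threshold_sq_bounds eventually_std_threshold_near[OF zero_less_one]
    eventually_std_shift_near
    eventually_sqrt_2_L_ge[of "2 * \<bar>\<gamma>\<bar> + 3"] eventually_L_ge[of 1]
proof eventually_elim
  case (elim n)
  have "2 * L n - ln (L n) - 1 \<le> (std_threshold n)\<^sup>2" using elim(1) scaled_ln_L_bounds[OF elim(5)]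
    by auto
  moreover have "ln (L n) \<le> L n - 1" using elim(5) by (intro ln_le_minus_one) simp
  ultimately have "L n \<le> (std_threshold n)\<^sup>2" by linarith
  then have "sqrt (L n) \<le> std_threshold n" using elim(1) real_le_lsqrt by blast
  then show ?case using elim(2-4) by (simp add: abs_le_iff)
qed

lemma eventually_sqrt_D_ge: "eventually (\<lambda>n. c \<le> sqrt (D n)) sequentially"
  using sqrt_D_at_top by (simp add: filterlim_at_top)

lemma eventually_sqrt_D_le_K: "eventually (\<lambda>n. sqrt (D n) \<le> K n) sequentially"
  using eventually_std_shift_ge[of 1] eventually_D_pos
  by eventually_elim (simp add: std_shift_def)

subsection \<open>Hypergeometric laws in the regime\<close>

text \<open>The mean of \<open>hypergeometric_pmf (N - j) (n - 1 - j) (m - j)\<close>: for \<open>j = 0\<close> this is the degree of a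
vertex in the null model, for \<open>j = k\<close> the number of edges that the hub receives besides its planted ones.\<close>

definition residual_mean :: "nat \<Rightarrow> nat \<Rightarrow> real" where
  "residual_mean n j = real (n - 1 - j) * real (m n - j) / real (N_pairs n - j)"

lemma residual_mean_0:
  assumes "2 \<le> n"
  shows "residual_mean n 0 = D n"
  using assms by (simp add: residual_mean_def mean_degree_def real_N_pairs of_nat_diff)

lemma residual_mean_le:
  assumes "j < n - 1" "n - 1 \<le> m n" "m n \<le> N_pairs n"
  shows "residual_mean n j \<le> D n"
proof -
  have "residual_mean n j = (real (n - 1) - real j) * ((real (m n) - real j) / (N n - real j))"
    using assms by (simp add: residual_mean_def of_nat_diff)
  also have "\<dots> \<le> real (n - 1) * (real (m n) / N n)"
    using assms by (intro mult_mono) (auto simp: field_simps intro!: mult_left_mono)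
  also have "\<dots> = D n"
    using mean_degree_N_pairs[of n "m n"] assms by (simp add: field_simps)
  finally show ?thesis .
qed

lemma residual_mean_ge:
  assumes "j < n - 1" "n - 1 \<le> m n" "m n \<le> N_pairs n"
    and small: "2 * real j * sqrt (D n) \<le> real (n - 1)"
  shows "D n \<le> residual_mean n j + sqrt (D n)"
proof -
  define M where "M = real (n - 1)"
  let ?m = "real (m n)" and ?j = "real j"
  have pos: "0 < M" "?j < M" "M \<le> ?m" "?m \<le> N n" "?j < N n"
    using assms by (auto simp: M_def)
  have D_eq: "D n = M * ?m / N n"
    using mean_degree_N_pairs[of n "m n"] pos assms(1) by (simp add: M_def field_simps)
  have "?j * M \<le> ?j * ?m" "0 \<le> ?j * ?j" using pos by (auto intro: mult_left_mono)
  moreover have "(M - ?j) * (?m - ?j) = M * ?m - ?j * M - ?j * ?m + ?j * ?j" by algebra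
  ultimately have "M * ?m - 2 * ?j * ?m \<le> (M - ?j) * (?m - ?j)" by linarith
  then have "(M * ?m - 2 * ?j * ?m) / N n \<le> (M - ?j) * (?m - ?j) / N n"
    using pos by (intro divide_right_mono) auto
  also have "\<dots> \<le> (M - ?j) * (?m - ?j) / (N n - ?j)"
    using pos by (intro divide_left_mono mult_nonneg_nonneg mult_pos_pos) auto
  also have "\<dots> = residual_mean n j"
    using assms by (simp add: residual_mean_def M_def of_nat_diff)
  finally have "D n - 2 * ?j * ?m / N n \<le> residual_mean n j" by (simp add: D_eq diff_divide_distrib)
  moreover have "2 * ?j * ?m / N n \<le> sqrt (D n)"
  proof -
    have "2 * ?j * ?m / N n = 2 * ?j * D n / M" using pos by (simp add: D_eq)
    also have "\<dots> = (2 * ?j * sqrt (D n) / M) * sqrt (D n)"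
      using D_nonneg[of n] by (simp add: mult.assoc)
    also have "\<dots> \<le> 1 * sqrt (D n)"
      using small pos D_nonneg[of n] by (intro mult_right_mono) (auto simp: M_def)
    finally show ?thesis by simp
  qed
  ultimately show ?thesis by linarith
qed

lemma eventually_residual_mean:
  "eventually (\<lambda>n. \<forall>j\<le>k n. 4 \<le> residual_mean n j \<and> residual_mean n j \<le> D n
     \<and> D n \<le> residual_mean n j + sqrt (D n) \<and> sqrt (D n) \<le> 2 * sqrt (residual_mean n j)) sequentially"
  using eventually_sizes eventually_sqrt_D_le_K eventually_sqrt_D_ge[of 4]
proof eventually_elim
  case (elim n)
  show ?case
  proof (intro allI impI)
    fix j assume j: "j \<le> k n"
    have "real j * sqrt (D n) \<le> (K n)\<^sup>2"
      unfolding power2_eq_square using elim j D_nonneg[of n] by (intro mult_mono) auto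
    moreover have "8 * (K n)\<^sup>2 \<le> real (n - 1)" using elim by blast
    moreover have "0 \<le> (K n)\<^sup>2" by simp
    ultimately have "2 * real j * sqrt (D n) \<le> real (n - 1)" by linarith
    moreover have "j < n - 1" using elim j by auto
    ultimately have bounds: "residual_mean n j \<le> D n" "D n \<le> residual_mean n j + sqrt (D n)"
      using elim by (auto intro!: residual_mean_le residual_mean_ge)
    have "4 * sqrt (D n) \<le> sqrt (D n) * sqrt (D n)" using elim D_nonneg[of n]
      by (intro mult_right_mono) auto
    then have D: "4 * sqrt (D n) \<le> D n" using D_nonneg[of n] by simp
    then have "D n \<le> 4 * residual_mean n j" "4 \<le> residual_mean n j" using bounds elim by linarith+
    moreover from this have "sqrt (D n) \<le> sqrt (4 * residual_mean n j)" by (intro real_sqrt_le_mono)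
    ultimately show "4 \<le> residual_mean n j \<and> residual_mean n j \<le> D n
        \<and> D n \<le> residual_mean n j + sqrt (D n) \<and> sqrt (D n) \<le> 2 * sqrt (residual_mean n j)"
      using bounds by (simp add: real_sqrt_mult)
  qed
qed

lemma eventually_hypergeometric_central:
  assumes "1 \<le> A"
  shows "eventually (\<lambda>n. \<forall>j\<le>k n. hypergeometric_central (N_pairs n - j) (n - 1 - j) (m n - j)
     (residual_mean n j) (sqrt (residual_mean n j)) A) sequentially"
proof -
  have "0 < 1 / (4 * (3 * A + 4))" using assms by simp
  from eventually_D_le[OF this] eventually_residual_mean eventually_sizes show ?thesis
  proof eventually_elim
    case (elim n)
    show ?case
    proof (intro allI impI)
      fix j assume j: "j \<le> k n"
      have mean: "4 \<le> residual_mean n j" "residual_mean n j \<le> D n" using elim j by auto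
      have "(3 * A + 4) * residual_mean n j \<le> (3 * A + 4) * (1 / (4 * (3 * A + 4)) * real n)"
        using elim mean assms by (intro mult_left_mono) auto
      also have "\<dots> = real n / 4" using assms by (simp add: field_simps)
      finally have A_le: "(3 * A + 4) * residual_mean n j \<le> real n / 4" .
      have real: "real (n - 1 - j) = real n - 1 - real j" "real (m n - j) = real (m n) - real j"
        "real (N_pairs n - j) = N n - real j"
        using elim j by (auto simp: of_nat_diff)
      have sizes: "2 * real j \<le> real n - 1" "2 * real (m n) + 2 * real n \<le> N n" "32 \<le> real n"
          "real n - 1 \<le> real (m n)"
        using elim j by (auto simp: of_nat_diff)
      show "hypergeometric_central (N_pairs n - j) (n - 1 - j) (m n - j)
          (residual_mean n j) (sqrt (residual_mean n j)) A"
      proof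
        show "n - 1 - j \<le> m n - j" "n - 1 - j + (m n - j) \<le> N_pairs n - j" using elim j by auto
        show "real (n - 1 - j) * real (m n - j) = residual_mean n j * real (N_pairs n - j)"
          using sizes real by (simp add: residual_mean_def)
        show "residual_mean n j = sqrt (residual_mean n j) * sqrt (residual_mean n j)" using mean
          by simp
        show "2 \<le> sqrt (residual_mean n j)" using real_sqrt_le_mono[OF mean(1)] by simp
        show "(3 * A + 4) * residual_mean n j \<le> real (n - 1 - j)" using A_le sizes real by linarith
        show "(3 * A + 4) * residual_mean n j
              \<le> real (N_pairs n - j) - real (n - 1 - j) - real (m n - j)"
          using A_le sizes real by linarith
      qed (fact assms)
    qed
  qed
qed

abbreviation "degree_pmf n \<equiv> hypergeometric_pmf (N_pairs n) (n - 1) (m n)"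
abbreviation "hub_pmf n \<equiv> hub_degree_pmf n (m n) (k n)"

lemma prob_hub_pmf:
  "measure_pmf.prob (hub_pmf n) {d. Q (real d)}
   = measure_pmf.prob (hypergeometric_pmf (N_pairs n - k n) (n - 1 - k n) (m n - k n)) {d. Q (real d + K n)}"
  by (simp add: hub_degree_pmf_def vimage_def add.commute)

lemma eventually_threshold_excess_bounds:
  "eventually (\<lambda>n. 1 \<le> std_threshold n * sqrt (D n) \<and> std_threshold n * sqrt (D n) + 1 \<le> D n
     \<and> (std_threshold n * sqrt (D n) + 1) ^ 3 \<le> (D n)\<^sup>2) sequentially"
  using eventually_std_threshold_between eventually_K_le[of "1/3", simplified]
    eventually_K_cubed_le[of "1/27", simplified] eventually_sqrt_D_ge[of 2] eventually_L_ge[of 1] eventually_D_pos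
proof eventually_elim
  case (elim n)
  have z: "1 \<le> std_threshold n" "std_threshold n \<le> 2 * std_shift n"
    using elim(1,5) order_trans[of 1 "sqrt (L n)" "std_threshold n"] by auto
  have "1 * 1 \<le> std_threshold n * sqrt (D n)" using z elim(4) by (intro mult_mono) linarith+
  then have ge: "1 \<le> std_threshold n * sqrt (D n)" by simp
  have "std_threshold n * sqrt (D n) \<le> 2 * K n"
    using z elim(6) by (simp add: K_eq_std_shift)
  then have le: "std_threshold n * sqrt (D n) + 1 \<le> 3 * K n" using K_ge_1[of n] by linarith
  have "(std_threshold n * sqrt (D n) + 1) ^ 3 \<le> (3 * K n) ^ 3" using le ge by (intro power_mono) auto
  also have "\<dots> \<le> (D n)\<^sup>2" using elim(3) by (simp add: power_mult_distrib)
  finally show ?case using ge le elim(2) by simp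
qed

lemma eventually_degree_tail_le:
  "eventually (\<lambda>n. real n * measure_pmf.prob (degree_pmf n) {d. t_star \<alpha> n (m n) \<le> real d}
     \<le> 8 * exp 6 * (L n powr (1 / (2 * \<alpha>) - 1 / 2))) sequentially"
  using eventually_hypergeometric_central[OF order_refl] eventually_std_threshold_sq_bounds
    eventually_std_threshold_between
    eventually_threshold_excess_bounds eventually_D_pos eventually_L_ge[of 1] eventually_sizes
proof eventually_elim
  case (elim n)
  have "residual_mean n 0 = D n" using elim(7) by (intro residual_mean_0) simp
  with elim(1)[rule_format, of 0]
  interpret hypergeometric_central "N_pairs n" "n - 1" "m n" "D n" "sqrt (D n)" 1 by simp
  define z Y where "z = std_threshold n" and "Y = z * sqrt (D n)"
  have D: "0 < D n" "0 < sqrt (D n)" using elim(5) by auto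
  have z: "sqrt (L n) \<le> z" "L n - ln (L n) / (2 * \<alpha>) - 1 / 2 \<le> z\<^sup>2 / 2"
    using elim(2,3) by (auto simp: z_def)
  have Y: "1 \<le> Y" "Y + 1 \<le> D n" "(Y + 1) ^ 3 \<le> (D n)\<^sup>2" "Y\<^sup>2 / (2 * D n) = z\<^sup>2 / 2"
    using elim(4) D by (auto simp: Y_def z_def power_mult_distrib)
  have cubic: "(Y + 1) ^ 3 / (D n)\<^sup>2 \<le> 1" using Y D by (simp add: divide_le_eq)
  have sqrt_L: "1 \<le> sqrt (L n)" using elim(6) by simp
  then have "0 \<le> z" using z(1) by linarith
  have "measure_pmf.prob (degree_pmf n) {d. t_star \<alpha> n (m n) \<le> real d}
      = measure_pmf.prob (degree_pmf n) {d. D n + Y \<le> real d}"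
    using D by (simp add: t_star_eq Y_def z_def)
  also have "\<dots> \<le> 8 * exp (9 / 2) * sqrt (D n) / Y * exp ((Y + 1) ^ 3 / (D n)\<^sup>2 - Y\<^sup>2 / (2 * D n))"
    using prob_upper_tail_le[OF Y(1,2)] by simp
  also have "8 * exp (9 / 2) * sqrt (D n) / Y = 8 * exp (9 / 2) * (1 / z)" using D by (simp add: Y_def)
  also have "\<dots> * exp ((Y + 1) ^ 3 / (D n)\<^sup>2 - Y\<^sup>2 / (2 * D n))
      \<le> 8 * exp (9 / 2) * (1 / sqrt (L n)) * exp (3 / 2 - L n + ln (L n) / (2 * \<alpha>))"
  proof (intro mult_mono mult_left_mono frac_le)
    show "exp ((Y + 1) ^ 3 / (D n)\<^sup>2 - Y\<^sup>2 / (2 * D n)) \<le> exp (3 / 2 - L n + ln (L n) / (2 * \<alpha>))"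
      unfolding exp_le_cancel_iff using cubic z Y(4) by linarith
    show "sqrt (L n) \<le> z" "0 < sqrt (L n)" using z sqrt_L by linarith+
  qed (use elim(6) \<open>0 \<le> z\<close> in auto)
  also have "\<dots> = 8 * (exp (9 / 2) * exp (3 / 2)) * (exp (ln (L n) / (2 * \<alpha>)) / sqrt (L n)) / real n"
    using elim(7) by (simp add: exp_add exp_diff)
  also have "exp (9 / 2) * exp (3 / 2 :: real) = exp 6" by (simp flip: exp_add)
  also have "exp (ln (L n) / (2 * \<alpha>)) / sqrt (L n) = L n powr (1 / (2 * \<alpha>) - 1 / 2)"
    using elim(6) by (simp add: powr_diff powr_half_sqrt) (simp add: powr_def)
  finally show ?case using elim(7) by (simp add: field_simps)
qed

text \<open>This is where \<open>\<alpha> > 1\<close> is needed: a union bound over the vertices costs a factor \<open>n\<close>, while the tail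
at the threshold is of order \<open>(log n) powr (1 / (2 * \<alpha>) - 1 / 2) / n\<close>.\<close>

lemma n_degree_tail_tendsto_0:
  "(\<lambda>n. real n * measure_pmf.prob (degree_pmf n) {d. t_star \<alpha> n (m n) \<le> real d}) \<longlonglongrightarrow> 0"
proof (rule tendsto_sandwich[OF _ eventually_degree_tail_le tendsto_const])
  have "1 / (2 * \<alpha>) - 1 / 2 < 0" using alpha by (simp add: field_simps)
  then have "(\<lambda>n. L n powr (1 / (2 * \<alpha>) - 1 / 2)) \<longlonglongrightarrow> 0"
    by (rule tendsto_neg_powr[OF _ L_at_top])
  then show "(\<lambda>n. 8 * exp 6 * (L n powr (1 / (2 * \<alpha>) - 1 / 2))) \<longlonglongrightarrow> 0"
    by (rule tendsto_mult_right_zero)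
qed simp

subsection \<open>The degree of the hub\<close>

lemma eventually_prob_hub_window_le:
  assumes "0 < \<epsilon>"
  shows "eventually (\<lambda>n. measure_pmf.prob (hub_pmf n) {d. t_star \<alpha> n (m n) - \<epsilon> * sqrt (D n) \<le> real d
      \<and> real d < t_star \<alpha> n (m n) + \<epsilon> * sqrt (D n)} \<le> 24 * exp 4 * \<epsilon>) sequentially"
  using eventually_hypergeometric_central[OF order_refl] eventually_residual_mean
    eventually_sqrt_D_ge[of "1 / \<epsilon>"]
proof eventually_elim
  case (elim n)
  interpret hypergeometric_central "N_pairs n - k n" "n - 1 - k n" "m n - k n"
    "residual_mean n (k n)" "sqrt (residual_mean n (k n))" 1
    using elim(1) by simp
  define a b where "a = t_star \<alpha> n (m n) - \<epsilon> * sqrt (D n) - K n"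
    and "b = t_star \<alpha> n (m n) + \<epsilon> * sqrt (D n) - K n"
  have D: "1 \<le> \<epsilon> * sqrt (D n)" using elim(3) assms by (simp add: field_simps)
  have r: "sqrt (D n) \<le> 2 * sqrt (residual_mean n (k n))" "0 < sqrt (residual_mean n (k n))"
    using elim(2) r_ge by auto
  have "measure_pmf.prob (hub_pmf n) {d. t_star \<alpha> n (m n) - \<epsilon> * sqrt (D n) \<le> real d
      \<and> real d < t_star \<alpha> n (m n) + \<epsilon> * sqrt (D n)}
    = measure_pmf.prob (hypergeometric_pmf (N_pairs n - k n) (n - 1 - k n) (m n - k n)) {d. a \<le> real d \<and> real d < b}"
    unfolding prob_hub_pmf[where Q = "\<lambda>x. _ \<le> x \<and> x < _"] by (simp add: a_def b_def algebra_simps)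
  also have "\<dots> \<le> (b - a + 1) * (4 * exp ((1 + 3) * 1) / sqrt (residual_mean n (k n)))"
    using D by (intro prob_window_le) (simp add: a_def b_def)
  also have "\<dots> \<le> (3 * (\<epsilon> * (2 * sqrt (residual_mean n (k n)))))
        * (4 * exp ((1 + 3) * 1) / sqrt (residual_mean n (k n)))"
  proof (intro mult_right_mono)
    have "b - a + 1 \<le> 3 * (\<epsilon> * sqrt (D n))" using D by (simp add: a_def b_def)
    also have "\<dots> \<le> 3 * (\<epsilon> * (2 * sqrt (residual_mean n (k n))))" using r assms
      by (intro mult_left_mono) auto
    finally show "b - a + 1 \<le> 3 * (\<epsilon> * (2 * sqrt (residual_mean n (k n))))" .
  qed (use r in simp)
  also have "\<dots> = 24 * exp 4 * \<epsilon>" using r(2) by simp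
  finally show ?case .
qed

lemma eventually_prob_hub_above_threshold_ge:
  obtains c\<^sub>0 where "0 < c\<^sub>0"
    "eventually (\<lambda>n. c\<^sub>0 \<le> measure_pmf.prob (hub_pmf n) {d. t_star \<alpha> n (m n) \<le> real d}) sequentially"
proof -
  define A where "A = 2 * \<bar>\<gamma>\<bar> + 7"
  have "1 \<le> A" by (simp add: A_def)
  have "eventually (\<lambda>n. exp (- ((A + 3) * A)) / 48
      \<le> measure_pmf.prob (hub_pmf n) {d. t_star \<alpha> n (m n) \<le> real d}) sequentially"
    using eventually_hypergeometric_central[OF \<open>1 \<le> A\<close>] eventually_residual_mean
      eventually_std_threshold_near[OF zero_less_one] eventually_std_shift_near eventually_D_pos
  proof eventually_elim
    case (elim n)
    interpret hypergeometric_central "N_pairs n - k n" "n - 1 - k n" "m n - k n"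
      "residual_mean n (k n)" "sqrt (residual_mean n (k n))" A
      using elim(1) by simp
    let ?r = "sqrt (residual_mean n (k n))"
    have D: "D n \<le> residual_mean n (k n) + sqrt (D n)" "sqrt (D n) \<le> 2 * ?r" using elim(2) by auto
    have "std_threshold n \<le> std_shift n + (\<bar>\<gamma>\<bar> + 2)" using elim(3,4) by linarith
    then have "std_threshold n * sqrt (D n) \<le> (std_shift n + (\<bar>\<gamma>\<bar> + 2)) * sqrt (D n)"
      using D_nonneg by (intro mult_right_mono) auto
    then have "t_star \<alpha> n (m n) - K n \<le> residual_mean n (k n) + (\<bar>\<gamma>\<bar> + 3) * sqrt (D n)"
      using D(1) elim(5) by (simp add: t_star_eq K_eq_std_shift algebra_simps)
    also have "(\<bar>\<gamma>\<bar> + 3) * sqrt (D n) \<le> (\<bar>\<gamma>\<bar> + 3) * (2 * ?r)" using D by (intro mult_left_mono) auto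
    also have "\<dots> = (A - 1) * ?r" by (simp add: A_def algebra_simps)
    finally have t_le: "t_star \<alpha> n (m n) \<le> residual_mean n (k n) + (A - 1) * ?r + K n" by simp
    have "exp (- ((A + 3) * A)) / 48 \<le> measure_pmf.prob (hypergeometric_pmf (N_pairs n - k n) (n - 1 - k n) (m n - k n))
        {d. residual_mean n (k n) + (A - 1) * ?r \<le> real d}"
      by (rule prob_above_mean_ge)
    also have "\<dots> \<le> measure_pmf.prob (hypergeometric_pmf (N_pairs n - k n) (n - 1 - k n) (m n - k n))
        {d. t_star \<alpha> n (m n) \<le> real d + K n}"
      using t_le by (intro measure_pmf.finite_measure_mono) auto
    finally show ?case unfolding prob_hub_pmf[where Q = "\<lambda>x. _ \<le> x"] .
  qed
  then show thesis by (rule that[rotated]) simp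
qed

subsection \<open>The weight around the threshold\<close>

lemma hub_exponent_eq:
  assumes "0 < D n"
  shows "K n * x / D n - (K n)\<^sup>2 / (2 * D n) = std_shift n * (x / sqrt (D n)) - (std_shift n)\<^sup>2 / 2"
  using assms by (simp add: std_shift_def power_divide)

lemma eventually_hub_weight_le:
  "eventually (\<lambda>n. \<forall>d. real n * hub_weight n (m n) (k n) d
     \<le> exp (std_shift n * ((real d - D n) / sqrt (D n)) - (std_shift n)\<^sup>2 / 2 + 1)) sequentially"
  using eventually_planted_model eventually_sizes eventually_K_le[OF zero_less_one] eventually_D_pos
proof eventually_elim
  case (elim n)
  interpret model: planted_model n "m n" "k n" by fact
  have pos: "0 < real (n - 1)" "8 * (K n)\<^sup>2 \<le> real (n - 1)" using elim(2) by auto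
  have "4 * (K n)\<^sup>2 / real (n - 1) \<le> 1 / 2" unfolding pos_divide_le_eq[OF pos(1)] using pos(2)
    by linarith
  moreover have "K n / (2 * D n) \<le> 1 / 2" using elim by (simp add: divide_le_eq)
  ultimately have "K n / (2 * D n) + 4 * (K n)\<^sup>2 / real (n - 1) \<le> 1 / 2 + 1 / 2" by (intro add_mono)
  then have error: "K n / (2 * D n) + 4 * (K n)\<^sup>2 / real (n - 1) \<le> 1"
    by (simp only: field_sum_of_halves)
  show ?case
  proof
    fix d
    have "real n * hub_weight n (m n) (k n) d \<le> exp (K n * (real d - D n) / D n - (K n)\<^sup>2 / (2 * D n)
        + K n / (2 * D n) + 4 * (K n)\<^sup>2 / real (n - 1))"
      using elim by (intro model.hub_weight_le_exp) auto
    also have "\<dots> \<le> exp (std_shift n * ((real d - D n) / sqrt (D n)) - (std_shift n)\<^sup>2 / 2 + 1)"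
      unfolding hub_exponent_eq[OF elim(4)] exp_le_cancel_iff
      using error by (simp only: add.assoc add_le_cancel_left)
    finally show "real n * hub_weight n (m n) (k n) d
        \<le> exp (std_shift n * ((real d - D n) / sqrt (D n)) - (std_shift n)\<^sup>2 / 2 + 1)" .
  qed
qed

lemma eventually_hub_weight_ge:
  "eventually (\<lambda>n. \<forall>d. D n \<le> real d \<longrightarrow> real d \<le> D n + 4 * K n \<longrightarrow>
     exp (std_shift n * ((real d - D n) / sqrt (D n)) - (std_shift n)\<^sup>2 / 2 - 1)
     \<le> real n * hub_weight n (m n) (k n) d) sequentially"
  using eventually_planted_model eventually_sizes eventually_K_le[of "1/8", simplified]
    eventually_K_cubed_le[of "1/64", simplified] eventually_D_pos
proof eventually_elim
  case (elim n)
  interpret model: planted_model n "m n" "k n" by fact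
  have N: "8 * (K n)\<^sup>2 \<le> N n" "n - 1 \<le> N_pairs n" "0 < N n" using elim(2) by auto
  have "2 * K n * (4 * K n)\<^sup>2 = 32 * K n ^ 3" by (simp add: power2_eq_square power3_eq_cube)
  then have "2 * K n * (4 * K n)\<^sup>2 / (D n)\<^sup>2 \<le> 1 / 2" "2 * (K n)\<^sup>2 / N n \<le> 1 / 2"
    using elim N by (simp_all add: divide_le_eq)
  then have error: "2 * K n * (4 * K n)\<^sup>2 / (D n)\<^sup>2 + 2 * (K n)\<^sup>2 / N n \<le> 1" by linarith
  show ?case
  proof (intro allI impI)
    fix d assume d: "D n \<le> real d" "real d \<le> D n + 4 * K n"
    have "exp (std_shift n * ((real d - D n) / sqrt (D n)) - (std_shift n)\<^sup>2 / 2 - 1)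
        \<le> exp (K n * (real d - D n) / D n - (K n)\<^sup>2 / (2 * D n) - 2 * K n * (4 * K n)\<^sup>2 / (D n)\<^sup>2 - 2 * (K n)\<^sup>2 / N n)"
      unfolding hub_exponent_eq[OF elim(5)] exp_le_cancel_iff using error by linarith
    also have "\<dots> \<le> real n * hub_weight n (m n) (k n) d"
      using elim N d K_ge_1[of n] by (intro model.hub_weight_ge_exp) auto
    finally show "exp (std_shift n * ((real d - D n) / sqrt (D n)) - (std_shift n)\<^sup>2 / 2 - 1)
        \<le> real n * hub_weight n (m n) (k n) d" .
  qed
qed

lemma eventually_hub_weight_small:
  assumes "0 < \<epsilon>" "0 < \<eta>"
  shows "eventually (\<lambda>n. \<forall>d. real d < t_star \<alpha> n (m n) - \<epsilon> * sqrt (D n)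
    \<longrightarrow> hub_weight n (m n) (k n) d \<le> \<eta>) sequentially"
  using eventually_hub_weight_le eventually_std_threshold_near[OF half_gt_zero[OF assms(1)]]
    eventually_std_shift_ge[of "max 1 (2 * (1 - ln \<eta>) / \<epsilon>)"]
    eventually_L_ge[of 1] eventually_D_pos eventually_n_pos
proof eventually_elim
  case (elim n)
  define \<mu> a where "\<mu> = std_shift n" and "a = sqrt (2 * L n)"
  have \<mu>: "1 \<le> \<mu>" "1 - ln \<eta> \<le> \<mu> * (\<epsilon> / 2)" and a: "a\<^sup>2 = 2 * L n"
    using elim assms by (auto simp: \<mu>_def a_def field_simps)
  show ?case
  proof (intro allI impI)
    fix d assume d: "real d < t_star \<alpha> n (m n) - \<epsilon> * sqrt (D n)"
    define y where "y = (real d - D n) / sqrt (D n)"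
    have "real d - D n \<le> (std_threshold n - \<epsilon>) * sqrt (D n)"
      using d elim(5) by (simp add: t_star_eq left_diff_distrib)
    then have "y \<le> std_threshold n - \<epsilon>" using elim(5) by (simp add: y_def pos_divide_le_eq)
    then have "y \<le> a - \<epsilon> / 2" using elim(2) unfolding a_def by linarith
    then have "\<mu> * y \<le> \<mu> * (a - \<epsilon> / 2)" using \<mu> by (intro mult_left_mono) auto
    moreover have "\<mu> * (a - \<epsilon> / 2) - \<mu>\<^sup>2 / 2 = a\<^sup>2 / 2 - (\<mu> - a)\<^sup>2 / 2 - \<mu> * (\<epsilon> / 2)"
      by (simp add: power2_eq_square field_simps)
    moreover have "0 \<le> (\<mu> - a)\<^sup>2 / 2" by simp
    ultimately have exponent: "\<mu> * y - \<mu>\<^sup>2 / 2 + 1 \<le> L n + ln \<eta>" using \<mu> a by linarith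
    have "real n * hub_weight n (m n) (k n) d \<le> exp (\<mu> * y - \<mu>\<^sup>2 / 2 + 1)"
      using elim(1) by (simp add: \<mu>_def y_def)
    also have "\<dots> \<le> exp (L n + ln \<eta>)" using exponent by simp
    also have "\<dots> = real n * \<eta>" using elim(6) assms by (simp add: exp_add)
    finally show "hub_weight n (m n) (k n) d \<le> \<eta>" using elim(6) by simp
  qed
qed

lemma eventually_hub_weight_large:
  assumes "0 < \<epsilon>" "\<epsilon> \<le> 1"
  shows "eventually (\<lambda>n. \<forall>d. t_star \<alpha> n (m n) + \<epsilon> * sqrt (D n) \<le> real d
    \<longrightarrow> 1 \<le> hub_weight n (m n) (k n) d) sequentially"
  using eventually_hub_weight_ge eventually_std_threshold_near[OF half_gt_zero[OF assms(1)]]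
    eventually_std_shift_near eventually_std_threshold_between
    eventually_std_shift_ge[of "max 1 (((\<bar>\<gamma>\<bar> + 1)\<^sup>2 + 2) / \<epsilon>)"]
    eventually_L_ge[of 1] eventually_D_pos eventually_n_pos
proof eventually_elim
  case (elim n)
  define \<mu> a where "\<mu> = std_shift n" and "a = sqrt (2 * L n)"
  define d\<^sub>1 where "d\<^sub>1 = nat \<lceil>t_star \<alpha> n (m n) + \<epsilon> * sqrt (D n)\<rceil>"
  define y where "y = (real d\<^sub>1 - D n) / sqrt (D n)"
  have \<mu>: "1 \<le> \<mu>" "(\<bar>\<gamma>\<bar> + 1)\<^sup>2 / 2 + 1 \<le> \<mu> * (\<epsilon> / 2)" and a: "a\<^sup>2 = 2 * L n"
    using elim assms by (auto simp: \<mu>_def a_def field_simps)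
  have s: "t_star \<alpha> n (m n) + \<epsilon> * sqrt (D n) = D n + (std_threshold n + \<epsilon>) * sqrt (D n)"
    using elim(7) by (simp add: t_star_eq distrib_right)
  have z: "0 \<le> std_threshold n" "std_threshold n \<le> 2 * \<mu>"
    using elim(4,6) order_trans[of 0 "sqrt (L n)" "std_threshold n"] by (auto simp: \<mu>_def)
  have nonneg: "0 \<le> (std_threshold n + \<epsilon>) * sqrt (D n)" using z assms D_nonneg[of n] by simp
  then have d\<^sub>1: "D n + (std_threshold n + \<epsilon>) * sqrt (D n) \<le> real d\<^sub>1"
      "real d\<^sub>1 \<le> D n + (std_threshold n + \<epsilon>) * sqrt (D n) + 1"
    using D_nonneg[of n] unfolding d\<^sub>1_def s by linarith+
  have "(std_threshold n + \<epsilon>) * sqrt (D n) \<le> 3 * \<mu> * sqrt (D n)"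
    using z assms \<mu> D_nonneg[of n] by (intro mult_right_mono) auto
  also have "\<dots> = 3 * K n" using elim(7) by (simp add: K_eq_std_shift \<mu>_def)
  finally have range: "D n \<le> real d\<^sub>1" "real d\<^sub>1 \<le> D n + 4 * K n"
    using d\<^sub>1 nonneg K_ge_1[of n] by linarith+
  have "std_threshold n + \<epsilon> \<le> y" using d\<^sub>1 elim(7) by (simp add: y_def pos_le_divide_eq)
  then have "a + \<epsilon> / 2 \<le> y" using elim(2) unfolding a_def by linarith
  then have "\<mu> * (a + \<epsilon> / 2) \<le> \<mu> * y" using \<mu> by (intro mult_left_mono) auto
  moreover have "\<mu> * (a + \<epsilon> / 2) - \<mu>\<^sup>2 / 2 = a\<^sup>2 / 2 - (\<mu> - a)\<^sup>2 / 2 + \<mu> * (\<epsilon> / 2)"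
    by (simp add: power2_eq_square field_simps)
  moreover have "(\<mu> - a)\<^sup>2 \<le> (\<bar>\<gamma>\<bar> + 1)\<^sup>2"
    using elim(3) power_mono[of "\<bar>\<mu> - a\<bar>" "\<bar>\<gamma>\<bar> + 1" 2] by (simp add: \<mu>_def a_def)
  ultimately have "L n \<le> \<mu> * y - \<mu>\<^sup>2 / 2 - 1" using \<mu> a by linarith
  then have "exp (L n) \<le> exp (\<mu> * y - \<mu>\<^sup>2 / 2 - 1)" by simp
  also have "\<dots> \<le> real n * hub_weight n (m n) (k n) d\<^sub>1"
    using elim(1) range by (simp add: \<mu>_def y_def)
  finally have weight: "1 \<le> hub_weight n (m n) (k n) d\<^sub>1" using elim(8) by simp
  show ?case
  proof (intro allI impI)
    fix d assume "t_star \<alpha> n (m n) + \<epsilon> * sqrt (D n) \<le> real d"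
    then have "d\<^sub>1 \<le> d" unfolding d\<^sub>1_def by linarith
    then show "1 \<le> hub_weight n (m n) (k n) d" using weight hub_weight_mono order_trans by blast
  qed
qed

subsection \<open>Concentration of the light part of the likelihood ratio\<close>

definition cutoff :: "nat \<Rightarrow> nat" where
  "cutoff n = nat \<lfloor>t_star \<alpha> n (m n)\<rfloor>"

lemma le_cutoff: "real d < t_star \<alpha> n (m n) \<Longrightarrow> d \<le> cutoff n"
  unfolding cutoff_def by linarith

lemma eventually_cutoff_le:
  "eventually (\<lambda>n. 0 \<le> t_star \<alpha> n (m n) \<and> real (cutoff n) \<le> 2 * D n) sequentially"
  using eventually_std_threshold_between eventually_K_le[of "1/2", simplified]
    eventually_L_ge[of 1] eventually_D_pos
proof eventually_elim
  case (elim n)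
  have "std_threshold n * sqrt (D n) \<le> 2 * std_shift n * sqrt (D n)"
    using elim by (intro mult_right_mono) auto
  also have "\<dots> = 2 * K n" using elim by (simp add: K_eq_std_shift)
  finally have "t_star \<alpha> n (m n) \<le> 2 * D n" using elim by (simp add: t_star_eq)
  moreover have "0 \<le> std_threshold n"
    using elim order_trans[of 0 "sqrt (L n)" "std_threshold n"] by simp
  then have "0 \<le> t_star \<alpha> n (m n)" using elim by (simp add: t_star_eq)
  ultimately show ?case unfolding cutoff_def by linarith
qed

lemma eventually_sparse_degrees: "eventually (\<lambda>n. sparse_degrees n (m n) (cutoff n)) sequentially"
  using eventually_cutoff_le eventually_sizes eventually_D_le[of "1/16", simplified]
proof eventually_elim
  case (elim n)
  have "0 < m n" using elim(2) by auto
  have "D n * 32 \<le> D n * real n" using elim D_nonneg by (intro mult_left_mono) auto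
  also have "\<dots> = 2 * real (m n)" using elim by (simp add: mean_degree_def)
  finally have "real (4 * cutoff n) \<le> real (m n)" "real (2 * cutoff n + 2) \<le> real n" using elim by auto
  then show ?case using elim \<open>0 < m n\<close> by (simp add: sparse_degrees_def del: of_nat_mult of_nat_add)
qed

definition dependence_factor :: "nat \<Rightarrow> real" where
  "dependence_factor n = exp (11 * (real (cutoff n))\<^sup>2 / real (m n))
     / (1 - 2 * measure_pmf.prob (degree_pmf n) {cutoff n<..})"

lemma prob_above_cutoff_tendsto_0: "(\<lambda>n. measure_pmf.prob (degree_pmf n) {cutoff n<..}) \<longlonglongrightarrow> 0"
proof (rule tendsto_sandwich[OF _ _ tendsto_const n_degree_tail_tendsto_0])
  show "eventually (\<lambda>n. measure_pmf.prob (degree_pmf n) {cutoff n<..}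
      \<le> real n * measure_pmf.prob (degree_pmf n) {d. t_star \<alpha> n (m n) \<le> real d}) sequentially"
    using eventually_n_ge[of 1]
  proof eventually_elim
    case (elim n)
    have "t_star \<alpha> n (m n) \<le> real d" if "cutoff n < d" for d
      using le_cutoff[of d n] that by linarith
    then have "measure_pmf.prob (degree_pmf n) {cutoff n<..}
          \<le> 1 * measure_pmf.prob (degree_pmf n) {d. t_star \<alpha> n (m n) \<le> real d}"
      by (auto intro!: measure_pmf.finite_measure_mono)
    also have "\<dots> \<le> real n * measure_pmf.prob (degree_pmf n) {d. t_star \<alpha> n (m n) \<le> real d}"
      using elim by (intro mult_right_mono) auto
    finally show ?case .
  qed
qed simp

lemma cutoff_sq_over_m_tendsto_0: "(\<lambda>n. 11 * (real (cutoff n))\<^sup>2 / real (m n)) \<longlonglongrightarrow> 0"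
proof (rule tendsto_sandwich[OF _ _ tendsto_const])
  show "(\<lambda>n. 88 * (D n / real n)) \<longlonglongrightarrow> 0" using tendsto_mult_right_zero[OF D_over_n_tendsto_0] .
  show "eventually (\<lambda>n. 11 * (real (cutoff n))\<^sup>2 / real (m n) \<le> 88 * (D n / real n)) sequentially"
    using eventually_cutoff_le eventually_sizes eventually_D_pos
  proof eventually_elim
    case (elim n)
    have m: "real (m n) = D n * real n / 2" using elim by (simp add: mean_degree_def)
    have "11 * (real (cutoff n))\<^sup>2 \<le> 11 * (2 * D n)\<^sup>2" using elim
      by (intro mult_left_mono power_mono) auto
    then have "11 * (real (cutoff n))\<^sup>2 / real (m n) \<le> 11 * (2 * D n)\<^sup>2 / real (m n)"
      by (rule divide_right_mono) simp
    also have "\<dots> = 88 * (D n / real n)" using elim by (simp add: m power2_eq_square)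
    finally show ?case .
  qed
qed simp

lemma dependence_factor_tendsto_1: "dependence_factor \<longlonglongrightarrow> 1"
proof -
  have "dependence_factor \<longlonglongrightarrow> exp 0 / (1 - 2 * 0)"
    unfolding dependence_factor_def[abs_def]
    by (intro tendsto_intros cutoff_sq_over_m_tendsto_0 prob_above_cutoff_tendsto_0) simp
  then show ?thesis by simp
qed

lemma eventually_second_moment_le:
  assumes "0 < \<epsilon>" "0 < \<eta>"
  shows "eventually (\<lambda>n. measure_pmf.expectation (P0 n (m n))
      (\<lambda>G. (LR_part n (m n) (k n) {d. real d < t_star \<alpha> n (m n) - \<epsilon> * sqrt (D n)} G)\<^sup>2)
    \<le> (measure_pmf.prob (hub_pmf n) {d. real d < t_star \<alpha> n (m n) - \<epsilon> * sqrt (D n)})\<^sup>2 + \<eta>) sequentially"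
proof -
  have "1 < 1 + \<eta> / 2" using assms by simp
  from order_tendstoD(2)[OF dependence_factor_tendsto_1 this]
    order_tendstoD(2)[OF prob_above_cutoff_tendsto_0 half_gt_zero[OF zero_less_one]]
    eventually_hub_weight_small[OF assms(1) half_gt_zero[OF assms(2)]]
    eventually_planted_model eventually_sparse_degrees
  show ?thesis
  proof eventually_elim
    case (elim n)
    interpret model: planted_model n "m n" "k n" by fact
    define S where "S = {d. real d < t_star \<alpha> n (m n) - \<epsilon> * sqrt (D n)}"
    define q where "q = measure_pmf.prob (hub_pmf n) S"
    have "0 \<le> \<epsilon> * sqrt (D n)" using assms D_nonneg[of n] by simp
    then have S_le: "S \<subseteq> {..cutoff n}" using le_cutoff[of _ n] by (auto simp: S_def)
    have q: "0 \<le> q" "q \<le> 1" "q\<^sup>2 \<le> 1" by (auto simp: q_def power_le_one)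
    have "model.E (\<lambda>G. (LR_part n (m n) (k n) S G)\<^sup>2) \<le> \<eta> / 2 * q + dependence_factor n * q\<^sup>2"
      unfolding q_def dependence_factor_def
      using elim S_le by (intro model.second_moment_LR_part_le) (auto simp: S_def)
    also have "\<dots> \<le> \<eta> / 2 * 1 + (1 + \<eta> / 2) * q\<^sup>2"
      using elim q assms by (intro add_mono mult_left_mono mult_right_mono) auto
    also have "(1 + \<eta> / 2) * q\<^sup>2 \<le> q\<^sup>2 + \<eta> / 2"
      using mult_left_mono[OF q(3), of "\<eta> / 2"] assms by (simp add: distrib_right)
    finally show ?case by (simp add: S_def q_def)
  qed
qed

subsection \<open>The symmetric difference is negligible\<close>

abbreviation sym_diff_event :: "nat \<Rightarrow> nat set set set" where
  "sym_diff_event n \<equiv>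
    sym_diff {G. 1 \<le> LR n (m n) (k n) G} {G. t_star \<alpha> n (m n) \<le> real (max_degree n G)}"

lemma eventually_prob_sym_diff_le:
  assumes c\<^sub>0: "0 < c\<^sub>0"
      "eventually (\<lambda>n. c\<^sub>0 \<le> measure_pmf.prob (hub_pmf n) {d. t_star \<alpha> n (m n) \<le> real d}) sequentially"
    and \<epsilon>: "0 < \<epsilon>" "\<epsilon> \<le> 1"
  shows "eventually (\<lambda>n. measure_pmf.prob (P0 n (m n)) (sym_diff_event n)
        \<le> \<epsilon> + 4 / c\<^sub>0\<^sup>2 * \<epsilon> + 2 / c\<^sub>0 * (24 * exp 4 * \<epsilon>)
      \<and> measure_pmf.prob (P1 n (m n) (k n)) (sym_diff_event n)
        \<le> 1 / \<epsilon> * measure_pmf.prob (P0 n (m n)) (sym_diff_event n) + 2 * \<epsilon> + 24 * exp 4 * \<epsilon>) sequentially"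
  using order_tendstoD(2)[OF n_degree_tail_tendsto_0 \<epsilon>(1)] c\<^sub>0(2) eventually_prob_hub_window_le[OF \<epsilon>(1)]
    eventually_hub_weight_large[OF \<epsilon>] eventually_second_moment_le[OF \<epsilon>(1) \<epsilon>(1)] eventually_planted_model
proof eventually_elim
  case (elim n)
  interpret model: planted_model n "m n" "k n" by fact
  define s t s' where "s = t_star \<alpha> n (m n) - \<epsilon> * sqrt (D n)" and "t = t_star \<alpha> n (m n)"
    and "s' = t_star \<alpha> n (m n) + \<epsilon> * sqrt (D n)"
  define window_mass where "window_mass = model.E (LR_part n (m n) (k n) {d. s \<le> real d \<and> real d < s'})"
  have window: "s \<le> t" "t \<le> s'" using \<epsilon> D_nonneg[of n] by (auto simp: s_def t_def s'_def)
  have window_mass: "window_mass \<le> 24 * exp 4 * \<epsilon>"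
    using elim(3) by (simp add: window_mass_def model.expectation_LR_part s_def s'_def)
  have B: "model.P {G. t \<le> real (max_degree n G)} \<le> \<epsilon>"
    using prob_max_degree_ge_le[OF model.n_pos model.m_le, of t] elim(1) by (simp add: t_def)
  interpret detection_window n "m n" "k n" s t s' c\<^sub>0 \<epsilon>
    using window elim c\<^sub>0(1) by unfold_locales (auto simp: s_def t_def s'_def)
  have "4 / c\<^sub>0\<^sup>2 * \<epsilon> + 2 / c\<^sub>0 * window_mass \<le> 4 / c\<^sub>0\<^sup>2 * \<epsilon> + 2 / c\<^sub>0 * (24 * exp 4 * \<epsilon>)"
    using window_mass c\<^sub>0 by (intro add_left_mono mult_left_mono) auto
  then have "measure_pmf.prob (P0 n (m n)) (sym_diff_event n)
      \<le> \<epsilon> + 4 / c\<^sub>0\<^sup>2 * \<epsilon> + 2 / c\<^sub>0 * (24 * exp 4 * \<epsilon>)"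
    using prob_P0_sym_diff_le B unfolding window_mass_def[symmetric] by (simp add: t_def)
  moreover have "measure_pmf.prob (P1 n (m n) (k n)) (sym_diff_event n)
      \<le> 1 / \<epsilon> * measure_pmf.prob (P0 n (m n)) (sym_diff_event n) + 2 * \<epsilon> + 24 * exp 4 * \<epsilon>"
  proof -
    have "measure_pmf.prob (P1 n (m n) (k n)) (sym_diff_event n)
        \<le> 1 / \<epsilon> * measure_pmf.prob (P0 n (m n)) (sym_diff_event n) + (1 + \<epsilon>) / (1 / \<epsilon>) + window_mass"
      using prob_P1_sym_diff_le[of "1 / \<epsilon>"] \<epsilon> unfolding window_mass_def t_def by simp
    also have "(1 + \<epsilon>) / (1 / \<epsilon>) \<le> 2 * \<epsilon>"
      using \<epsilon> mult_left_mono[of \<epsilon> 1 \<epsilon>] by (simp add: distrib_right)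
    finally show ?thesis using window_mass by simp
  qed
  ultimately show ?case by blast
qed

lemma sym_diff_tendsto_0:
  "(\<lambda>n. measure_pmf.prob (P0 n (m n)) (sym_diff_event n)) \<longlonglongrightarrow> 0"
  "(\<lambda>n. measure_pmf.prob (P1 n (m n) (k n)) (sym_diff_event n)) \<longlonglongrightarrow> 0"
proof -
  obtain c\<^sub>0 where c\<^sub>0: "0 < c\<^sub>0"
    "eventually (\<lambda>n. c\<^sub>0 \<le> measure_pmf.prob (hub_pmf n) {d. t_star \<alpha> n (m n) \<le> real d}) sequentially"
    by (rule eventually_prob_hub_above_threshold_ge)
  note bound = eventually_prob_sym_diff_le[OF c\<^sub>0]
  show P0: "(\<lambda>n. measure_pmf.prob (P0 n (m n)) (sym_diff_event n)) \<longlonglongrightarrow> 0"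
  proof (rule tendsto_0_if_eventually_le_mult[where C = "1 + 4 / c\<^sub>0\<^sup>2 + 2 / c\<^sub>0 * (24 * exp 4)"])
    fix \<epsilon> :: real assume "0 < \<epsilon>" "\<epsilon> \<le> 1"
    from bound[OF this] show "eventually (\<lambda>n. measure_pmf.prob (P0 n (m n)) (sym_diff_event n)
        \<le> (1 + 4 / c\<^sub>0\<^sup>2 + 2 / c\<^sub>0 * (24 * exp 4)) * \<epsilon>) sequentially"
      by eventually_elim (simp add: distrib_right)
  qed simp
  show "(\<lambda>n. measure_pmf.prob (P1 n (m n) (k n)) (sym_diff_event n)) \<longlonglongrightarrow> 0"
  proof (rule tendsto_0_if_eventually_le_mult[where C = "3 + 24 * exp 4"])
    fix \<epsilon> :: real assume \<epsilon>: "0 < \<epsilon>" "\<epsilon> \<le> 1"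
    then have "0 < \<epsilon>\<^sup>2" by simp
    from order_tendstoD(2)[OF P0 this] bound[OF \<epsilon>]
    show "eventually (\<lambda>n. measure_pmf.prob (P1 n (m n) (k n)) (sym_diff_event n)
          \<le> (3 + 24 * exp 4) * \<epsilon>) sequentially"
    proof eventually_elim
      case (elim n)
      have "1 / \<epsilon> * measure_pmf.prob (P0 n (m n)) (sym_diff_event n) \<le> 1 / \<epsilon> * \<epsilon>\<^sup>2"
        using elim(1) \<epsilon> by (intro mult_left_mono) auto
      also have "\<dots> = \<epsilon>" using \<epsilon> by (simp add: power2_eq_square)
      finally show ?case using elim(2) by (simp add: distrib_right)
    qed
  qed simp
qed

end

theorem mainTheorem2:
  fixes \<gamma> \<alpha> :: real and k m :: "nat \<Rightarrow> nat"
  assumes "\<alpha> > 1"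
    and "\<forall>n. k n > 0"
    and "(\<lambda>n. (ln (real n))\<^sup>2 / real (k n)) \<longlonglongrightarrow> 0"
    and "(\<lambda>n. real (k n) / sqrt (real n)) \<longlonglongrightarrow> 0"
    and "\<forall>n. m n = nat (round (real (k n) ^ 2 * real n / (4 * ln (real n))
                                 * (1 + \<gamma> / sqrt (ln (real n)))))"
  defines "A \<equiv> \<lambda>n. {G. LR n (m n) (k n) G \<ge> 1}"
    and "B \<equiv> \<lambda>n. {G. real (max_degree n G) \<ge> t_star \<alpha> n (m n)}"
  shows "(\<lambda>n. measure_pmf.prob (P0 n (m n)) ((A n - B n) \<union> (B n - A n))) \<longlonglongrightarrow> 0
       \<and> (\<lambda>n. measure_pmf.prob (P1 n (m n) (k n)) ((A n - B n) \<union> (B n - A n))) \<longlonglongrightarrow> 0"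
proof -
  interpret planted_regime \<gamma> \<alpha> k m
    by (rule planted_regime.intro) (use assms(1-5) in blast)+
  show ?thesis unfolding A_def B_def by (intro conjI sym_diff_tendsto_0)
qed

end
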